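(* Let $(\mathcal{C},\mathcal{N})$ be a homological category and consider a commutative diagram in $\mathcal{C}$ with rows $A\xrightarrow{f}B\xrightarrow{g}C$ and $A'\xrightarrow{f'}B'\xrightarrow{g'}C'$ and vertical morphisms $a:A\to A'$, $b:B\to B'$, $c:C\to C'$ (so $bf=f'a$, $cg=g'b$), where $gf$ and $g'f'$ are null and $b$ is an exact morphism. Let $S$ be the left-hand and $T$ the right-hand square, let $S_0$ be the square with top $\widehat f:\operatorname{Ker}a\to\operatorname{Ker}b$ (induced by $f$), left $\ker a$, right $\ker b$, bottom $f$, and let $T_0$ be the square with top $g'$, left $\operatorname{coker}b$, right $\operatorname{coker}c$, bottom $\check g':\operatorname{Coker}b\to\operatorname{Coker}c$ (induced by $g'$). Let $h:H\to H'$ be the induced morphism of the homologies of the rows. Then the morphisms $p,\varkappa,\beta,\beta',\varkappa',p'$ described in the context, together with the Lambek morphism $\Lambda$, are well defined and form a null sequence $$\operatorname{Im}S_0\xrightarrow{p}H(\operatorname{Ker}a\to\operatorname{Ker}b\to\operatorname{Ker}c)\xrightarrow{\varkappa}\operatorname{Ker}h\xrightarrow{\beta}\operatorname{Im}S\xrightarrow{\Lambda}\operatorname{Ker}T\xrightarrow{\beta'}\operatorname{Coker}h\xrightarrow{\varkappa'}H(\operatorname{Coker}a\to\operatorname{Coker}b\to\operatorname{Coker}c)\xrightarrow{p'}\operatorname{Ker}T_0 .$$ If, moreover, $f$ and $g'$ are exact, then $\operatorname{Im}S_0\cong\operatorname{Ker}S$ and $\operatorname{Ker}T_0\cong\operatorname{Im}T$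 via Lambek morphisms, so that one obtains a null sequence $$\operatorname{Ker}S\xrightarrow{p_1}H(\operatorname{Ker}a\to\operatorname{Ker}b\to\operatorname{Ker}c)\xrightarrow{\varkappa}\operatorname{Ker}h\xrightarrow{\beta}\operatorname{Im}S\xrightarrow{\Lambda}\operatorname{Ker}T\xrightarrow{\beta'}\operatorname{Coker}h\xrightarrow{\varkappa'}H(\operatorname{Coker}a\to\operatorname{Coker}b\to\operatorname{Coker}c)\xrightarrow{p_1'}\operatorname{Im}T .$$
   Context: **Homological categories.** An ideal in a category $\mathcal{C}$ is a class $\mathcal{N}$ of morphisms such that every legitimate composite $hfg$ with $f\in\mathcal{N}$ lies in $\mathcal{N}$; morphisms in $\mathcal{N}$ are called null, and an object $A$ is null if $\mathrm{id}_A\in\mathcal{N}$. The ideal is closed if every null morphism factors through a null object. A kernel of $f:A\to B$ is a morphism $\ker f:\operatorname{Ker}f\to A$ with $f\ker f\in\mathcal{N}$ such that every $x$ with $fx\in\mathcal{N}$ factors uniquely as $x=(\ker f)x'$; the cokernel $\operatorname{coker}f:B\to\operatorname{Coker}f$ is defined dually. $(\mathcal{C},\mathcal{N})$ is semiexact if $\mathcal{N}$ is a closed ideal and every morphism has a kernel and a cokernel. It is homological (in the sense of Grandis) if moreover kernels and cokernels are each closed under composition, and for every kernel $i:A\to B$ and cokernel $q:B\to C$ with $(\operatorname{coker}i)(\ker q)\in\mathcal{N}$ there exist a cokernel $\pi:A\to H$ and a kernel $\iota:H\to C$ with $qi=\iota\pi$. Put $\operatorname{im}f=\ker(\operatorname{coker}f):\operatorname{Im}f\to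 B$ and $\operatorname{coim}f=\operatorname{coker}(\ker f):A\to\operatorname{Coim}f$. Every $f$ factors uniquely as $f=(\operatorname{im}f)\,\overline f\,\operatorname{coim}f$; $f$ is exact if $\overline f$ is an isomorphism (then $\operatorname{Coim}f$ is identified with $\operatorname{Im}f$). A sequence is null if all compositions of two consecutive morphisms are null; $X\xrightarrow{f}Y\xrightarrow{g}Z$ is exact at $Y$ if $\operatorname{im}f=\ker g$. **Homology.** For a null sequence $X\xrightarrow{f}Y\xrightarrow{g}Z$, its homology $H(f,g)$, also written $H(X\to Y\to Z)$, is $\operatorname{Coker}(X\to\operatorname{Ker}g)$, canonically isomorphic (in a homological category) to $\operatorname{Ker}(\operatorname{Coker}f\to Z)$, where $X\to\operatorname{Ker}g$ and $\operatorname{Coker}f\to Z$ are induced by $f$ and $g$; the canonical isomorphism $m$ is the one with $\ker(\operatorname{Coker}f\to Z)\,m\,\operatorname{coker}(X\to\operatorname{Ker}g)=(\operatorname{coker}f)\ker g$. **Lambek invariants.** For a commutative square $S$ with top $f:A\to B$, left $a:A\to C$, right $b:B\to D$, bottom $g:C\to D$: let $M$ be the pullback of $\operatorname{im}b$ and $\operatorname{im}g$, with projection $l_S:M\to\operatorname{Im}b$, and $\lambda_S:A\to M$ the morphism induced by $\overline b(\operatorname{coim}b)f:A\to\operatorname{Im}b$ and $\overline g(\operatorname{coim}g)a:A\to\operatorname{Im}g$; put $\operatorname{Im}S=\operatorname{Coker}\lambda_S$. Let $N$ be the pushout of $\operatorname{coim}a$ and $\operatorname{coim}f$, with coprojection $r_S:\operatorname{Coim}a\to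 N$, and $\rho_S:N\to D$ the morphism induced by $g(\operatorname{im}a)\overline a:\operatorname{Coim}a\to D$ and $b(\operatorname{im}f)\overline f:\operatorname{Coim}f\to D$; put $\operatorname{Ker}S=\operatorname{Ker}\rho_S$. These objects do not change if the square is transposed. If $S,T$ are consecutive squares (as in the claim) with null rows and with exact common vertical morphism $b$, the Lambek morphism $\Lambda_{S,T}:\operatorname{Im}S\to\operatorname{Ker}T$ is the unique morphism with $r_T\,l_S=(\ker\rho_T)\,\Lambda_{S,T}\operatorname{coker}\lambda_S$ (with $\operatorname{Coim}b=\operatorname{Im}b$ via $\overline b$). It is known to be an isomorphism if in addition both rows are exact at the middle. The same applies to two squares stacked vertically, with columns in place of rows and the common horizontal morphism exact. Put $\Lambda=\Lambda_{S,T}$. **The diagram.** Let $g^\flat:\operatorname{Coker}f\to C$ satisfy $g^\flat\operatorname{coker}f=g$, and let $f^\sharp:A\to\operatorname{Ker}g$, $f'^\sharp:A'\to\operatorname{Ker}g'$ satisfy $(\ker g)f^\sharp=f$, $(\ker g')f'^\sharp=f'$. Let $\widehat b:\operatorname{Ker}g\to\operatorname{Ker}g'$ and $\check b:\operatorname{Coker}f\to\operatorname{Coker}f'$ be induced by $b$. The morphism $h:H=\operatorname{Coker}f^\sharp\to H'=\operatorname{Coker}f'^\sharp$ is induced by $\widehat b$ (equivalently, it is induced by $\check b$ on right homologies). Let $\xi:\operatorname{Ker}b\to\operatorname{Ker}\check b$ and $\eta:\operatorname{Ker}\check b\to\operatorname{Ker}c$ be given by $(\ker\check b)\xi=(\operatorname{coker}f)\ker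 b$ and $(\ker c)\eta=g^\flat\ker\check b$. The composite $\eta\xi$ is the morphism $\widehat g:\operatorname{Ker}b\to\operatorname{Ker}c$ induced by $g$, and $\operatorname{Ker}h=\operatorname{Ker}\eta$ canonically (as subobjects of $\operatorname{Coker}f$, via $H=\operatorname{Ker}g^\flat$). Dually, $\eta':\operatorname{Coker}a\to\operatorname{Coker}\widehat b$ and $\xi':\operatorname{Coker}\widehat b\to\operatorname{Coker}b$ are given by $\eta'\operatorname{coker}a=(\operatorname{coker}\widehat b)f'^\sharp$ and $\xi'\operatorname{coker}\widehat b=(\operatorname{coker}b)\ker g'$; the composite $\xi'\eta'$ is the morphism $\check f':\operatorname{Coker}a\to\operatorname{Coker}b$ induced by $f'$, and $\operatorname{Coker}h=\operatorname{Coker}\eta'$ canonically. The homologies of $\operatorname{Ker}a\xrightarrow{\widehat f}\operatorname{Ker}b\xrightarrow{\widehat g}\operatorname{Ker}c$ and $\operatorname{Coker}a\xrightarrow{\check f'}\operatorname{Coker}b\xrightarrow{\check g'}\operatorname{Coker}c$ are the ones in the sequence. **$\beta,\beta'$.** Let $S_1$ be the square with top $\operatorname{coker}f$, left $b$, right $\check b$, bottom $\operatorname{coker}f'$, and $S_2$ the square with top $\xi$, left $\ker b$, right $\ker\check b$, bottom $\operatorname{coker}f$; one has $\operatorname{Im}S_2=\operatorname{Coker}\xi$. By Lambek's theorem, $\Lambda_{S,S_1}:\operatorname{Im}S\to\operatorname{Ker}S_1$ and (vertically) $\Lambda_{S_2,S_1}:\operatorname{Im}S_2\to\operatorname{Ker}S_1$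 are isomorphisms. Then $\beta=\Lambda_{S,S_1}^{-1}\Lambda_{S_2,S_1}(\operatorname{coker}\xi)\ker\eta$. Let $T_1$ be the square with top $\ker g$, left $\widehat b$, right $b$, bottom $\ker g'$, and $T_2$ the square with top $\ker g'$, left $\operatorname{coker}\widehat b$, right $\operatorname{coker}b$, bottom $\xi'$; one has $\operatorname{Ker}T_2=\operatorname{Ker}\xi'$. The morphisms $\Lambda_{T_1,T}:\operatorname{Im}T_1\to\operatorname{Ker}T$ and (vertically) $\Lambda_{T_1,T_2}:\operatorname{Im}T_1\to\operatorname{Ker}T_2$ are isomorphisms, and $\beta'=(\operatorname{coker}\eta')(\ker\xi')\Lambda_{T_1,T_2}\Lambda_{T_1,T}^{-1}$. **$p,\varkappa,p_1$.** Let $\lambda:\operatorname{Ker}a\to\operatorname{Ker}\xi$ and $\mu:\operatorname{Ker}\xi\to\operatorname{Ker}(\eta\xi)$ satisfy $(\ker\xi)\lambda=\widehat f$ and $\ker(\eta\xi)\mu=\ker\xi$. Then $\operatorname{Im}S_0=\operatorname{Coker}\lambda$ and $H(\operatorname{Ker}a\to\operatorname{Ker}b\to\operatorname{Ker}c)=\operatorname{Coker}(\mu\lambda)$. The morphism $p:\operatorname{Coker}\lambda\to\operatorname{Coker}(\mu\lambda)$ is given by $p\operatorname{coker}\lambda=\operatorname{coker}(\mu\lambda)\,\mu$. With $v:\operatorname{Ker}(\eta\xi)\to\operatorname{Ker}\eta$ given by $(\ker\eta)v=\xi\ker(\eta\xi)$, the morphism $\varkappa$ is the unique one with $\varkappa\operatorname{coker}(\mu\lambda)=v$.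 If $f$ is exact, (vertically) $\Lambda_{S_0,S}:\operatorname{Im}S_0\to\operatorname{Ker}S$ is an isomorphism and $p_1=p\,\Lambda_{S_0,S}^{-1}$. **$\varkappa',p',p_1'$.** Dually, let $\mu':\operatorname{Coker}(\xi'\eta')\to\operatorname{Coker}\xi'$ and $\lambda':\operatorname{Coker}\xi'\to\operatorname{Coker}c$ satisfy $\mu'\operatorname{coker}(\xi'\eta')=\operatorname{coker}\xi'$ and $\lambda'\operatorname{coker}\xi'=\check g'$. Then $\operatorname{Ker}T_0=\operatorname{Ker}\lambda'$ and $H(\operatorname{Coker}a\to\operatorname{Coker}b\to\operatorname{Coker}c)=\operatorname{Ker}(\lambda'\mu')$. With $u:\operatorname{Coker}\eta'\to\operatorname{Coker}(\xi'\eta')$ given by $u\operatorname{coker}\eta'=\operatorname{coker}(\xi'\eta')\,\xi'$, the morphism $\varkappa'$ is the unique one with $\ker(\lambda'\mu')\,\varkappa'=u$; $p':\operatorname{Ker}(\lambda'\mu')\to\operatorname{Ker}\lambda'$ is given by $(\ker\lambda')p'=\mu'\ker(\lambda'\mu')$. If $g'$ is exact, (vertically) $\Lambda_{T,T_0}:\operatorname{Im}T\to\operatorname{Ker}T_0$ is an isomorphism and $p_1'=\Lambda_{T,T_0}^{-1}p'$. *)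

theory Defs
  imports Main
begin

text \<open>
  Categories are one-sorted in the arrows: \<open>Comp\<close> is a total function of which only the values on
  composable pairs matter, and \<open>f \<cdot> g\<close> is ``\<open>f\<close> after \<open>g\<close>''. The field \<open>Null\<close> is the class of null
  morphisms. The last six fields are a choice of kernels, cokernels, pullback projections and
  pushout coprojections; every statement is made for an arbitrary such choice.
\<close>

record ('o, 'm) ideal_category =
  Obj :: "'o set"
  Arr :: "'m set"
  Dom :: "'m \<Rightarrow> 'o"
  Cod :: "'m \<Rightarrow> 'o"
  Id :: "'o \<Rightarrow> 'm"
  Comp :: "'m \<Rightarrow> 'm \<Rightarrow> 'm"  (infixr "\<cdot>\<index>" 70)
  Null :: "'m set"

record ('o, 'm) chosen_category = "('o, 'm) ideal_category" +
  chosen_ker :: "'m \<Rightarrow> 'm"  ("ker\<index>")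
  chosen_coker :: "'m \<Rightarrow> 'm"  ("coker\<index>")
  pb_fst :: "'m \<Rightarrow> 'm \<Rightarrow> 'm"
  pb_snd :: "'m \<Rightarrow> 'm \<Rightarrow> 'm"
  po_fst :: "'m \<Rightarrow> 'm \<Rightarrow> 'm"
  po_snd :: "'m \<Rightarrow> 'm \<Rightarrow> 'm"

section \<open>Homological categories\<close>

context
  fixes C :: "('o, 'm, 'x) ideal_category_scheme" (structure)
begin

definition hom :: "'o \<Rightarrow> 'o \<Rightarrow> 'm set" where
  "hom X Y = {f \<in> Arr C. Dom C f = X \<and> Cod C f = Y}"

definition is_inverse :: "'m \<Rightarrow> 'm \<Rightarrow> bool" where
  "is_inverse f g \<longleftrightarrow> f \<in> Arr C \<and> g \<in> hom (Cod C f) (Dom C f) \<and>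
     g \<cdot> f = Id C (Dom C f) \<and> f \<cdot> g = Id C (Cod C f)"

definition is_iso :: "'m \<Rightarrow> bool" where
  "is_iso f \<longleftrightarrow> (\<exists>g. is_inverse f g)"

definition inv_arr :: "'m \<Rightarrow> 'm" where
  "inv_arr f = (THE g. is_inverse f g)"

definition is_lift :: "'m \<Rightarrow> 'm \<Rightarrow> 'm \<Rightarrow> bool" where
  "is_lift k x y \<longleftrightarrow> y \<in> hom (Dom C x) (Dom C k) \<and> k \<cdot> y = x"

definition is_colift :: "'m \<Rightarrow> 'm \<Rightarrow> 'm \<Rightarrow> bool" where
  "is_colift q x y \<longleftrightarrow> y \<in> hom (Cod C q) (Cod C x) \<and> y \<cdot> q = x"

definition is_kernel :: "'m \<Rightarrow> 'm \<Rightarrow> bool" where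
  "is_kernel k f \<longleftrightarrow> f \<in> Arr C \<and> k \<in> Arr C \<and> Cod C k = Dom C f \<and> f \<cdot> k \<in> Null C \<and>
     (\<forall>x \<in> Arr C. Cod C x = Dom C f \<and> f \<cdot> x \<in> Null C \<longrightarrow> (\<exists>!y. is_lift k x y))"

definition is_cokernel :: "'m \<Rightarrow> 'm \<Rightarrow> bool" where
  "is_cokernel q f \<longleftrightarrow> f \<in> Arr C \<and> q \<in> Arr C \<and> Dom C q = Cod C f \<and> q \<cdot> f \<in> Null C \<and>
     (\<forall>x \<in> Arr C. Dom C x = Cod C f \<and> x \<cdot> f \<in> Null C \<longrightarrow> (\<exists>!y. is_colift q x y))"

definition kernel_arrow :: "'m \<Rightarrow> bool" where
  "kernel_arrow k \<longleftrightarrow> (\<exists>f. is_kernel k f)"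

definition cokernel_arrow :: "'m \<Rightarrow> bool" where
  "cokernel_arrow q \<longleftrightarrow> (\<exists>f. is_cokernel q f)"

definition is_pullback :: "'m \<Rightarrow> 'm \<Rightarrow> 'm \<Rightarrow> 'm \<Rightarrow> bool" where
  "is_pullback x y p q \<longleftrightarrow>
     x \<in> Arr C \<and> y \<in> Arr C \<and> Cod C x = Cod C y \<and> p \<in> Arr C \<and> q \<in> Arr C \<and>
     Dom C p = Dom C q \<and> Cod C p = Dom C x \<and> Cod C q = Dom C y \<and> x \<cdot> p = y \<cdot> q \<and>
     (\<forall>u \<in> Arr C. \<forall>v \<in> Arr C. Dom C u = Dom C v \<and> Cod C u = Dom C x \<and> Cod C v = Dom C y \<and>
        x \<cdot> u = y \<cdot> v \<longrightarrow> (\<exists>!w. is_lift p u w \<and> is_lift q v w))"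

definition is_pushout :: "'m \<Rightarrow> 'm \<Rightarrow> 'm \<Rightarrow> 'm \<Rightarrow> bool" where
  "is_pushout x y p q \<longleftrightarrow>
     x \<in> Arr C \<and> y \<in> Arr C \<and> Dom C x = Dom C y \<and> p \<in> Arr C \<and> q \<in> Arr C \<and>
     Cod C p = Cod C q \<and> Dom C p = Cod C x \<and> Dom C q = Cod C y \<and> p \<cdot> x = q \<cdot> y \<and>
     (\<forall>u \<in> Arr C. \<forall>v \<in> Arr C. Cod C u = Cod C v \<and> Dom C u = Cod C x \<and> Dom C v = Cod C y \<and>
        u \<cdot> x = v \<cdot> y \<longrightarrow> (\<exists>!w. is_colift p u w \<and> is_colift q v w))"

definition null_sequence :: "'o list \<Rightarrow> 'm list \<Rightarrow> bool" where
  "null_sequence Xs fs \<longleftrightarrow> length Xs = Suc (length fs) \<and>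
     (\<forall>i < length fs. fs ! i \<in> hom (Xs ! i) (Xs ! Suc i)) \<and>
     (\<forall>i. Suc i < length fs \<longrightarrow> (fs ! Suc i) \<cdot> (fs ! i) \<in> Null C)"

end

locale category =
  fixes C :: "('o, 'm, 'x) ideal_category_scheme" (structure)
  assumes Dom_closed: "f \<in> Arr C \<Longrightarrow> Dom C f \<in> Obj C"
    and Cod_closed: "f \<in> Arr C \<Longrightarrow> Cod C f \<in> Obj C"
    and Id_closed: "X \<in> Obj C \<Longrightarrow> Id C X \<in> hom C X X"
    and Comp_closed: "f \<in> hom C X Y \<Longrightarrow> g \<in> hom C Y Z \<Longrightarrow> g \<cdot> f \<in> hom C X Z"
    and Id_left: "f \<in> hom C X Y \<Longrightarrow> Id C Y \<cdot> f = f"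
    and Id_right: "f \<in> hom C X Y \<Longrightarrow> f \<cdot> Id C X = f"
    and Comp_assoc:
      "f \<in> hom C W X \<Longrightarrow> g \<in> hom C X Y \<Longrightarrow> h \<in> hom C Y Z \<Longrightarrow> (h \<cdot> g) \<cdot> f = h \<cdot> (g \<cdot> f)"

locale semiexact_category = category +
  assumes Null_Arr: "Null C \<subseteq> Arr C"
    and Null_ideal:
      "g \<in> hom C W X \<Longrightarrow> f \<in> hom C X Y \<Longrightarrow> f \<in> Null C \<Longrightarrow> h \<in> hom C Y Z \<Longrightarrow> h \<cdot> f \<cdot> g \<in> Null C"
    and Null_closed:
      "f \<in> Null C \<Longrightarrow> \<exists>Z \<in> Obj C. Id C Z \<in> Null C \<and>
         (\<exists>u \<in> hom C (Dom C f) Z. \<exists>v \<in> hom C Z (Cod C f). f = v \<cdot> u)"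
    and kernel_exists: "f \<in> Arr C \<Longrightarrow> \<exists>k. is_kernel C k f"
    and cokernel_exists: "f \<in> Arr C \<Longrightarrow> \<exists>q. is_cokernel C q f"

locale homological_category = semiexact_category +
  assumes kernels_comp:
      "kernel_arrow C k \<Longrightarrow> kernel_arrow C l \<Longrightarrow> Cod C k = Dom C l \<Longrightarrow> kernel_arrow C (l \<cdot> k)"
    and cokernels_comp:
      "cokernel_arrow C p \<Longrightarrow> cokernel_arrow C q \<Longrightarrow> Cod C p = Dom C q \<Longrightarrow> cokernel_arrow C (q \<cdot> p)"
    and subquotient:
      "kernel_arrow C i \<Longrightarrow> cokernel_arrow C q \<Longrightarrow> Cod C i = Dom C q \<Longrightarrow>
       is_cokernel C ci i \<Longrightarrow> is_kernel C kq q \<Longrightarrow> ci \<cdot> kq \<in> Null C \<Longrightarrow>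
       \<exists>\<pi> \<iota>. cokernel_arrow C \<pi> \<and> kernel_arrow C \<iota> \<and> Dom C \<pi> = Dom C i \<and> Cod C \<pi> = Dom C \<iota> \<and>
         Cod C \<iota> = Cod C q \<and> q \<cdot> i = \<iota> \<cdot> \<pi>"

text \<open>
  A semiexact category need not have all pullbacks and pushouts, so the chosen ones are only
  required to be correct where one exists.
\<close>

locale homological_category_with_choices = homological_category C
  for C :: "('o, 'm, 'x) chosen_category_scheme" (structure) +
  assumes ker_choice: "f \<in> Arr C \<Longrightarrow> is_kernel C (ker f) f"
    and coker_choice: "f \<in> Arr C \<Longrightarrow> is_cokernel C (coker f) f"
    and pullback_choice:
      "is_pullback C x y p q \<Longrightarrow> is_pullback C x y (pb_fst C x y) (pb_snd C x y)"
    and pushout_choice: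
      "is_pushout C x y p q \<Longrightarrow> is_pushout C x y (po_fst C x y) (po_snd C x y)"

section \<open>Images, homology and Lambek invariants\<close>

record 'm square =
  sq_top :: 'm
  sq_left :: 'm
  sq_right :: 'm
  sq_bot :: 'm

context
  fixes C :: "('o, 'm, 'x) chosen_category_scheme" (structure)
begin

definition lift :: "'m \<Rightarrow> 'm \<Rightarrow> 'm" where
  "lift k x = (THE y. is_lift C k x y)"

definition colift :: "'m \<Rightarrow> 'm \<Rightarrow> 'm" where
  "colift q x = (THE y. is_colift C q x y)"

definition is_middle :: "'m \<Rightarrow> 'm \<Rightarrow> 'm \<Rightarrow> 'm \<Rightarrow> bool" where
  "is_middle k q x y \<longleftrightarrow> y \<in> hom C (Cod C q) (Dom C k) \<and> k \<cdot> y \<cdot> q = x"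

definition middle :: "'m \<Rightarrow> 'm \<Rightarrow> 'm \<Rightarrow> 'm" where
  "middle k q x = (THE y. is_middle k q x y)"

definition lifts :: "'m \<Rightarrow> 'm \<Rightarrow> bool" where
  "lifts k x \<longleftrightarrow> (\<exists>!y. is_lift C k x y)"

definition colifts :: "'m \<Rightarrow> 'm \<Rightarrow> bool" where
  "colifts q x \<longleftrightarrow> (\<exists>!y. is_colift C q x y)"

definition has_middle :: "'m \<Rightarrow> 'm \<Rightarrow> 'm \<Rightarrow> bool" where
  "has_middle k q x \<longleftrightarrow> (\<exists>!y. is_middle k q x y)"

text \<open>\<open>on_ker x y u\<close> is the morphism \<open>Ker x \<rightarrow> Ker y\<close> induced by \<open>u : Dom x \<rightarrow> Dom y\<close>;
  \<open>on_coker x y u\<close> is the morphism \<open>Coker x \<rightarrow> Coker y\<close> induced by \<open>u : Cod x \<rightarrow> Cod y\<close>.\<close>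

definition on_ker :: "'m \<Rightarrow> 'm \<Rightarrow> 'm \<Rightarrow> 'm" where
  "on_ker x y u = lift (ker y) (u \<cdot> ker x)"

definition on_coker :: "'m \<Rightarrow> 'm \<Rightarrow> 'm \<Rightarrow> 'm" where
  "on_coker x y u = colift (coker x) (coker y \<cdot> u)"

definition induces_on_ker :: "'m \<Rightarrow> 'm \<Rightarrow> 'm \<Rightarrow> bool" where
  "induces_on_ker x y u \<longleftrightarrow> lifts (ker y) (u \<cdot> ker x)"

definition induces_on_coker :: "'m \<Rightarrow> 'm \<Rightarrow> 'm \<Rightarrow> bool" where
  "induces_on_coker x y u \<longleftrightarrow> colifts (coker x) (coker y \<cdot> u)"

definition Ker :: "'m \<Rightarrow> 'o" where
  "Ker f = Dom C (ker f)"

definition Coker :: "'m \<Rightarrow> 'o" where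
  "Coker f = Cod C (coker f)"

definition im :: "'m \<Rightarrow> 'm" where
  "im f = ker (coker f)"

definition coim :: "'m \<Rightarrow> 'm" where
  "coim f = coker (ker f)"

definition bar :: "'m \<Rightarrow> 'm" where
  "bar f = middle (im f) (coim f) f"

definition exact_arrow :: "'m \<Rightarrow> bool" where
  "exact_arrow f \<longleftrightarrow> f \<in> Arr C \<and> has_middle (im f) (coim f) f \<and> is_iso C (bar f)"

definition sharp :: "'m \<Rightarrow> 'm \<Rightarrow> 'm" where
  "sharp f g = lift (ker g) f"

definition flat :: "'m \<Rightarrow> 'm \<Rightarrow> 'm" where
  "flat f g = colift (coker f) g"

definition homology :: "'m \<Rightarrow> 'm \<Rightarrow> 'o" where
  "homology f g = Coker (sharp f g)"

text \<open>The canonical isomorphism \<open>m\<close> from \<open>Coker (X \<rightarrow> Ker g)\<close> to \<open>Ker (Coker f \<rightarrow> Z)\<close>.\<close>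

definition homology_iso :: "'m \<Rightarrow> 'm \<Rightarrow> 'm" where
  "homology_iso f g = middle (ker (flat f g)) (coker (sharp f g)) (coker f \<cdot> ker g)"

definition homology_well_defined :: "'m \<Rightarrow> 'm \<Rightarrow> bool" where
  "homology_well_defined f g \<longleftrightarrow> lifts (ker g) f \<and> colifts (coker f) g \<and>
     has_middle (ker (flat f g)) (coker (sharp f g)) (coker f \<cdot> ker g) \<and> is_iso C (homology_iso f g)"

definition commutative_square :: "'m square \<Rightarrow> bool" where
  "commutative_square S \<longleftrightarrow>
     sq_top S \<in> Arr C \<and> sq_left S \<in> Arr C \<and> sq_right S \<in> Arr C \<and> sq_bot S \<in> Arr C \<and>
     Dom C (sq_left S) = Dom C (sq_top S) \<and> Dom C (sq_right S) = Cod C (sq_top S) \<and>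
     Dom C (sq_bot S) = Cod C (sq_left S) \<and> Cod C (sq_bot S) = Cod C (sq_right S) \<and>
     sq_right S \<cdot> sq_top S = sq_bot S \<cdot> sq_left S"

text \<open>
  For a square \<open>S\<close>, \<open>l_right\<close> and \<open>l_bot\<close> are the projections from the pullback to the images of
  the right and the bottom side; \<open>r_left\<close> and \<open>r_top\<close> are the coprojections from the coimages of
  the left and the top side. Transposing the square exchanges \<open>l_right\<close> with \<open>l_bot\<close> and \<open>r_left\<close>
  with \<open>r_top\<close>, and leaves \<open>Im_sq\<close> and \<open>Ker_sq\<close> unchanged (up to the choice of limits).
\<close>

definition l_right :: "'m square \<Rightarrow> 'm" where
  "l_right S = pb_fst C (im (sq_right S)) (im (sq_bot S))"

definition l_bot :: "'m square \<Rightarrow> 'm" where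
  "l_bot S = pb_snd C (im (sq_right S)) (im (sq_bot S))"

definition is_lam :: "'m square \<Rightarrow> 'm \<Rightarrow> bool" where
  "is_lam S w \<longleftrightarrow>
     is_lift C (l_right S) (bar (sq_right S) \<cdot> coim (sq_right S) \<cdot> sq_top S) w \<and>
     is_lift C (l_bot S) (bar (sq_bot S) \<cdot> coim (sq_bot S) \<cdot> sq_left S) w"

definition lam :: "'m square \<Rightarrow> 'm" where
  "lam S = (THE w. is_lam S w)"

definition Im_sq :: "'m square \<Rightarrow> 'o" where
  "Im_sq S = Coker (lam S)"

definition r_left :: "'m square \<Rightarrow> 'm" where
  "r_left S = po_fst C (coim (sq_left S)) (coim (sq_top S))"

definition r_top :: "'m square \<Rightarrow> 'm" where
  "r_top S = po_snd C (coim (sq_left S)) (coim (sq_top S))"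

definition is_rho :: "'m square \<Rightarrow> 'm \<Rightarrow> bool" where
  "is_rho S w \<longleftrightarrow>
     is_colift C (r_left S) (sq_bot S \<cdot> im (sq_left S) \<cdot> bar (sq_left S)) w \<and>
     is_colift C (r_top S) (sq_right S \<cdot> im (sq_top S) \<cdot> bar (sq_top S)) w"

definition rho :: "'m square \<Rightarrow> 'm" where
  "rho S = (THE w. is_rho S w)"

definition Ker_sq :: "'m square \<Rightarrow> 'o" where
  "Ker_sq S = Ker (rho S)"

definition Lambek_invariants_well_defined :: "'m square \<Rightarrow> bool" where
  "Lambek_invariants_well_defined S \<longleftrightarrow> commutative_square S \<and>
     (\<forall>x \<in> {sq_top S, sq_left S, sq_right S, sq_bot S}. has_middle (im x) (coim x) x) \<and>
     is_pullback C (im (sq_right S)) (im (sq_bot S)) (l_right S) (l_bot S) \<and>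
     (\<exists>!w. is_lam S w) \<and>
     is_pushout C (coim (sq_left S)) (coim (sq_top S)) (r_left S) (r_top S) \<and>
     (\<exists>!w. is_rho S w)"

text \<open>
  Lambek morphisms of horizontally and of vertically consecutive squares. The inverse of \<open>bar\<close> of
  the common side is the identification of its image with its coimage.
\<close>

definition Lambek_h_target :: "'m square \<Rightarrow> 'm square \<Rightarrow> 'm" where
  "Lambek_h_target S T = r_left T \<cdot> inv_arr C (bar (sq_right S)) \<cdot> l_right S"

definition Lambek_h :: "'m square \<Rightarrow> 'm square \<Rightarrow> 'm" where
  "Lambek_h S T = middle (ker (rho T)) (coker (lam S)) (Lambek_h_target S T)"

definition Lambek_h_well_defined :: "'m square \<Rightarrow> 'm square \<Rightarrow> bool" where
  "Lambek_h_well_defined S T \<longleftrightarrow> sq_right S = sq_left T \<and> exact_arrow (sq_right S) \<and>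
     has_middle (ker (rho T)) (coker (lam S)) (Lambek_h_target S T)"

definition Lambek_v_target :: "'m square \<Rightarrow> 'm square \<Rightarrow> 'm" where
  "Lambek_v_target S T = r_top T \<cdot> inv_arr C (bar (sq_bot S)) \<cdot> l_bot S"

definition Lambek_v :: "'m square \<Rightarrow> 'm square \<Rightarrow> 'm" where
  "Lambek_v S T = middle (ker (rho T)) (coker (lam S)) (Lambek_v_target S T)"

definition Lambek_v_well_defined :: "'m square \<Rightarrow> 'm square \<Rightarrow> bool" where
  "Lambek_v_well_defined S T \<longleftrightarrow> sq_bot S = sq_top T \<and> exact_arrow (sq_bot S) \<and>
     has_middle (ker (rho T)) (coker (lam S)) (Lambek_v_target S T)"

end

section \<open>The diagram and its sequence\<close>

text \<open>A prime is written \<open>p\<close> in names: \<open>f'\<close> is \<open>row_fp\<close>, \<open>\<xi>'\<close> is \<open>xip\<close>.\<close>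

record 'm diagram =
  row_f :: 'm
  row_g :: 'm
  row_fp :: 'm
  row_gp :: 'm
  col_a :: 'm
  col_b :: 'm
  col_c :: 'm

context
  fixes C :: "('o, 'm, 'x) chosen_category_scheme" (structure) and D :: "'m diagram"
begin

private abbreviation (input) "f \<equiv> row_f D"
private abbreviation (input) "g \<equiv> row_g D"
private abbreviation (input) "f' \<equiv> row_fp D"
private abbreviation (input) "g' \<equiv> row_gp D"
private abbreviation (input) "a \<equiv> col_a D"
private abbreviation (input) "b \<equiv> col_b D"
private abbreviation (input) "c \<equiv> col_c D"

definition null_row_diagram :: bool where
  "null_row_diagram \<longleftrightarrow>
     {f, g, f', g', a, b, c} \<subseteq> Arr C \<and>
     Dom C a = Dom C f \<and> Cod C a = Dom C f' \<and>
     Cod C f = Dom C g \<and> Dom C b = Dom C g \<and> Cod C b = Dom C g' \<and> Cod C f' = Dom C g' \<and>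
     Dom C c = Cod C g \<and> Cod C c = Cod C g' \<and>
     b \<cdot> f = f' \<cdot> a \<and> c \<cdot> g = g' \<cdot> b \<and> g \<cdot> f \<in> Null C \<and> g' \<cdot> f' \<in> Null C"

definition b_hat :: 'm where "b_hat = on_ker C g g' b"
definition b_check :: 'm where "b_check = on_coker C f f' b"
definition f_hat :: 'm where "f_hat = on_ker C a b f"
definition g_hat :: 'm where "g_hat = on_ker C b c g"
definition fp_check :: 'm where "fp_check = on_coker C a b f'"
definition gp_check :: 'm where "gp_check = on_coker C b c g'"
definition h_arr :: 'm where "h_arr = on_coker C (sharp C f g) (sharp C f' g') b_hat"

definition xi :: 'm where "xi = on_ker C b b_check (coker f)"
definition eta :: 'm where "eta = on_ker C b_check c (flat C f g)"
definition etap :: 'm where "etap = on_coker C a b_hat (sharp C f' g')"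
definition xip :: 'm where "xip = on_coker C b_hat b (ker g')"

definition sq_S :: "'m square" where
  "sq_S = \<lparr>sq_top = f, sq_left = a, sq_right = b, sq_bot = f'\<rparr>"
definition sq_T :: "'m square" where
  "sq_T = \<lparr>sq_top = g, sq_left = b, sq_right = c, sq_bot = g'\<rparr>"
definition sq_S0 :: "'m square" where
  "sq_S0 = \<lparr>sq_top = f_hat, sq_left = ker a, sq_right = ker b, sq_bot = f\<rparr>"
definition sq_T0 :: "'m square" where
  "sq_T0 = \<lparr>sq_top = g', sq_left = coker b, sq_right = coker c, sq_bot = gp_check\<rparr>"
definition sq_S1 :: "'m square" where
  "sq_S1 = \<lparr>sq_top = coker f, sq_left = b, sq_right = b_check, sq_bot = coker f'\<rparr>"
definition sq_S2 :: "'m square" where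
  "sq_S2 = \<lparr>sq_top = xi, sq_left = ker b, sq_right = ker b_check, sq_bot = coker f\<rparr>"
definition sq_T1 :: "'m square" where
  "sq_T1 = \<lparr>sq_top = ker g, sq_left = b_hat, sq_right = b, sq_bot = ker g'\<rparr>"
definition sq_T2 :: "'m square" where
  "sq_T2 = \<lparr>sq_top = ker g', sq_left = coker b_hat, sq_right = coker b, sq_bot = xip\<rparr>"

definition Lambda :: 'm where "Lambda = Lambek_h C sq_S sq_T"

text \<open>\<open>lambda\<close>, \<open>mu\<close>, \<open>v_arr\<close> and their duals are \<open>\<lambda>\<close>, \<open>\<mu>\<close>, \<open>v\<close> and \<open>\<lambda>'\<close>, \<open>\<mu>'\<close>, \<open>u\<close>.\<close>

definition lambda :: 'm where "lambda = lift C (ker xi) f_hat"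
definition mu :: 'm where "mu = lift C (ker (eta \<cdot> xi)) (ker xi)"
definition v_arr :: 'm where "v_arr = on_ker C (eta \<cdot> xi) eta xi"
definition mup :: 'm where "mup = colift C (coker (xip \<cdot> etap)) (coker xip)"
definition lambdap :: 'm where "lambdap = colift C (coker xip) gp_check"
definition u_arr :: 'm where "u_arr = on_coker C etap (xip \<cdot> etap) xip"

text \<open>
  The canonical identifications, as explicit isomorphisms:
  \<open>Ker h = Ker \<eta>\<close> as subobjects of \<open>Coker f\<close>, and \<open>Coker h = Coker \<eta>'\<close> as quotients of \<open>Ker g'\<close>;
  \<open>Im S\<^sub>0 = Coker \<lambda>\<close> and \<open>Im S\<^sub>2 = Coker \<xi>\<close>, induced by the isomorphisms from the pullbacks to \<open>Ker \<xi>\<close>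
  (as subobjects of \<open>B\<close>) and to the kernel of \<open>b_check\<close> (as subobjects of \<open>Coker f\<close>);
  and dually for \<open>Ker T\<^sub>0 = Ker \<lambda>'\<close> (quotients of \<open>B'\<close>) and \<open>Ker T\<^sub>2 = Ker \<xi>'\<close> (quotients of \<open>Ker g'\<close>).
\<close>

definition ker_h_iso :: 'm where
  "ker_h_iso = lift C (ker b_check \<cdot> ker eta) (ker (flat C f g) \<cdot> homology_iso C f g \<cdot> ker h_arr)"
definition coker_h_iso :: 'm where
  "coker_h_iso = colift C (coker etap \<cdot> coker b_hat) (coker h_arr \<cdot> coker (sharp C f' g'))"

definition pb_S0_iso :: 'm where
  "pb_S0_iso = lift C (ker b \<cdot> ker xi) (im C (ker b) \<cdot> l_right C sq_S0)"
definition Im_S0_iso :: 'm where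
  "Im_S0_iso = on_coker C (lam C sq_S0) lambda pb_S0_iso"
definition pb_S2_iso :: 'm where
  "pb_S2_iso = lift C (ker b_check) (im C (ker b_check) \<cdot> l_right C sq_S2)"
definition Im_S2_iso :: 'm where
  "Im_S2_iso = on_coker C (lam C sq_S2) xi pb_S2_iso"

definition po_T0_iso :: 'm where
  "po_T0_iso = colift C (coker xip \<cdot> coker b) (r_left C sq_T0 \<cdot> coim C (coker b))"
definition Ker_T0_iso :: 'm where
  "Ker_T0_iso = on_ker C lambdap (rho C sq_T0) po_T0_iso"
definition po_T2_iso :: 'm where
  "po_T2_iso = colift C (coker b_hat) (r_left C sq_T2 \<cdot> coim C (coker b_hat))"
definition Ker_T2_iso :: 'm where
  "Ker_T2_iso = on_ker C xip (rho C sq_T2) po_T2_iso"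

text \<open>
  A suffix \<open>_pre\<close> marks a morphism before its ends are transported along the identifications above
  to the objects of the sequence.
\<close>

definition p_pre :: 'm where "p_pre = on_coker C lambda (mu \<cdot> lambda) mu"
definition p_arr :: 'm where "p_arr = p_pre \<cdot> Im_S0_iso"

definition kappa_pre :: 'm where "kappa_pre = colift C (coker (mu \<cdot> lambda)) v_arr"
definition kappa :: 'm where "kappa = inv_arr C ker_h_iso \<cdot> kappa_pre"

definition beta :: 'm where
  "beta = inv_arr C (Lambek_h C sq_S sq_S1) \<cdot> Lambek_v C sq_S2 sq_S1 \<cdot>
     inv_arr C Im_S2_iso \<cdot> coker xi \<cdot> ker eta \<cdot> ker_h_iso"

definition betap :: 'm where
  "betap = coker_h_iso \<cdot> coker etap \<cdot> ker xip \<cdot> inv_arr C Ker_T2_iso \<cdot>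
     Lambek_v C sq_T1 sq_T2 \<cdot> inv_arr C (Lambek_h C sq_T1 sq_T)"

definition kappap_pre :: 'm where "kappap_pre = lift C (ker (lambdap \<cdot> mup)) u_arr"
definition kappap :: 'm where
  "kappap = inv_arr C (homology_iso C fp_check gp_check) \<cdot> kappap_pre \<cdot> inv_arr C coker_h_iso"

definition pp_pre :: 'm where "pp_pre = on_ker C (lambdap \<cdot> mup) lambdap mup"
definition pp_arr :: 'm where
  "pp_arr = Ker_T0_iso \<cdot> pp_pre \<cdot> homology_iso C fp_check gp_check"

definition p1_arr :: 'm where "p1_arr = p_arr \<cdot> inv_arr C (Lambek_v C sq_S0 sq_S)"
definition pp1_arr :: 'm where "pp1_arr = inv_arr C (Lambek_v C sq_T sq_T0) \<cdot> pp_arr"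

definition induced_arrows_well_defined :: bool where
  "induced_arrows_well_defined \<longleftrightarrow>
     induces_on_ker C g g' b \<and> induces_on_coker C f f' b \<and>
     induces_on_ker C a b f \<and> induces_on_ker C b c g \<and>
     induces_on_coker C a b f' \<and> induces_on_coker C b c g' \<and>
     homology_well_defined C f g \<and> homology_well_defined C f' g' \<and>
     homology_well_defined C f_hat g_hat \<and> homology_well_defined C fp_check gp_check \<and>
     induces_on_coker C (sharp C f g) (sharp C f' g') b_hat \<and>
     induces_on_ker C (flat C f g) (flat C f' g') b_check \<and>
     homology_iso C f' g' \<cdot> h_arr =
       on_ker C (flat C f g) (flat C f' g') b_check \<cdot> homology_iso C f g \<and>
     induces_on_ker C b b_check (coker f) \<and> induces_on_ker C b_check c (flat C f g) \<and>
     induces_on_coker C a b_hat (sharp C f' g') \<and> induces_on_coker C b_hat b (ker g') \<and>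
     eta \<cdot> xi = g_hat \<and> xip \<cdot> etap = fp_check"

definition identifications_well_defined :: bool where
  "identifications_well_defined \<longleftrightarrow>
     lifts C (ker b_check \<cdot> ker eta) (ker (flat C f g) \<cdot> homology_iso C f g \<cdot> ker h_arr) \<and>
     is_iso C ker_h_iso \<and>
     colifts C (coker etap \<cdot> coker b_hat) (coker h_arr \<cdot> coker (sharp C f' g')) \<and>
     is_iso C coker_h_iso \<and>
     lifts C (ker b \<cdot> ker xi) (im C (ker b) \<cdot> l_right C sq_S0) \<and> is_iso C pb_S0_iso \<and>
     induces_on_coker C (lam C sq_S0) lambda pb_S0_iso \<and> is_iso C Im_S0_iso \<and>
     lifts C (ker b_check) (im C (ker b_check) \<cdot> l_right C sq_S2) \<and> is_iso C pb_S2_iso \<and>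
     induces_on_coker C (lam C sq_S2) xi pb_S2_iso \<and> is_iso C Im_S2_iso \<and>
     colifts C (coker xip \<cdot> coker b) (r_left C sq_T0 \<cdot> coim C (coker b)) \<and> is_iso C po_T0_iso \<and>
     induces_on_ker C lambdap (rho C sq_T0) po_T0_iso \<and> is_iso C Ker_T0_iso \<and>
     colifts C (coker b_hat) (r_left C sq_T2 \<cdot> coim C (coker b_hat)) \<and> is_iso C po_T2_iso \<and>
     induces_on_ker C xip (rho C sq_T2) po_T2_iso \<and> is_iso C Ker_T2_iso"

definition sequence_arrows_well_defined :: bool where
  "sequence_arrows_well_defined \<longleftrightarrow>
     lifts C (ker xi) f_hat \<and> lifts C (ker (eta \<cdot> xi)) (ker xi) \<and>
     induces_on_ker C (eta \<cdot> xi) eta xi \<and>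
     induces_on_coker C lambda (mu \<cdot> lambda) mu \<and> colifts C (coker (mu \<cdot> lambda)) v_arr \<and>
     colifts C (coker (xip \<cdot> etap)) (coker xip) \<and> colifts C (coker xip) gp_check \<and>
     induces_on_coker C etap (xip \<cdot> etap) xip \<and>
     lifts C (ker (lambdap \<cdot> mup)) u_arr \<and> induces_on_ker C (lambdap \<cdot> mup) lambdap mup \<and>
     Lambek_h_well_defined C sq_S sq_T \<and>
     Lambek_h_well_defined C sq_S sq_S1 \<and> is_iso C (Lambek_h C sq_S sq_S1) \<and>
     Lambek_v_well_defined C sq_S2 sq_S1 \<and> is_iso C (Lambek_v C sq_S2 sq_S1) \<and>
     Lambek_h_well_defined C sq_T1 sq_T \<and> is_iso C (Lambek_h C sq_T1 sq_T) \<and>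
     Lambek_v_well_defined C sq_T1 sq_T2 \<and> is_iso C (Lambek_v C sq_T1 sq_T2)"

end

end

(*
  The dual of a homological category is homological, and dualizing the diagram exchanges its two
  halves, so it is almost always enough to treat the left half.

  Lambek's theorem reduces to the homology of a null sequence: with E the common image of the shared
  side, the invariants are Ker (E -> D) / A and Ker (E / A -> D) for a null sequence A -> E -> D,
  and the subquotient axiom together with closure of kernels and cokernels under composition
  identifies the two.

  The only composites whose nullness is not immediate are Lambda beta and, dually, beta' Lambda.
  Both Lambda_{S,T} and Lambda_{S,S_1} are induced by the identity of E, and N_{S_1} -> N_T is the
  further quotient along Coker f -> Coim g; so Lambda beta becomes the restriction of
  Coker f -> Coim g to Ker eta. This is null because Coker f -> C is, and because the morphism
  Coim g -> Im g reflects null morphisms in a homological category.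
*)
theory Submission
  imports Defs
begin

section \<open>Duality\<close>

text \<open>The ideal replaces zero morphisms: there need be no zero object, and an arbitrary
  monomorphism need not reflect null morphisms. Kernels do, because the ideal is closed, and most
  arguments are reduced to asking which morphisms a given one sends into the ideal: kernels and
  cokernels depend on nothing else, and subobjects are compared by the conditions that cut them out.

  Duality is made literal: \<open>opp\<close> also exchanges the chosen kernels with the chosen
  cokernels and the pullback projections with the pushout coprojections, so the constructions of one
  half turn into those of the other. What breaks the symmetry is homology, which is always taken in
  the cokernel form \<open>Coker (sharp f g)\<close>; its dual is the kernel form. Hence the arrows
  marked \<open>_pre\<close> are dual to each other, but their transports along
  \<open>ker_h_iso\<close>, \<open>coker_h_iso\<close> and \<open>homology_iso\<close> are not: the
  identifications of \<open>Ker h\<close> and of \<open>Coker h\<close> are established separately,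
  and nullness is dualized before transport.\<close>

definition opp :: "('o, 'm, 'x) chosen_category_scheme \<Rightarrow> ('o, 'm, 'x) chosen_category_scheme" where
  "opp C = C\<lparr>Dom := Cod C, Cod := Dom C, Comp := (\<lambda>f g. Comp C g f),
     chosen_ker := chosen_coker C, chosen_coker := chosen_ker C,
     pb_fst := po_fst C, pb_snd := po_snd C, po_fst := pb_fst C, po_snd := pb_snd C\<rparr>"

lemma opp_fields [simp]:
  "Obj (opp C) = Obj C" "Arr (opp C) = Arr C" "Dom (opp C) = Cod C" "Cod (opp C) = Dom C"
  "Id (opp C) = Id C" "Comp (opp C) f g = Comp C g f" "Null (opp C) = Null C"
  "chosen_ker (opp C) = chosen_coker C" "chosen_coker (opp C) = chosen_ker C"
  "pb_fst (opp C) = po_fst C" "pb_snd (opp C) = po_snd C"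
  "po_fst (opp C) = pb_fst C" "po_snd (opp C) = pb_snd C"
  by (simp_all add: opp_def)

lemma hom_opp [simp]: "hom (opp C) X Y = hom C Y X"
  by (auto simp: hom_def)

lemma is_inverse_opp [simp]: "is_inverse (opp C) f g \<longleftrightarrow> is_inverse C f g"
  by (auto simp: is_inverse_def hom_def)

lemma is_iso_opp [simp]: "is_iso (opp C) = is_iso C"
  by (simp add: is_iso_def fun_eq_iff)

lemma inv_arr_opp [simp]: "inv_arr (opp C) = inv_arr C"
  by (simp add: inv_arr_def fun_eq_iff)

lemma is_lift_opp [simp]: "is_lift (opp C) = is_colift C"
  by (simp add: is_lift_def is_colift_def fun_eq_iff)

lemma is_colift_opp [simp]: "is_colift (opp C) = is_lift C"
  by (simp add: is_lift_def is_colift_def fun_eq_iff)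

lemma is_kernel_opp [simp]: "is_kernel (opp C) = is_cokernel C"
  by (simp add: is_kernel_def is_cokernel_def fun_eq_iff)

lemma is_cokernel_opp [simp]: "is_cokernel (opp C) = is_kernel C"
  by (simp add: is_kernel_def is_cokernel_def fun_eq_iff)

lemma kernel_arrow_opp [simp]: "kernel_arrow (opp C) = cokernel_arrow C"
  by (simp add: kernel_arrow_def cokernel_arrow_def fun_eq_iff)

lemma cokernel_arrow_opp [simp]: "cokernel_arrow (opp C) = kernel_arrow C"
  by (simp add: kernel_arrow_def cokernel_arrow_def fun_eq_iff)

lemma is_pullback_opp [simp]: "is_pullback (opp C) = is_pushout C"
  by (simp add: is_pullback_def is_pushout_def fun_eq_iff)

lemma is_pushout_opp [simp]: "is_pushout (opp C) = is_pullback C"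
  by (simp add: is_pullback_def is_pushout_def fun_eq_iff)

lemma lift_opp [simp]: "lift (opp C) = colift C"
  by (simp add: lift_def colift_def fun_eq_iff)

lemma colift_opp [simp]: "colift (opp C) = lift C"
  by (simp add: lift_def colift_def fun_eq_iff)

lemma lifts_opp [simp]: "lifts (opp C) = colifts C"
  by (simp add: lifts_def colifts_def fun_eq_iff)

lemma colifts_opp [simp]: "colifts (opp C) = lifts C"
  by (simp add: lifts_def colifts_def fun_eq_iff)

lemma on_ker_opp [simp]: "on_ker (opp C) x y u = on_coker C y x u"
  by (simp add: on_ker_def on_coker_def)

lemma on_coker_opp [simp]: "on_coker (opp C) x y u = on_ker C y x u"
  by (simp add: on_ker_def on_coker_def)

lemma induces_on_ker_opp [simp]: "induces_on_ker (opp C) x y u = induces_on_coker C y x u"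
  by (simp add: induces_on_ker_def induces_on_coker_def)

lemma induces_on_coker_opp [simp]: "induces_on_coker (opp C) x y u = induces_on_ker C y x u"
  by (simp add: induces_on_ker_def induces_on_coker_def)

lemma im_opp [simp]: "im (opp C) = coim C"
  by (simp add: im_def coim_def fun_eq_iff)

lemma coim_opp [simp]: "coim (opp C) = im C"
  by (simp add: im_def coim_def fun_eq_iff)

lemma sharp_opp [simp]: "sharp (opp C) f g = flat C g f"
  by (simp add: sharp_def flat_def)

lemma flat_opp [simp]: "flat (opp C) f g = sharp C g f"
  by (simp add: sharp_def flat_def)

text \<open>Equal composites \<open>m \<cdot> x\<close> and \<open>m \<cdot> y\<close> of composable
  arrows have equal domains, so it is enough to compare the codomains of \<open>x\<close> and
  \<open>y\<close> with \<open>Dom m\<close>.\<close>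

definition mono_arr :: "('o, 'm, 'x) chosen_category_scheme \<Rightarrow> 'm \<Rightarrow> bool" where
  "mono_arr C m \<longleftrightarrow> m \<in> Arr C \<and> (\<forall>x \<in> Arr C. \<forall>y \<in> Arr C.
     Cod C x = Dom C m \<and> Cod C y = Dom C m \<and> Comp C m x = Comp C m y \<longrightarrow> x = y)"

definition epi_arr :: "('o, 'm, 'x) chosen_category_scheme \<Rightarrow> 'm \<Rightarrow> bool" where
  "epi_arr C q \<longleftrightarrow> q \<in> Arr C \<and> (\<forall>x \<in> Arr C. \<forall>y \<in> Arr C.
     Dom C x = Cod C q \<and> Dom C y = Cod C q \<and> Comp C x q = Comp C y q \<longrightarrow> x = y)"

lemma mono_arr_opp [simp]: "mono_arr (opp C) = epi_arr C"
  by (simp add: mono_arr_def epi_arr_def fun_eq_iff)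

lemma epi_arr_opp [simp]: "epi_arr (opp C) = mono_arr C"
  by (simp add: mono_arr_def epi_arr_def fun_eq_iff)

context homological_category_with_choices
begin

text \<open>Two axioms are self-dual only after rearrangement. The ideal law changes its bracketing.
  In the subquotient axiom the kernel \<open>i\<close> and the cokernel \<open>q\<close> trade
  places, and so do \<pi> and \<iota>; the hypothesis keeps its shape, since the cokernel of the
  kernel arrow is still composed with the kernel of the cokernel arrow.\<close>

lemma homological_opp: "homological_category_with_choices (opp C)"
proof (unfold_locales, simp_all)
  show "\<And>f. f \<in> Arr C \<Longrightarrow> Cod C f \<in> Obj C" by (rule Cod_closed)
  show "\<And>f. f \<in> Arr C \<Longrightarrow> Dom C f \<in> Obj C" by (rule Dom_closed)
  show "\<And>X. X \<in> Obj C \<Longrightarrow> Id C X \<in> hom C X X" by (rule Id_closed)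
  show "\<And>f X Y g Z. f \<in> hom C Y X \<Longrightarrow> g \<in> hom C Z Y \<Longrightarrow> f \<cdot> g \<in> hom C Z X" by (rule Comp_closed)
  show "\<And>f X Y. f \<in> hom C Y X \<Longrightarrow> f \<cdot> Id C Y = f" by (rule Id_right)
  show "\<And>f X Y. f \<in> hom C Y X \<Longrightarrow> Id C X \<cdot> f = f" by (rule Id_left)
  show "\<And>f W X g Y h Z. f \<in> hom C X W \<Longrightarrow> g \<in> hom C Y X \<Longrightarrow> h \<in> hom C Z Y \<Longrightarrow> f \<cdot> g \<cdot> h = (f \<cdot> g) \<cdot> h"
    by (rule Comp_assoc [symmetric])
  show "Null C \<subseteq> Arr C" by (rule Null_Arr)
  show "\<And>g W X f Y h Z. g \<in> hom C X W \<Longrightarrow> f \<in> hom C Y X \<Longrightarrow> f \<in> Null C \<Longrightarrow> h \<in> hom C Z Y \<Longrightarrow> (g \<cdot> f) \<cdot> h \<in> Null C"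
    by (metis Null_ideal Comp_assoc)
  show "\<And>f. f \<in> Null C \<Longrightarrow> \<exists>Z\<in>Obj C. Id C Z \<in> Null C \<and> (\<exists>u\<in>hom C Z (Cod C f). \<exists>v\<in>hom C (Dom C f) Z. f = u \<cdot> v)"
    using Null_closed by meson
  show "\<And>f. f \<in> Arr C \<Longrightarrow> Ex (\<lambda>k. is_cokernel C k f)" by (rule cokernel_exists)
  show "\<And>f. f \<in> Arr C \<Longrightarrow> Ex (\<lambda>k. is_kernel C k f)" by (rule kernel_exists)
  show "\<And>k l. cokernel_arrow C k \<Longrightarrow> cokernel_arrow C l \<Longrightarrow> Dom C k = Cod C l \<Longrightarrow> cokernel_arrow C (k \<cdot> l)"
    by (rule cokernels_comp [OF _ _ sym])
  show "\<And>k l. kernel_arrow C k \<Longrightarrow> kernel_arrow C l \<Longrightarrow> Dom C k = Cod C l \<Longrightarrow> kernel_arrow C (k \<cdot> l)"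
    by (rule kernels_comp [OF _ _ sym])
  next
    fix i q ci kq
    assume a: "cokernel_arrow C i" "kernel_arrow C q" "Dom C i = Cod C q" "is_kernel C ci i"
      "is_cokernel C kq q" "kq \<cdot> ci \<in> Null C"
    obtain \<pi> \<iota> where "cokernel_arrow C \<pi>" "kernel_arrow C \<iota>" "Dom C \<pi> = Dom C q" "Cod C \<pi> = Dom C \<iota>"
      "Cod C \<iota> = Cod C i" "i \<cdot> q = \<iota> \<cdot> \<pi>"
      using subquotient [OF a(2,1) a(3) [symmetric] a(5,4,6)] by (elim exE conjE)
    then show "\<exists>\<pi>. kernel_arrow C \<pi> \<and> (\<exists>\<iota>. cokernel_arrow C \<iota> \<and> Cod C \<pi> = Cod C i \<and> Dom C \<pi> = Cod C \<iota> \<and> Dom C \<iota> = Dom C q \<and> i \<cdot> q = \<pi> \<cdot> \<iota>)"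
      by (intro exI [of _ \<iota>] exI [of _ \<pi>] conjI) simp_all
  next
  show "\<And>f. f \<in> Arr C \<Longrightarrow> is_cokernel C (coker f) f" by (rule coker_choice)
  show "\<And>f. f \<in> Arr C \<Longrightarrow> is_kernel C (ker f) f" by (rule ker_choice)
  show "\<And>x y p q. is_pushout C x y p q \<Longrightarrow> is_pushout C x y (po_fst C x y) (po_snd C x y)" by (rule pushout_choice)
  show "\<And>x y p q. is_pullback C x y p q \<Longrightarrow> is_pullback C x y (pb_fst C x y) (pb_snd C x y)" by (rule pullback_choice)
qed

end

section \<open>Lifts and inverses\<close>

lemma mono_arr_Arr: "mono_arr C m \<Longrightarrow> m \<in> Arr C"
  by (simp add: mono_arr_def)

lemma mono_arr_cancel:
  "mono_arr C m \<Longrightarrow> x \<in> Arr C \<Longrightarrow> y \<in> Arr C \<Longrightarrow> Cod C x = Dom C m \<Longrightarrow> Cod C y = Dom C m \<Longrightarrow>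
   Comp C m x = Comp C m y \<Longrightarrow> x = y"
  by (simp add: mono_arr_def)

lemma epi_arr_Arr: "epi_arr C q \<Longrightarrow> q \<in> Arr C"
  by (simp add: epi_arr_def)

lemma epi_arr_cancel:
  "epi_arr C q \<Longrightarrow> x \<in> Arr C \<Longrightarrow> y \<in> Arr C \<Longrightarrow> Dom C x = Cod C q \<Longrightarrow> Dom C y = Cod C q \<Longrightarrow>
   Comp C x q = Comp C y q \<Longrightarrow> x = y"
  by (simp add: epi_arr_def)

lemma is_liftD:
  assumes "is_lift C k x y"
  shows "y \<in> Arr C" "Dom C y = Dom C x" "Cod C y = Dom C k" "Comp C k y = x"
  using assms by (auto simp: is_lift_def hom_def)

lemma is_liftI:
  "y \<in> Arr C \<Longrightarrow> Dom C y = Dom C x \<Longrightarrow> Cod C y = Dom C k \<Longrightarrow> Comp C k y = x \<Longrightarrow> is_lift C k x y"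
  by (auto simp: is_lift_def hom_def)

lemma is_coliftD:
  assumes "is_colift C q x y"
  shows "y \<in> Arr C" "Dom C y = Cod C q" "Cod C y = Cod C x" "Comp C y q = x"
  using assms by (auto simp: is_colift_def hom_def)

lemma liftsD: "lifts C k x \<Longrightarrow> is_lift C k x (lift C k x)"
  unfolding lifts_def lift_def by (rule theI')

lemma coliftsD: "colifts C q x \<Longrightarrow> is_colift C q x (colift C q x)"
  unfolding colifts_def colift_def by (rule theI')

lemma mono_lift:
  assumes "mono_arr C k" "is_lift C k x y"
  shows "lifts C k x" "lift C k x = y"
proof -
  have u: "z = y" if "is_lift C k x z" for z
    by (rule mono_arr_cancel [OF assms(1)]) (simp_all add: is_liftD [OF that] is_liftD [OF assms(2)])
  with assms(2) show "lifts C k x" unfolding lifts_def by (intro ex1I)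
  show "lift C k x = y" unfolding lift_def using assms(2) u by (intro the_equality)
qed

lemma is_kernelD:
  assumes "is_kernel C k f"
  shows "f \<in> Arr C" "k \<in> Arr C" "Cod C k = Dom C f" "Comp C f k \<in> Null C"
  using assms by (simp_all add: is_kernel_def)

lemma is_kernel_lifts:
  assumes "is_kernel C k f" "x \<in> Arr C" "Cod C x = Dom C f" "Comp C f x \<in> Null C"
  shows "lifts C k x"
  using assms by (simp add: is_kernel_def lifts_def)

lemma is_cokernelD:
  assumes "is_cokernel C q f"
  shows "f \<in> Arr C" "q \<in> Arr C" "Dom C q = Cod C f" "Comp C q f \<in> Null C"
  using assms by (simp_all add: is_cokernel_def)

lemma is_cokernel_colifts:
  assumes "is_cokernel C q f" "x \<in> Arr C" "Dom C x = Cod C f" "Comp C x f \<in> Null C"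
  shows "colifts C q x"
  using assms by (simp add: is_cokernel_def colifts_def)

lemma is_pullback_commute: "is_pullback C x y p q \<Longrightarrow> is_pullback C y x q p"
  unfolding is_pullback_def by (metis (no_types, lifting))

lemma is_inverseD:
  assumes "is_inverse C f g"
  shows "f \<in> Arr C" "g \<in> Arr C" "Dom C g = Cod C f" "Cod C g = Dom C f"
    "Comp C g f = Id C (Dom C f)" "Comp C f g = Id C (Cod C f)"
  using assms by (auto simp: is_inverse_def hom_def)

context homological_category_with_choices
begin

lemma Comp_typing [simp]:
  assumes "f \<in> Arr C" "g \<in> Arr C" "Cod C f = Dom C g"
  shows "g \<cdot> f \<in> Arr C" "Dom C (g \<cdot> f) = Dom C f" "Cod C (g \<cdot> f) = Cod C g"
  using Comp_closed [of f "Dom C f" "Dom C g" g "Cod C g"] assms by (auto simp: hom_def)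

lemma assoc [simp]:
  assumes "f \<in> Arr C" "g \<in> Arr C" "h \<in> Arr C" "Cod C f = Dom C g" "Cod C g = Dom C h"
  shows "(h \<cdot> g) \<cdot> f = h \<cdot> g \<cdot> f"
  using Comp_assoc [of f "Dom C f" "Dom C g" g "Dom C h" h "Cod C h"] assms by (auto simp: hom_def)

lemma Id_typing [simp]:
  assumes "X \<in> Obj C"
  shows "Id C X \<in> Arr C" "Dom C (Id C X) = X" "Cod C (Id C X) = X"
  using Id_closed [OF assms] by (auto simp: hom_def)

lemma Id_simps [simp]:
  assumes "f \<in> Arr C"
  shows "X = Cod C f \<Longrightarrow> Id C X \<cdot> f = f" "X = Dom C f \<Longrightarrow> f \<cdot> Id C X = f"
  using assms by (auto intro!: Id_left Id_right simp: hom_def)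

lemma Dom_Obj [simp]: "f \<in> Arr C \<Longrightarrow> Dom C f \<in> Obj C"
  and Cod_Obj [simp]: "f \<in> Arr C \<Longrightarrow> Cod C f \<in> Obj C"
  by (auto intro: Dom_closed Cod_closed)

lemma reassoc:
  assumes "g \<cdot> f = h" "f \<in> Arr C" "g \<in> Arr C" "Cod C f = Dom C g" "x \<in> Arr C" "Cod C x = Dom C f"
  shows "g \<cdot> f \<cdot> x = h \<cdot> x"
  using assoc [of x f g] assms by simp

section \<open>Null morphisms\<close>

lemma Null_in_Arr: "f \<in> Null C \<Longrightarrow> f \<in> Arr C"
  using Null_Arr by auto

lemma null_left:
  assumes "f \<in> Null C" "h \<in> Arr C" "Cod C f = Dom C h"
  shows "h \<cdot> f \<in> Null C"
proof -
  have f: "f \<in> Arr C" using assms by (auto dest: Null_in_Arr)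
  have "h \<cdot> f \<cdot> Id C (Dom C f) \<in> Null C"
    using assms f by (intro Null_ideal [of _ "Dom C f" "Dom C f" _ "Dom C h" _ "Cod C h"]) (auto simp: hom_def)
  then show ?thesis using assms f by simp
qed

lemma null_right:
  assumes "f \<in> Null C" "h \<in> Arr C" "Cod C h = Dom C f"
  shows "f \<cdot> h \<in> Null C"
  using homological_category_with_choices.null_left [OF homological_opp, of f h] assms by simp

text \<open>This is where closedness of the ideal enters. If
  \<open>k \<cdot> x = v \<cdot> u\<close> through a null object, then \<open>v\<close> is null, so
  \<open>d \<cdot> v\<close> is null and \<open>v = k \<cdot> w\<close>; uniqueness of lifts along
  \<open>k\<close> gives \<open>x = w \<cdot> u\<close> with \<open>u\<close> null.\<close>

lemma kernel_reflects_null: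
  assumes k: "is_kernel C k d" and x: "x \<in> Arr C" "Cod C x = Dom C k" and n: "k \<cdot> x \<in> Null C"
  shows "x \<in> Null C"
proof -
  note K = is_kernelD [OF k]
  obtain Z u v where Z: "Z \<in> Obj C" "Id C Z \<in> Null C" and u: "u \<in> Arr C" "Dom C u = Dom C x" "Cod C u = Z"
    and v: "v \<in> Arr C" "Dom C v = Z" "Cod C v = Dom C d" and e: "k \<cdot> x = v \<cdot> u"
    using Null_closed [OF n] K x by (auto simp: hom_def)
  have nu: "u \<in> Null C" using null_right [OF Z(2) u(1)] Z u by simp
  have nv: "v \<in> Null C" using null_left [OF Z(2) v(1)] Z v by simp
  obtain w where w: "w \<in> Arr C" "Dom C w = Z" "Cod C w = Dom C k" "k \<cdot> w = v"
    using is_liftD [OF liftsD [OF is_kernel_lifts [OF k v(1,3)]]] null_left [OF nv] K v by auto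
  have "\<exists>!y. is_lift C k (k \<cdot> x) y"
    using is_kernel_lifts [OF k, of "k \<cdot> x"] null_left [OF n] K x by (simp add: lifts_def)
  moreover have "is_lift C k (k \<cdot> x) x"
    using x K by (intro is_liftI) simp_all
  moreover have "k \<cdot> w \<cdot> u = k \<cdot> x" unfolding e using w u v K by (intro reassoc) simp_all
  then have "is_lift C k (k \<cdot> x) (w \<cdot> u)"
    using x w u v K by (intro is_liftI) simp_all
  ultimately have "x = w \<cdot> u" by blast
  then show ?thesis using null_left [OF nu w(1)] w u by simp
qed

lemma is_kernel_mono:
  assumes k: "is_kernel C k d" shows "mono_arr C k"
proof -
  note K = is_kernelD [OF k]
  have "x = y" if "x \<in> Arr C" "y \<in> Arr C" "Cod C x = Dom C k" "Cod C y = Dom C k" "k \<cdot> x = k \<cdot> y" for x y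
  proof -
    have D: "Dom C x = Dom C y"
      using that K Comp_typing(2) [of x k] Comp_typing(2) [of y k] by simp
    have "d \<cdot> k \<cdot> x \<in> Null C" using null_right [OF K(4) that(1)] that K by simp
    then have "\<exists>!z. is_lift C k (k \<cdot> x) z"
      using is_kernel_lifts [OF k, of "k \<cdot> x"] K that by (simp add: lifts_def)
    moreover have "is_lift C k (k \<cdot> x) x"
      by (rule is_liftI) (use that(1-4) K in simp_all)
    moreover have "is_lift C k (k \<cdot> x) y"
      by (rule is_liftI) (use that(1-4) that(5) [symmetric] K D in simp_all)
    ultimately show ?thesis by blast
  qed
  then show ?thesis using K by (simp add: mono_arr_def)
qed

end

lemma is_middleD:
  assumes "is_middle C k q x y"
  shows "y \<in> Arr C" "Dom C y = Cod C q" "Cod C y = Dom C k" "Comp C k (Comp C y q) = x"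
  using assms by (auto simp: is_middle_def hom_def)

lemma is_middleI:
  "y \<in> Arr C \<Longrightarrow> Dom C y = Cod C q \<Longrightarrow> Cod C y = Dom C k \<Longrightarrow> Comp C k (Comp C y q) = x \<Longrightarrow>
   is_middle C k q x y"
  by (auto simp: is_middle_def hom_def)

lemma has_middleD: "has_middle C k q x \<Longrightarrow> is_middle C k q x (middle C k q x)"
  unfolding has_middle_def middle_def by (rule theI')

lemma mono_arrI:
  assumes "m \<in> Arr C"
    and "\<And>x y. x \<in> Arr C \<Longrightarrow> y \<in> Arr C \<Longrightarrow> Cod C x = Dom C m \<Longrightarrow> Cod C y = Dom C m \<Longrightarrow>
      Comp C m x = Comp C m y \<Longrightarrow> x = y"
  shows "mono_arr C m"
  using assms by (simp add: mono_arr_def)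

text \<open>For monic \<open>k\<close> this is membership of the generalized element
  \<open>x\<close> in the subobject \<open>k\<close>. Existence alone is asked, since uniqueness
  then comes from \<open>k\<close>.\<close>

definition factors :: "('o, 'm, 'x) chosen_category_scheme \<Rightarrow> 'm \<Rightarrow> 'm \<Rightarrow> bool" where
  "factors C k x \<longleftrightarrow> (\<exists>y. is_lift C k x y)"

context homological_category_with_choices
begin

lemmas is_cokernel_epi = homological_category_with_choices.is_kernel_mono [OF homological_opp, simplified]

lemma cokernel_reflects_null:
  "is_cokernel C q d \<Longrightarrow> x \<in> Arr C \<Longrightarrow> Dom C x = Cod C q \<Longrightarrow> x \<cdot> q \<in> Null C \<Longrightarrow> x \<in> Null C"
  using homological_category_with_choices.kernel_reflects_null [OF homological_opp, of q d x] by simp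

section \<open>Kernels and cokernels, and their dependence on annihilated morphisms\<close>

lemma ker_typing [simp]:
  assumes "f \<in> Arr C"
  shows "ker f \<in> Arr C" "Cod C (ker f) = Dom C f" "f \<cdot> ker f \<in> Null C" "mono_arr C (ker f)"
  using is_kernelD [OF ker_choice [OF assms]] is_kernel_mono [OF ker_choice [OF assms]] by simp_all

lemma coker_typing [simp]:
  assumes "f \<in> Arr C"
  shows "coker f \<in> Arr C" "Dom C (coker f) = Cod C f" "coker f \<cdot> f \<in> Null C" "epi_arr C (coker f)"
  using is_cokernelD [OF coker_choice [OF assms]] is_cokernel_epi [OF coker_choice [OF assms]] by simp_all

lemma ker_reflects_null:
  "f \<in> Arr C \<Longrightarrow> x \<in> Arr C \<Longrightarrow> Cod C x = Dom C (ker f) \<Longrightarrow> ker f \<cdot> x \<in> Null C \<Longrightarrow> x \<in> Null C"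
  using kernel_reflects_null [OF ker_choice] by blast

lemma coker_reflects_null:
  "f \<in> Arr C \<Longrightarrow> x \<in> Arr C \<Longrightarrow> Dom C x = Cod C (coker f) \<Longrightarrow> x \<cdot> coker f \<in> Null C \<Longrightarrow> x \<in> Null C"
  using cokernel_reflects_null [OF coker_choice] by blast

lemma kernel_arrow_ker [simp]: "f \<in> Arr C \<Longrightarrow> kernel_arrow C (ker f)"
  using ker_choice by (auto simp: kernel_arrow_def)

lemma cokernel_arrow_coker [simp]: "f \<in> Arr C \<Longrightarrow> cokernel_arrow C (coker f)"
  using coker_choice by (auto simp: cokernel_arrow_def)

lemma kernel_factor:
  assumes "is_kernel C k d" "x \<in> Arr C" "Cod C x = Dom C d" "d \<cdot> x \<in> Null C"
  obtains y where "y \<in> Arr C" "Dom C y = Dom C x" "Cod C y = Dom C k" "k \<cdot> y = x"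
  using is_liftD [OF liftsD [OF is_kernel_lifts [OF assms]]] by blast

lemma cokernel_factor:
  assumes "is_cokernel C q d" "x \<in> Arr C" "Dom C x = Cod C d" "x \<cdot> d \<in> Null C"
  obtains y where "y \<in> Arr C" "Dom C y = Cod C q" "Cod C y = Cod C x" "y \<cdot> q = x"
  using is_coliftD [OF coliftsD [OF is_cokernel_colifts [OF assms]]] by blast

lemma ker_lift:
  assumes "d \<in> Arr C" "x \<in> Arr C" "Cod C x = Dom C d" "d \<cdot> x \<in> Null C"
  shows "lifts C (ker d) x" "lift C (ker d) x \<in> Arr C" "Dom C (lift C (ker d) x) = Dom C x"
    "Cod C (lift C (ker d) x) = Dom C (ker d)" "ker d \<cdot> lift C (ker d) x = x"
proof -
  show l: "lifts C (ker d) x" using is_kernel_lifts [OF ker_choice] assms by simp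
  show "lift C (ker d) x \<in> Arr C" "Dom C (lift C (ker d) x) = Dom C x"
    "Cod C (lift C (ker d) x) = Dom C (ker d)" "ker d \<cdot> lift C (ker d) x = x"
    using is_liftD [OF liftsD [OF l]] by simp_all
qed

lemma coker_colift:
  assumes "d \<in> Arr C" "x \<in> Arr C" "Dom C x = Cod C d" "x \<cdot> d \<in> Null C"
  shows "colifts C (coker d) x" "colift C (coker d) x \<in> Arr C" "Cod C (colift C (coker d) x) = Cod C x"
    "Dom C (colift C (coker d) x) = Cod C (coker d)" "colift C (coker d) x \<cdot> coker d = x"
  using homological_category_with_choices.ker_lift [OF homological_opp, of d x] assms by simp_all

text \<open>A kernel of \<open>d\<close> is determined by the class of morphisms that
  \<open>d\<close> annihilates, so \<open>d\<close> may be replaced by any \<open>d'\<close> with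
  the same class, even when no morphism relates their codomains.\<close>

lemma is_kernel_cong:
  assumes k: "is_kernel C k d" and d': "d' \<in> Arr C" "Dom C d' = Dom C d"
    and eq: "\<And>x. x \<in> Arr C \<Longrightarrow> Cod C x = Dom C d \<Longrightarrow> d' \<cdot> x \<in> Null C \<longleftrightarrow> d \<cdot> x \<in> Null C"
  shows "is_kernel C k d'"
  unfolding is_kernel_def
proof (intro conjI ballI impI)
  fix x assume "x \<in> Arr C" "Cod C x = Dom C d' \<and> d' \<cdot> x \<in> Null C"
  then show "\<exists>!y. is_lift C k x y"
    using is_kernel_lifts [OF k, of x] eq [of x] d' unfolding lifts_def by simp
qed (use is_kernelD [OF k] d' eq in simp_all)

lemma is_cokernel_cong:
  assumes k: "is_cokernel C k d" and d': "d' \<in> Arr C" "Cod C d' = Cod C d"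
    and eq: "\<And>x. x \<in> Arr C \<Longrightarrow> Dom C x = Cod C d \<Longrightarrow> x \<cdot> d' \<in> Null C \<longleftrightarrow> x \<cdot> d \<in> Null C"
  shows "is_cokernel C k d'"
  using homological_category_with_choices.is_kernel_cong [OF homological_opp, of k d d'] assms by simp

text \<open>\<open>d\<close> annihilates \<open>k\<close>, so it factors through
  \<open>coker k\<close>, and whatever \<open>coker k\<close> annihilates, \<open>d\<close>
  annihilates. Conversely, a morphism annihilated by \<open>d\<close> factors through
  \<open>k\<close>.\<close>

lemma kernel_arrow_coker:
  assumes "kernel_arrow C k" shows "is_kernel C k (coker k)"
proof -
  obtain d where k: "is_kernel C k d" using assms by (auto simp: kernel_arrow_def)
  note K = is_kernelD [OF k]
  obtain d' where d': "d' \<in> Arr C" "Dom C d' = Cod C (coker k)" "Cod C d' = Cod C d" "d' \<cdot> coker k = d"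
    by (rule cokernel_factor [OF coker_choice [OF K(2)] K(1) K(3) [symmetric] K(4)]) (use K(3) in simp)
  show ?thesis
  proof (rule is_kernel_cong [OF k])
    show "coker k \<in> Arr C" "Dom C (coker k) = Dom C d" using K by simp_all
    fix x assume x: "x \<in> Arr C" "Cod C x = Dom C d"
    show "coker k \<cdot> x \<in> Null C \<longleftrightarrow> d \<cdot> x \<in> Null C"
    proof
      assume "coker k \<cdot> x \<in> Null C"
      then have "d' \<cdot> coker k \<cdot> x \<in> Null C" by (rule null_left) (use d' x K in simp_all)
      moreover have "d' \<cdot> coker k \<cdot> x = d \<cdot> x" by (rule reassoc) (use d' x K in simp_all)
      ultimately show "d \<cdot> x \<in> Null C" by simp
    next
      assume "d \<cdot> x \<in> Null C"
      then obtain y where y: "y \<in> Arr C" "Dom C y = Dom C x" "Cod C y = Dom C k" "k \<cdot> y = x"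
        using kernel_factor [OF k x] by metis
      have "(coker k \<cdot> k) \<cdot> y \<in> Null C" by (rule null_right) (use y K in simp_all)
      then show "coker k \<cdot> x \<in> Null C" using y K by simp
    qed
  qed
qed

lemma cokernel_arrow_ker: "cokernel_arrow C k \<Longrightarrow> is_cokernel C k (ker k)"
  using homological_category_with_choices.kernel_arrow_coker [OF homological_opp, of k] by simp

section \<open>Isomorphisms and comparison of subobjects\<close>

lemma mono_isoI:
  assumes k: "mono_arr C k" and l: "mono_arr C l" and y: "is_lift C k l y" and z: "is_lift C l k z"
  shows "is_inverse C y z"
proof -
  note S = is_liftD [OF y] is_liftD [OF z] mono_arr_Arr [OF k] mono_arr_Arr [OF l]
  have e1: "l \<cdot> z \<cdot> y = l" "k \<cdot> y \<cdot> z = k"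
    using reassoc [OF S(4)] reassoc [OF S(8)] S by simp_all
  have cc: "Cod C k = Cod C l" using S Comp_typing(3) [of y k] by simp
  have "z \<cdot> y = Id C (Dom C l)"
    by (rule mono_arr_cancel [OF l]) (use S e1 in simp_all)
  moreover have "y \<cdot> z = Id C (Dom C k)"
    by (rule mono_arr_cancel [OF k]) (use S e1 in simp_all)
  ultimately show ?thesis using S by (simp add: is_inverse_def hom_def)
qed

lemma inv_arr_eq:
  assumes "is_inverse C f g" shows "inv_arr C f = g"
  unfolding inv_arr_def
proof (rule the_equality)
  show "is_inverse C f g" by fact
  fix h assume h: "is_inverse C f h"
  note S = is_inverseD [OF h] is_inverseD [OF assms]
  have "h = h \<cdot> f \<cdot> g" using S by simp
  also have "\<dots> = (h \<cdot> f) \<cdot> g" using S(1-4,7-10) by simp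
  also have "\<dots> = g" unfolding S(5) using S by simp
  finally show "h = g" .
qed

lemma iso_inverse: "is_iso C f \<Longrightarrow> is_inverse C f (inv_arr C f)"
  using inv_arr_eq by (auto simp: is_iso_def)

lemma iso_inv_typing [simp]:
  assumes "is_iso C f"
  shows "inv_arr C f \<in> Arr C" "Dom C (inv_arr C f) = Cod C f" "Cod C (inv_arr C f) = Dom C f"
  using is_inverseD [OF iso_inverse [OF assms]] by simp_all

lemma iso_Arr: "is_iso C f \<Longrightarrow> f \<in> Arr C"
  by (auto simp: is_iso_def is_inverse_def)

lemma iso_cancel:
  assumes "is_iso C f"
  shows "inv_arr C f \<cdot> f = Id C (Dom C f)" "f \<cdot> inv_arr C f = Id C (Cod C f)"
    "x \<in> Arr C \<Longrightarrow> Cod C x = Dom C f \<Longrightarrow> inv_arr C f \<cdot> f \<cdot> x = x"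
    "x \<in> Arr C \<Longrightarrow> Cod C x = Cod C f \<Longrightarrow> f \<cdot> inv_arr C f \<cdot> x = x"
proof -
  note S = is_inverseD [OF iso_inverse [OF assms]]
  show "inv_arr C f \<cdot> f = Id C (Dom C f)" "f \<cdot> inv_arr C f = Id C (Cod C f)" using S by simp_all
  show "x \<in> Arr C \<Longrightarrow> Cod C x = Dom C f \<Longrightarrow> inv_arr C f \<cdot> f \<cdot> x = x"
    using reassoc [OF S(5)] S by simp
  show "x \<in> Arr C \<Longrightarrow> Cod C x = Cod C f \<Longrightarrow> f \<cdot> inv_arr C f \<cdot> x = x"
    using reassoc [OF S(6)] S by simp
qed

lemma iso_mono:
  assumes "is_iso C f" shows "mono_arr C f"
proof (rule mono_arrI)
  show "f \<in> Arr C" using assms by (rule iso_Arr)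
  fix x y assume xy: "x \<in> Arr C" "y \<in> Arr C" "Cod C x = Dom C f" "Cod C y = Dom C f" "f \<cdot> x = f \<cdot> y"
  have "x = inv_arr C f \<cdot> f \<cdot> x" using iso_cancel(3) [OF assms xy(1,3)] by simp
  also have "\<dots> = y" unfolding xy(5) using iso_cancel(3) [OF assms xy(2,4)] .
  finally show "x = y" .
qed

lemma iso_epi: "is_iso C f \<Longrightarrow> epi_arr C f"
  using homological_category_with_choices.iso_mono [OF homological_opp, of f] by simp

lemma is_inverse_sym: "is_inverse C f g \<Longrightarrow> is_inverse C g f"
  by (auto simp: is_inverse_def hom_def)

lemma iso_inv [simp]: "is_iso C f \<Longrightarrow> is_iso C (inv_arr C f)"
  using iso_inverse is_inverse_sym by (auto simp: is_iso_def)

lemma iso_comp: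
  assumes f: "is_iso C f" and g: "is_iso C g" and "Cod C f = Dom C g"
  shows "is_iso C (g \<cdot> f)"
proof -
  note F = iso_Arr [OF f] iso_Arr [OF g] iso_inv_typing [OF f] iso_inv_typing [OF g] iso_cancel [OF f] iso_cancel [OF g] assms(3)
  have "is_inverse C (g \<cdot> f) (inv_arr C f \<cdot> inv_arr C g)"
    using F by (simp add: is_inverse_def hom_def)
  then show ?thesis by (auto simp: is_iso_def)
qed

lemma iso_reflects_null:
  assumes "is_iso C f" "x \<in> Arr C" "Cod C x = Dom C f" "f \<cdot> x \<in> Null C"
  shows "x \<in> Null C"
  using null_left [OF assms(4), of "inv_arr C f"] iso_cancel(3) [OF assms(1-3)] assms iso_Arr [OF assms(1)]
  by simp

lemma factors_self: "k \<in> Arr C \<Longrightarrow> factors C k k"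
  unfolding factors_def by (rule exI [of _ "Id C (Dom C k)"]) (simp add: is_lift_def hom_def)

text \<open>The equivalence is applied to the two monomorphisms themselves, which gives lifts in
  both directions. The identifications of subobjects below come from here, out of a common
  description of what factors through each.\<close>

lemma factors_iso:
  assumes k: "mono_arr C k" and l: "mono_arr C l" and c: "Cod C k = Cod C l"
    and eq: "\<And>x. x \<in> Arr C \<Longrightarrow> Cod C x = Cod C l \<Longrightarrow> factors C k x \<longleftrightarrow> factors C l x"
  shows "lifts C k l" "is_iso C (lift C k l)"
proof -
  note S = mono_arr_Arr [OF k] mono_arr_Arr [OF l]
  obtain y z where y: "is_lift C k l y" and z: "is_lift C l k z"
    using eq [of k] eq [of l] S c factors_self [of k] factors_self [of l] unfolding factors_def by auto
  show "lifts C k l" "is_iso C (lift C k l)"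
    using mono_lift [OF k y] mono_isoI [OF k l y z] by (auto simp: is_iso_def)
qed

lemma factors_kernel:
  assumes "is_kernel C k d" "x \<in> Arr C" "Cod C x = Dom C d"
  shows "factors C k x \<longleftrightarrow> d \<cdot> x \<in> Null C"
proof
  note K = is_kernelD [OF assms(1)]
  assume "factors C k x"
  then obtain y where "is_lift C k x y" by (auto simp: factors_def)
  note Y = is_liftD [OF this]
  have "(d \<cdot> k) \<cdot> y \<in> Null C" by (rule null_right) (use K Y in simp_all)
  then show "d \<cdot> x \<in> Null C" using K Y by simp
next
  assume "d \<cdot> x \<in> Null C"
  then show "factors C k x" using liftsD [OF is_kernel_lifts [OF assms]] by (auto simp: factors_def)
qed

lemma mono_comp:
  assumes "mono_arr C k" "mono_arr C l" "Cod C l = Dom C k"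
  shows "mono_arr C (k \<cdot> l)"
proof (rule mono_arrI)
  note S = mono_arr_Arr [OF assms(1)] mono_arr_Arr [OF assms(2)] assms(3)
  show "k \<cdot> l \<in> Arr C" using S by simp
  fix x y assume xy: "x \<in> Arr C" "y \<in> Arr C" "Cod C x = Dom C (k \<cdot> l)" "Cod C y = Dom C (k \<cdot> l)"
    and e: "(k \<cdot> l) \<cdot> x = (k \<cdot> l) \<cdot> y"
  have "l \<cdot> x = l \<cdot> y"
    by (rule mono_arr_cancel [OF assms(1)]) (use S xy e in simp_all)
  then show "x = y" using mono_arr_cancel [OF assms(2) xy(1,2)] S xy by simp
qed

lemma factors_comp:
  assumes "mono_arr C k" "l \<in> Arr C" "Cod C l = Dom C k" "y \<in> Arr C" "Cod C y = Dom C k"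
  shows "factors C (k \<cdot> l) (k \<cdot> y) \<longleftrightarrow> factors C l y"
proof
  note S = mono_arr_Arr [OF assms(1)] assms(2-)
  assume "factors C (k \<cdot> l) (k \<cdot> y)"
  then obtain z where "is_lift C (k \<cdot> l) (k \<cdot> y) z" by (auto simp: factors_def)
  note Z = is_liftD [OF this]
  have "l \<cdot> z = y" by (rule mono_arr_cancel [OF assms(1)]) (use S Z in simp_all)
  then have "is_lift C l y z"
    using Z(1-3) S by (simp add: is_lift_def hom_def)
  then show "factors C l y" by (auto simp: factors_def)
next
  note S = mono_arr_Arr [OF assms(1)] assms(2-)
  assume "factors C l y"
  then obtain z where "is_lift C l y z" by (auto simp: factors_def)
  note Z = is_liftD [OF this]
  have "is_lift C (k \<cdot> l) (k \<cdot> y) z" by (rule is_liftI) (use Z S in simp_all)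
  then show "factors C (k \<cdot> l) (k \<cdot> y)" by (auto simp: factors_def)
qed

lemma factors_comp_left:
  assumes "k \<in> Arr C" "l \<in> Arr C" "Cod C l = Dom C k" "factors C (k \<cdot> l) x"
  shows "factors C k x"
proof -
  obtain z where "is_lift C (k \<cdot> l) x z" using assms by (auto simp: factors_def)
  note Z = is_liftD [OF this]
  have "is_lift C k x (l \<cdot> z)" by (rule is_liftI) (use Z assms(1-3) in simp_all)
  then show ?thesis by (auto simp: factors_def)
qed

lemma kernel_unique:
  assumes "is_kernel C k d" "is_kernel C l d"
  shows "lifts C k l" "is_iso C (lift C k l)"
  using factors_iso [OF is_kernel_mono [OF assms(1)] is_kernel_mono [OF assms(2)]]
    is_kernelD [OF assms(1)] is_kernelD [OF assms(2)] factors_kernel [OF assms(1)] factors_kernel [OF assms(2)]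
  by simp_all

lemma cokernel_unique:
  assumes "is_cokernel C k d" "is_cokernel C l d"
  shows "colifts C k l" "is_iso C (colift C k l)"
  using homological_category_with_choices.kernel_unique [OF homological_opp, of k d l] assms by simp_all

text \<open>\<open>is_middle\<close> brackets to the right, and reversing arrows produces the left
  bracketing. Unlike the earlier exchange rules, this one rests on associativity and hence on
  \<open>k\<close> and \<open>q\<close> being arrows.\<close>

lemma is_middle_opp:
  "q \<in> Arr C \<Longrightarrow> k \<in> Arr C \<Longrightarrow> is_middle (opp C) k q x y \<longleftrightarrow> is_middle C q k x y"
  by (auto simp: is_middle_def hom_def)

lemma has_middle_opp: "q \<in> Arr C \<Longrightarrow> k \<in> Arr C \<Longrightarrow> has_middle (opp C) k q x = has_middle C q k x"
  by (simp add: has_middle_def is_middle_opp)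

lemma middle_opp: "q \<in> Arr C \<Longrightarrow> k \<in> Arr C \<Longrightarrow> middle (opp C) k q x = middle C q k x"
  by (simp add: middle_def is_middle_opp)

lemma middleI:
  assumes k: "mono_arr C k" and q: "epi_arr C q" and y: "is_middle C k q x y"
  shows "has_middle C k q x" "middle C k q x = y"
proof -
  have u: "z = y" if "is_middle C k q x z" for z
  proof -
    note S = is_middleD [OF that] is_middleD [OF y] mono_arr_Arr [OF k] epi_arr_Arr [OF q]
    have "z \<cdot> q = y \<cdot> q"
      by (rule mono_arr_cancel [OF k]) (use S in simp_all)
    then show "z = y"
      using epi_arr_cancel [OF q S(1,5)] S by simp
  qed
  with y show "has_middle C k q x" unfolding has_middle_def by (intro ex1I)
  show "middle C k q x = y" unfolding middle_def using y u by (intro the_equality)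
qed

text \<open>Since \<open>x \<cdot> e\<close> is null, \<open>x = y \<cdot> q\<close>. Then
  \<open>(d \<cdot> y) \<cdot> q = d \<cdot> x\<close> is null, the cokernel \<open>q\<close>
  reflects this to \<open>d \<cdot> y\<close>, and \<open>y\<close> passes through
  \<open>k\<close>.\<close>

lemma middle_exists:
  assumes k: "is_kernel C k d" and q: "is_cokernel C q e"
    and x: "x \<in> Arr C" "Dom C x = Cod C e" "Cod C x = Dom C d" "d \<cdot> x \<in> Null C" "x \<cdot> e \<in> Null C"
  shows "has_middle C k q x"
proof -
  note K = is_kernelD [OF k] and Q = is_cokernelD [OF q]
  obtain y where y: "y \<in> Arr C" "Dom C y = Cod C q" "Cod C y = Cod C x" "y \<cdot> q = x"
    using cokernel_factor [OF q x(1,2,5)] by metis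
  have "d \<cdot> y \<in> Null C"
    by (rule cokernel_reflects_null [OF q]) (use K Q y x in simp_all)
  then obtain z where z: "z \<in> Arr C" "Dom C z = Dom C y" "Cod C z = Dom C k" "k \<cdot> z = y"
    using kernel_factor [OF k y(1)] y x by metis
  have "is_middle C k q x z"
    by (rule is_middleI) (use K Q y z reassoc [OF z(4)] in simp_all)
  then show ?thesis using middleI [OF is_kernel_mono [OF k] is_cokernel_epi [OF q]] by simp
qed

section \<open>Images, coimages and exact morphisms\<close>

lemma im_typing [simp]:
  assumes "f \<in> Arr C"
  shows "im C f \<in> Arr C" "Cod C (im C f) = Cod C f" "mono_arr C (im C f)"
  using assms by (simp_all add: im_def)

lemma coim_typing [simp]:
  assumes "f \<in> Arr C"
  shows "coim C f \<in> Arr C" "Dom C (coim C f) = Dom C f" "epi_arr C (coim C f)"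
  using assms by (simp_all add: coim_def)

lemma im_kernel: "f \<in> Arr C \<Longrightarrow> is_kernel C (im C f) (coker f)"
  by (simp add: im_def ker_choice)

lemma coim_cokernel: "f \<in> Arr C \<Longrightarrow> is_cokernel C (coim C f) (ker f)"
  by (simp add: coim_def coker_choice)

lemma im_reflects_null:
  "f \<in> Arr C \<Longrightarrow> x \<in> Arr C \<Longrightarrow> Cod C x = Dom C (im C f) \<Longrightarrow> im C f \<cdot> x \<in> Null C \<Longrightarrow> x \<in> Null C"
  using kernel_reflects_null [OF im_kernel] by blast

lemma im_coim_has_middle: "f \<in> Arr C \<Longrightarrow> has_middle C (im C f) (coim C f) f"
  by (rule middle_exists [OF im_kernel coim_cokernel]) simp_all

lemma bar_typing [simp]:
  assumes "f \<in> Arr C"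
  shows "bar C f \<in> Arr C" "Dom C (bar C f) = Cod C (coim C f)" "Cod C (bar C f) = Dom C (im C f)"
    "im C f \<cdot> bar C f \<cdot> coim C f = f"
  using is_middleD [OF has_middleD [OF im_coim_has_middle [OF assms]]] by (simp_all add: bar_def)

lemma bar_comp [simp]:
  assumes "f \<in> Arr C" "x \<in> Arr C" "Cod C x = Dom C f"
  shows "im C f \<cdot> bar C f \<cdot> coim C f \<cdot> x = f \<cdot> x"
  using reassoc [OF bar_typing(4) [OF assms(1)]] assms by simp

lemma bar_opp: "f \<in> Arr C \<Longrightarrow> bar (opp C) f = bar C f"
  by (simp add: bar_def middle_opp)

lemma exact_arrow_iff: "exact_arrow C f \<longleftrightarrow> f \<in> Arr C \<and> is_iso C (bar C f)"
  using im_coim_has_middle by (auto simp: exact_arrow_def)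

lemma exact_arrow_opp: "exact_arrow (opp C) f = exact_arrow C f"
  using homological_category_with_choices.exact_arrow_iff [OF homological_opp, of f]
  by (auto simp: exact_arrow_iff bar_opp)

text \<open>A morphism that annihilates \<open>f\<close> factors through \<open>coker f\<close>,
  which annihilates \<open>im f\<close>; and \<open>f\<close> itself factors through
  \<open>im f\<close>. So \<open>f\<close> may be exchanged for its image in nullness tests without
  asking \<open>bar f\<close> to be invertible.\<close>

lemma null_im_iff:
  assumes "f \<in> Arr C" "x \<in> Arr C" "Dom C x = Cod C f"
  shows "x \<cdot> im C f \<in> Null C \<longleftrightarrow> x \<cdot> f \<in> Null C"
proof
  assume "x \<cdot> im C f \<in> Null C"
  then have "(x \<cdot> im C f) \<cdot> bar C f \<cdot> coim C f \<in> Null C"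
    by (rule null_right) (use assms in simp_all)
  then show "x \<cdot> f \<in> Null C" using assms by simp
next
  assume "x \<cdot> f \<in> Null C"
  then obtain y where y: "y \<in> Arr C" "Dom C y = Cod C (coker f)" "Cod C y = Cod C x" "y \<cdot> coker f = x"
    using cokernel_factor [OF coker_choice] assms by metis
  have "y \<cdot> coker f \<cdot> im C f \<in> Null C"
    by (rule null_left) (use assms y is_kernelD [OF im_kernel] in simp_all)
  then show "x \<cdot> im C f \<in> Null C"
    using reassoc [OF y(4)] assms y by simp
qed

lemma null_coim_iff:
  assumes "f \<in> Arr C" "x \<in> Arr C" "Cod C x = Dom C f"
  shows "coim C f \<cdot> x \<in> Null C \<longleftrightarrow> f \<cdot> x \<in> Null C"
  using homological_category_with_choices.null_im_iff [OF homological_opp, of f x] assms by simp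

text \<open>
  Cokernels compose, so \<open>d q\<close>, with \<open>q = coim f\<close> and \<open>d = coker (ker (bar f))\<close>, is the cokernel of
  its kernel. Since \<open>q\<close> annihilates that kernel, \<open>d\<close> is a split monomorphism.
\<close>

lemma bar_reflects_null:
  assumes f: "f \<in> Arr C" and x: "x \<in> Arr C" "Cod C x = Dom C (bar C f)" and n: "bar C f \<cdot> x \<in> Null C"
  shows "x \<in> Null C"
proof -
  let ?q = "coim C f" and ?y = "ker (bar C f)"
  let ?d = "coker ?y"
  have "cokernel_arrow C (?d \<cdot> ?q)"
    by (rule cokernels_comp) (use f in \<open>simp_all add: coim_def\<close>)
  then have dq: "is_cokernel C (?d \<cdot> ?q) (ker (?d \<cdot> ?q))" by (rule cokernel_arrow_ker)
  let ?k = "ker (?d \<cdot> ?q)"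
  have "?d \<cdot> ?q \<cdot> ?k \<in> Null C" using ker_typing(3) [of "?d \<cdot> ?q"] f by simp
  moreover have "is_kernel C (im C ?y) ?d" using f by (intro im_kernel) simp
  ultimately obtain z where z: "z \<in> Arr C" "Dom C z = Dom C ?k" "Cod C z = Dom C (im C ?y)" "im C ?y \<cdot> z = ?q \<cdot> ?k"
    using f by (elim kernel_factor [of _ _ "?q \<cdot> ?k"]) simp_all
  \<comment> \<open>Why \<open>?q\<close> annihilates \<open>?k\<close>:
    \<open>?q \<cdot> ?k\<close> lies in the image of \<open>?y = ker (bar f)\<close>, and
    \<open>bar f\<close> annihilates that image along with \<open>?y\<close>. So
    \<open>f \<cdot> ?k\<close> is null, and \<open>coim f\<close> annihilates the same morphisms as
    \<open>f\<close>.\<close>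
  have "bar C f \<cdot> im C ?y \<in> Null C" using f null_im_iff [of ?y "bar C f"] by simp
  then have "(bar C f \<cdot> im C ?y) \<cdot> z \<in> Null C"
    by (rule null_right) (use f z in simp_all)
  then have "bar C f \<cdot> ?q \<cdot> ?k \<in> Null C" using f z by simp
  then have "im C f \<cdot> bar C f \<cdot> ?q \<cdot> ?k \<in> Null C"
    by (rule null_left) (use f in simp_all)
  then have "?q \<cdot> ?k \<in> Null C"
    using f null_coim_iff [of f ?k] by simp
  then obtain s where s: "s \<in> Arr C" "Dom C s = Cod C ?d" "Cod C s = Cod C ?q" "s \<cdot> ?d \<cdot> ?q = ?q"
    using cokernel_factor [OF dq, of ?q] f by auto
  have sd: "s \<cdot> ?d = Id C (Cod C ?q)"
    by (rule epi_arr_cancel [of C ?q]) (use s f in simp_all)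
  obtain w where w: "w \<in> Arr C" "Dom C w = Dom C x" "Cod C w = Dom C ?y" "?y \<cdot> w = x"
    using kernel_factor [OF ker_choice x n] f by auto
  have "s \<cdot> ?d \<cdot> ?y \<in> Null C"
    by (rule null_left) (use s f in simp_all)
  then have "(s \<cdot> ?d \<cdot> ?y) \<cdot> w \<in> Null C"
    by (rule null_right) (use w s f in simp_all)
  then have "(s \<cdot> ?d) \<cdot> x \<in> Null C" using w s f x by simp
  then show ?thesis unfolding sd using x f by simp
qed

text \<open>With \<open>?q = coker f\<close>, the cokernel of \<open>?q\<close> is null because
  \<open>?q\<close> reflects null morphisms. So the identity of Coker f factors through
  \<open>im ?q\<close>, which is therefore invertible, while \<open>coim ?q\<close> and
  \<open>?q\<close> are two cokernels of \<open>ker ?q\<close>. This provides the exact shared side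
  of the vertical pair \<open>sq_S2\<close>, \<open>sq_S1\<close>.\<close>

lemma exact_coker:
  assumes "f \<in> Arr C" shows "exact_arrow C (coker f)"
proof -
  let ?q = "coker f"
  have "coker ?q \<in> Null C"
    by (rule coker_reflects_null [OF assms]) (use assms in simp_all)
  then obtain s where s: "s \<in> Arr C" "Dom C s = Cod C ?q" "Cod C s = Dom C (im C ?q)" "im C ?q \<cdot> s = Id C (Cod C ?q)"
    using kernel_factor [OF im_kernel [of ?q], of "Id C (Cod C ?q)"] assms by auto
  have m: "is_inverse C s (im C ?q)"
    by (rule mono_isoI [of "im C ?q" "Id C (Cod C ?q)"])
      (use s assms in \<open>auto intro!: is_liftI mono_arrI\<close>)
  then have im: "is_iso C (im C ?q)" using is_inverse_sym by (auto simp: is_iso_def)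
  have c: "is_cokernel C ?q (ker ?q)" using assms by (intro cokernel_arrow_ker) simp
  let ?s = "colift C (coim C ?q) ?q"
  have s: "is_iso C ?s" "is_colift C (coim C ?q) ?q ?s"
    using cokernel_unique [OF coim_cokernel c] coliftsD assms by auto
  have e: "im C ?q \<cdot> bar C ?q = ?s"
    by (rule epi_arr_cancel [of C "coim C ?q"]) (use is_coliftD [OF s(2)] assms in simp_all)
  have "bar C ?q = inv_arr C (im C ?q) \<cdot> ?s"
    unfolding e [symmetric] using iso_cancel(3) [OF im] assms by simp
  then have "is_iso C (bar C ?q)" using iso_comp [OF s(1) iso_inv [OF im]] is_coliftD [OF s(2)] im assms by simp
  then show ?thesis using assms by (simp add: exact_arrow_iff)
qed

lemma exact_ker: "f \<in> Arr C \<Longrightarrow> exact_arrow C (ker f)"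
  using homological_category_with_choices.exact_coker [OF homological_opp, of f]
  by (simp add: exact_arrow_opp)

section \<open>Subquotients\<close>

text \<open>Read \<open>l\<close> as a subobject L of E, \<open>lm\<close> as a morphism A
  \<rightarrow> L, and \<open>r\<close> as the quotient of E by A. That \<pi> annihilates
  \<open>lm\<close> holds because the kernel \<iota> reflects the null morphism
  \<open>r \<cdot> l \<cdot> lm\<close>; the content is that \<open>ker \<pi>\<close> is no larger
  than \<open>im lm\<close>.\<close>

lemma homology_core_left:
  assumes l: "is_kernel C l (\<rho> \<cdot> r)" and r: "is_cokernel C r (l \<cdot> lm)"
    and A: "lm \<in> Arr C" "\<rho> \<in> Arr C" "Cod C lm = Dom C l" "Dom C \<rho> = Cod C r" "Cod C l = Dom C r"
    and \<pi>: "cokernel_arrow C \<pi>" and \<iota>: "kernel_arrow C \<iota>"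
    and T: "Dom C \<pi> = Dom C l" "Cod C \<pi> = Dom C \<iota>" "Cod C \<iota> = Cod C r" and e: "r \<cdot> l = \<iota> \<cdot> \<pi>"
  shows "is_cokernel C \<pi> lm"
proof -
  note L = is_kernelD [OF l] and R = is_cokernelD [OF r]
  have P: "\<pi> \<in> Arr C" "\<iota> \<in> Arr C"
    using \<pi> \<iota> by (auto simp: kernel_arrow_def cokernel_arrow_def is_kernel_def is_cokernel_def)
  note S = L(2) R(2,4) A P T
  have "\<iota> \<cdot> \<pi> \<cdot> lm = r \<cdot> l \<cdot> lm" using S reassoc [OF e] by simp
  then have pl: "\<pi> \<cdot> lm \<in> Null C"
    using kernel_reflects_null [OF kernel_arrow_coker [OF \<iota>], of "\<pi> \<cdot> lm"] S by simp
  let ?k = "ker \<pi>" and ?i = "im C lm"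
  have "r \<cdot> l \<cdot> ?k = \<iota> \<cdot> \<pi> \<cdot> ?k" using S reassoc [OF e] by simp
  then have rlk: "r \<cdot> l \<cdot> ?k \<in> Null C" using S null_left [OF ker_typing(3), of \<pi> \<iota>] by simp
  \<comment> \<open>\<open>ker \<pi>\<close> is placed inside \<open>im lm\<close> by a test in E.
    Closure under composition makes \<open>l \<cdot> im lm\<close> the kernel of its cokernel
    \<open>?d\<close>; \<open>?d\<close> annihilates \<open>l \<cdot> lm\<close>, so it factors
    through \<open>r\<close>, and \<open>r \<cdot> l\<close> annihilates
    \<open>ker \<pi>\<close>.\<close>
  have "kernel_arrow C (l \<cdot> ?i)"
    by (rule kernels_comp) (use l im_kernel [OF A(1)] S in \<open>auto simp: kernel_arrow_def\<close>)
  then have li: "is_kernel C (l \<cdot> ?i) (coker (l \<cdot> ?i))" by (rule kernel_arrow_coker)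
  let ?d = "coker (l \<cdot> ?i)"
  have "(?d \<cdot> l \<cdot> ?i) \<cdot> bar C lm \<cdot> coim C lm \<in> Null C"
    by (rule null_right) (use S in simp_all)
  then have "?d \<cdot> l \<cdot> lm \<in> Null C" using S by simp
  then obtain d' where d': "d' \<in> Arr C" "Dom C d' = Cod C r" "Cod C d' = Cod C ?d" "d' \<cdot> r = ?d"
    using cokernel_factor [OF r, of ?d] S by auto
  have "d' \<cdot> r \<cdot> l \<cdot> ?k \<in> Null C"
    by (rule null_left [OF rlk]) (use S d' in simp_all)
  then have "?d \<cdot> l \<cdot> ?k \<in> Null C" using reassoc [OF d'(4), of "l \<cdot> ?k"] S d' by simp
  then obtain z where z: "z \<in> Arr C" "Dom C z = Dom C ?k" "Cod C z = Dom C ?i" "(l \<cdot> ?i) \<cdot> z = l \<cdot> ?k"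
    using kernel_factor [OF li, of "l \<cdot> ?k"] S by auto
  have k: "?k = ?i \<cdot> z"
    by (rule mono_arr_cancel [OF is_kernel_mono [OF l]]) (use S z in simp_all)
  show ?thesis
  proof (rule is_cokernel_cong [OF cokernel_arrow_ker [OF \<pi>]])
    show "lm \<in> Arr C" "Cod C lm = Cod C ?k" using S by simp_all
    fix x assume x: "x \<in> Arr C" "Dom C x = Cod C ?k"
    show "x \<cdot> lm \<in> Null C \<longleftrightarrow> x \<cdot> ?k \<in> Null C"
    proof
      assume "x \<cdot> lm \<in> Null C"
      then have "x \<cdot> ?i \<in> Null C" using null_im_iff [of lm x] x S by simp
      then have "(x \<cdot> ?i) \<cdot> z \<in> Null C"
        by (rule null_right) (use S z x in simp_all)
      then show "x \<cdot> ?k \<in> Null C" using k S z x by simp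
    next
      assume "x \<cdot> ?k \<in> Null C"
      then obtain y where y: "y \<in> Arr C" "Dom C y = Cod C \<pi>" "Cod C y = Cod C x" "y \<cdot> \<pi> = x"
        using cokernel_factor [OF cokernel_arrow_ker [OF \<pi>] x] by metis
      have "y \<cdot> \<pi> \<cdot> lm \<in> Null C"
        by (rule null_left [OF pl]) (use S y in simp_all)
      then show "x \<cdot> lm \<in> Null C" using reassoc [OF y(4), of lm] S y by simp
    qed
  qed
qed

text \<open>Stated for arbitrary kernels and cokernels, so that chosen ones can be inserted. The
  factors \<pi> and \<iota> of the subquotient axiom are a cokernel of \<open>lm\<close> and,
  dually, a kernel of \<rho>. They differ from \<open>q\<close> and \<open>k\<close> by
  isomorphisms, whose composite is the middle morphism.\<close>

lemma homology_core:
  assumes l: "is_kernel C l (\<rho> \<cdot> r)" and r: "is_cokernel C r (l \<cdot> lm)"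
    and A: "lm \<in> Arr C" "\<rho> \<in> Arr C" "Cod C lm = Dom C l" "Dom C \<rho> = Cod C r" "Cod C l = Dom C r"
    and q: "is_cokernel C q lm" and k: "is_kernel C k \<rho>"
  shows "has_middle C k q (r \<cdot> l)" "is_iso C (middle C k q (r \<cdot> l))"
proof -
  note L = is_kernelD [OF l] and R = is_cokernelD [OF r] and K = is_kernelD [OF k] and Q = is_cokernelD [OF q]
  \<comment> \<open>The hypothesis of the subquotient axiom: \<open>\<rho> \<cdot> r\<close>
    annihilates \<open>ker r\<close>, so \<open>ker r\<close> lies in the subobject
    \<open>l\<close>, which \<open>coker l\<close> annihilates.\<close>
  have rn: "\<rho> \<cdot> r \<cdot> ker r \<in> Null C"
    by (rule null_left) (use R A in simp_all)
  obtain j where j: "j \<in> Arr C" "Dom C j = Dom C (ker r)" "Cod C j = Dom C l" "l \<cdot> j = ker r"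
    using kernel_factor [OF l, of "ker r"] rn A R by auto
  have "(coker l \<cdot> l) \<cdot> j \<in> Null C"
    by (rule null_right) (use j L in simp_all)
  then have "coker l \<cdot> ker r \<in> Null C" using j L by simp
  moreover have "kernel_arrow C l" "cokernel_arrow C r"
    using l r by (auto simp: kernel_arrow_def cokernel_arrow_def)
  ultimately obtain \<pi> \<iota> where \<pi>: "cokernel_arrow C \<pi>" and \<iota>: "kernel_arrow C \<iota>"
    and T: "Dom C \<pi> = Dom C l" "Cod C \<pi> = Dom C \<iota>" "Cod C \<iota> = Cod C r" and e: "r \<cdot> l = \<iota> \<cdot> \<pi>"
    using subquotient [OF _ _ A(5) coker_choice [OF L(2)] ker_choice [OF R(2)]] by meson
  have cp: "is_cokernel C \<pi> lm"
    by (rule homology_core_left [OF l r A \<pi> \<iota> T e])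
  have ki: "is_kernel C \<iota> \<rho>"
    using homological_category_with_choices.homology_core_left [OF homological_opp, of r lm l \<rho> \<iota> \<pi>]
      l r A \<pi> \<iota> T e by simp
  let ?s = "colift C q \<pi>" and ?t = "lift C k \<iota>"
  have s: "is_iso C ?s" "is_colift C q \<pi> ?s" using cokernel_unique [OF q cp] coliftsD by auto
  have t: "is_iso C ?t" "is_lift C k \<iota> ?t" using kernel_unique [OF k ki] liftsD by auto
  note S = is_coliftD [OF s(2)] is_liftD [OF t(2)]
  have m: "is_middle C k q (r \<cdot> l) (?t \<cdot> ?s)"
    by (rule is_middleI) (use S K Q T e reassoc [OF S(8)] is_kernelD [OF ki] is_cokernelD [OF cp] in simp_all)
  show "has_middle C k q (r \<cdot> l)" "is_iso C (middle C k q (r \<cdot> l))"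
    using middleI [OF is_kernel_mono [OF k] is_cokernel_epi [OF q] m] iso_comp [OF s(1) t(1)] S T by simp_all
qed

end

section \<open>Dual squares and pullbacks along kernels\<close>

definition sq_opp :: "'m square \<Rightarrow> 'm square" where
  "sq_opp S = \<lparr>sq_top = sq_bot S, sq_left = sq_right S, sq_right = sq_left S, sq_bot = sq_top S\<rparr>"

lemma sq_opp_simps [simp]:
  "sq_top (sq_opp S) = sq_bot S" "sq_left (sq_opp S) = sq_right S"
  "sq_right (sq_opp S) = sq_left S" "sq_bot (sq_opp S) = sq_top S" "sq_opp (sq_opp S) = S"
  by (simp_all add: sq_opp_def)

lemma commutative_square_opp [simp]: "commutative_square (opp C) (sq_opp S) = commutative_square C S"
  by (auto simp: commutative_square_def)

lemma square_projections_opp [simp]: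
  "l_right (opp C) (sq_opp S) = r_left C S" "l_bot (opp C) (sq_opp S) = r_top C S"
  "r_left (opp C) (sq_opp S) = l_right C S" "r_top (opp C) (sq_opp S) = l_bot C S"
  by (simp_all add: l_right_def l_bot_def r_left_def r_top_def)

lemma is_pullbackD:
  assumes "is_pullback C x y p q"
  shows "x \<in> Arr C" "y \<in> Arr C" "Cod C x = Cod C y" "p \<in> Arr C" "q \<in> Arr C"
     "Dom C p = Dom C q" "Cod C p = Dom C x" "Cod C q = Dom C y" "Comp C x p = Comp C y q"
  using assms by (simp_all add: is_pullback_def)

lemma is_pullback_ex1:
  assumes "is_pullback C x y p q" "u \<in> Arr C" "v \<in> Arr C" "Dom C u = Dom C v" "Cod C u = Dom C x"
    "Cod C v = Dom C y" "Comp C x u = Comp C y v"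
  shows "\<exists>!w. is_lift C p u w \<and> is_lift C q v w"
  using assms by (simp add: is_pullback_def)

lemma commutative_squareD:
  assumes "commutative_square C S"
  shows "sq_top S \<in> Arr C" "sq_left S \<in> Arr C" "sq_right S \<in> Arr C" "sq_bot S \<in> Arr C"
     "Dom C (sq_left S) = Dom C (sq_top S)" "Dom C (sq_right S) = Cod C (sq_top S)"
     "Dom C (sq_bot S) = Cod C (sq_left S)" "Cod C (sq_bot S) = Cod C (sq_right S)"
     "Comp C (sq_right S) (sq_top S) = Comp C (sq_bot S) (sq_left S)"
  using assms by (simp_all add: commutative_square_def)

context homological_category_with_choices
begin

lemma is_kernelI:
  assumes "mono_arr C k" "f \<in> Arr C" "Cod C k = Dom C f" "f \<cdot> k \<in> Null C"
    and "\<And>x. x \<in> Arr C \<Longrightarrow> Cod C x = Dom C f \<Longrightarrow> f \<cdot> x \<in> Null C \<Longrightarrow> factors C k x"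
  shows "is_kernel C k f"
  unfolding is_kernel_def
proof (intro conjI ballI impI)
  fix x assume "x \<in> Arr C" "Cod C x = Dom C f \<and> f \<cdot> x \<in> Null C"
  then obtain y where "is_lift C k x y" using assms(5) by (auto simp: factors_def)
  then show "\<exists>!y. is_lift C k x y" using mono_lift [OF assms(1)] by (simp add: lifts_def)
qed (use assms mono_arr_Arr in simp_all)

lemma kernel_shift:
  assumes k: "is_kernel C k d" and i: "is_iso C \<phi>" "Cod C \<phi> = Dom C d"
  shows "is_kernel C (inv_arr C \<phi> \<cdot> k) (d \<cdot> \<phi>)"
proof (rule is_kernelI)
  note S = is_kernelD [OF k] iso_Arr [OF i(1)] iso_inv_typing [OF i(1)] i(2) iso_cancel [OF i(1)]
  show "mono_arr C (inv_arr C \<phi> \<cdot> k)"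
    by (rule mono_comp) (use S is_kernel_mono [OF k] iso_mono [OF iso_inv [OF i(1)]] in simp_all)
  show "d \<cdot> \<phi> \<in> Arr C" "Cod C (inv_arr C \<phi> \<cdot> k) = Dom C (d \<cdot> \<phi>)"
    "(d \<cdot> \<phi>) \<cdot> inv_arr C \<phi> \<cdot> k \<in> Null C" using S by simp_all
  fix x assume x: "x \<in> Arr C" "Cod C x = Dom C (d \<cdot> \<phi>)" "(d \<cdot> \<phi>) \<cdot> x \<in> Null C"
  obtain y where y: "y \<in> Arr C" "Dom C y = Dom C x" "Cod C y = Dom C k" "k \<cdot> y = \<phi> \<cdot> x"
    using kernel_factor [OF k, of "\<phi> \<cdot> x"] S x by auto
  have "is_lift C (inv_arr C \<phi> \<cdot> k) x y"
    by (rule is_liftI) (use S x y in simp_all)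
  then show "factors C (inv_arr C \<phi> \<cdot> k) x" by (auto simp: factors_def)
qed

lemma cokernel_shift:
  assumes k: "is_cokernel C r d" and i: "is_iso C \<phi>" "Dom C \<phi> = Cod C d"
  shows "is_cokernel C (r \<cdot> inv_arr C \<phi>) (\<phi> \<cdot> d)"
  using homological_category_with_choices.kernel_shift [OF homological_opp, of r d \<phi>] assms by simp

lemma null_of_coker:
  assumes "f \<in> Arr C" "g \<in> Arr C" "x \<in> Arr C" "Cod C f = Dom C g" "Cod C x = Dom C g"
    "g \<cdot> f \<in> Null C" "coker f \<cdot> x \<in> Null C"
  shows "g \<cdot> x \<in> Null C"
proof -
  obtain y where y: "y \<in> Arr C" "Dom C y = Cod C (coker f)" "Cod C y = Cod C g" "y \<cdot> coker f = g"
    using cokernel_factor [OF coker_choice [OF assms(1)] assms(2)] assms by metis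
  have "y \<cdot> coker f \<cdot> x \<in> Null C"
    by (rule null_left) (use assms y in simp_all)
  then show ?thesis using reassoc [OF y(4)] assms y by simp
qed

lemma null_of_ker:
  assumes "f \<in> Arr C" "g \<in> Arr C" "x \<in> Arr C" "Cod C f = Dom C g" "Dom C x = Cod C f"
    "g \<cdot> f \<in> Null C" "x \<cdot> ker g \<in> Null C"
  shows "x \<cdot> f \<in> Null C"
  using homological_category_with_choices.null_of_coker [OF homological_opp, of g f x] assms by simp

text \<open>\<open>ker (d \<cdot> x)\<close> is the inverse image of \<open>ker d\<close> under
  \<open>x\<close>. The Lambek invariants involve only pullbacks along kernels and, dually, pushouts
  along cokernels, so they exist although general pullbacks may not.\<close>

lemma pullback_exists:
  assumes k: "is_kernel C k d" and x: "x \<in> Arr C" "Cod C x = Cod C k"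
  shows "\<exists>p q. is_pullback C x k p q"
proof -
  note K = is_kernelD [OF k]
  let ?p = "ker (d \<cdot> x)"
  have dx: "d \<cdot> x \<in> Arr C" using K x by simp
  have "d \<cdot> x \<cdot> ?p \<in> Null C" using ker_typing(3) [OF dx] K x by simp
  then obtain q where q: "q \<in> Arr C" "Dom C q = Dom C ?p" "Cod C q = Dom C k" "k \<cdot> q = x \<cdot> ?p"
    using kernel_factor [OF k, of "x \<cdot> ?p"] K x by auto
  have "is_pullback C x k ?p q"
    unfolding is_pullback_def
  proof (intro conjI ballI impI; (elim conjE)?)
    fix u v assume u: "u \<in> Arr C" "Cod C u = Dom C x" and v: "v \<in> Arr C" "Cod C v = Dom C k"
      and uv: "Dom C u = Dom C v" and e: "x \<cdot> u = k \<cdot> v"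
    have "(d \<cdot> k) \<cdot> v \<in> Null C" by (rule null_right) (use K v in simp_all)
    then have "(d \<cdot> x) \<cdot> u \<in> Null C" using K v u x e by simp
    note W = ker_lift [OF dx u(1) _ this]
    let ?w = "lift C ?p u"
    have l: "is_lift C ?p u ?w" using W u x K by (auto intro: is_liftI)
    have "k \<cdot> q \<cdot> ?w = x \<cdot> u"
      using reassoc [OF q(4), of ?w] W q K x u by simp
    then have "q \<cdot> ?w = v"
      unfolding e by (elim mono_arr_cancel [OF is_kernel_mono [OF k], rotated 4]) (use W q K x u v in simp_all)
    then have m: "is_lift C q v ?w" using W q K x u v uv by (simp add: is_lift_def hom_def)
    show "\<exists>!w. is_lift C ?p u w \<and> is_lift C q v w"
    proof (rule ex1I, rule conjI [OF l m])
      fix w assume "is_lift C ?p u w \<and> is_lift C q v w"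
      then show "w = ?w" using mono_lift(2) [of C ?p u w] dx by simp
    qed
  qed (use K x q dx in simp_all)
  then show ?thesis by blast
qed

text \<open>The chosen projections are known only through the universal property; this exhibits them
  as kernels of explicit morphisms, to which the nullness tests apply.\<close>

lemma pullback_kernel:
  assumes pb: "is_pullback C x k p q" and k: "is_kernel C k d"
  shows "is_kernel C p (d \<cdot> x)"
proof (rule is_kernelI)
  note S = is_pullbackD [OF pb] is_kernelD [OF k]
  show "d \<cdot> x \<in> Arr C" "Cod C p = Dom C (d \<cdot> x)" using S by simp_all
  have "(d \<cdot> k) \<cdot> q \<in> Null C" by (rule null_right) (use S in simp_all)
  then show "(d \<cdot> x) \<cdot> p \<in> Null C" using S by simp
  show "mono_arr C p"
  proof (rule mono_arrI)
    show "p \<in> Arr C" by (rule S)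
    fix w z assume w: "w \<in> Arr C" "Cod C w = Dom C p" and z: "z \<in> Arr C" "Cod C z = Dom C p" and e: "p \<cdot> w = p \<cdot> z"
    have D: "Dom C w = Dom C z"
      using Comp_typing(2) [of w p] Comp_typing(2) [of z p] w z e S by simp
    have x1: "x \<cdot> p \<cdot> w = k \<cdot> q \<cdot> w" if "w \<in> Arr C" "Cod C w = Dom C p" for w
      using reassoc [OF S(9)] S that by simp
    have "k \<cdot> q \<cdot> w = k \<cdot> q \<cdot> z" using x1 [OF w] x1 [OF z] e by simp
    then have f: "q \<cdot> w = q \<cdot> z"
      by (elim mono_arr_cancel [OF is_kernel_mono [OF k], rotated 4]) (use w z S in simp_all)
    have "\<exists>!y. is_lift C p (p \<cdot> w) y \<and> is_lift C q (q \<cdot> w) y"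
      by (rule is_pullback_ex1 [OF pb]) (use w S x1 in simp_all)
    moreover have "is_lift C p (p \<cdot> w) w" "is_lift C q (q \<cdot> w) w"
      using w S by (simp_all add: is_lift_def hom_def)
    moreover have "is_lift C p (p \<cdot> w) z" unfolding e using z S D by (simp add: is_lift_def hom_def)
    moreover have "is_lift C q (q \<cdot> w) z" unfolding f using z S D by (simp add: is_lift_def hom_def)
    ultimately show "w = z" by blast
  qed
  fix u assume u: "u \<in> Arr C" "Cod C u = Dom C (d \<cdot> x)" "(d \<cdot> x) \<cdot> u \<in> Null C"
  obtain v where v: "v \<in> Arr C" "Dom C v = Dom C u" "Cod C v = Dom C k" "k \<cdot> v = x \<cdot> u"
    using kernel_factor [OF k, of "x \<cdot> u"] S u by auto
  have "\<exists>!w. is_lift C p u w \<and> is_lift C q v w"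
    by (rule is_pullback_ex1 [OF pb]) (use S u v in simp_all)
  then show "factors C p u" by (auto simp: factors_def)
qed

section \<open>Lambek invariants\<close>

lemma square_pullback:
  assumes "commutative_square C S"
  shows "is_pullback C (im C (sq_right S)) (im C (sq_bot S)) (l_right C S) (l_bot C S)"
proof -
  note S = commutative_squareD [OF assms]
  have "\<exists>p q. is_pullback C (im C (sq_right S)) (im C (sq_bot S)) p q"
    by (rule pullback_exists [OF im_kernel]) (use S in simp_all)
  then show ?thesis unfolding l_right_def l_bot_def using pullback_choice by blast
qed

lemma l_right_kernel:
  assumes "commutative_square C S"
  shows "is_kernel C (l_right C S) (coker (sq_bot S) \<cdot> im C (sq_right S))"
  by (rule pullback_kernel [OF square_pullback [OF assms] im_kernel])
    (use commutative_squareD [OF assms] in simp)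

lemma l_bot_kernel:
  assumes "commutative_square C S"
  shows "is_kernel C (l_bot C S) (coker (sq_right S) \<cdot> im C (sq_bot S))"
  by (rule pullback_kernel [OF is_pullback_commute [OF square_pullback [OF assms]] im_kernel])
    (use commutative_squareD [OF assms] in simp)

lemma lam_ex1:
  assumes "commutative_square C S"
  shows "\<exists>!w. is_lam C S w"
  unfolding is_lam_def
  by (rule is_pullback_ex1 [OF square_pullback [OF assms]])
    (use commutative_squareD [OF assms] in simp_all)

lemma lam_typing:
  assumes "commutative_square C S"
  shows "lam C S \<in> Arr C" "Dom C (lam C S) = Dom C (sq_top S)" "Cod C (lam C S) = Dom C (l_right C S)"
    "Cod C (lam C S) = Dom C (l_bot C S)"
    "l_right C S \<cdot> lam C S = bar C (sq_right S) \<cdot> coim C (sq_right S) \<cdot> sq_top S"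
    "l_bot C S \<cdot> lam C S = bar C (sq_bot S) \<cdot> coim C (sq_bot S) \<cdot> sq_left S"
proof -
  have "is_lam C S (lam C S)" unfolding lam_def by (rule theI' [OF lam_ex1 [OF assms]])
  then have l: "is_lift C (l_right C S) (bar C (sq_right S) \<cdot> coim C (sq_right S) \<cdot> sq_top S) (lam C S)"
    "is_lift C (l_bot C S) (bar C (sq_bot S) \<cdot> coim C (sq_bot S) \<cdot> sq_left S) (lam C S)"
    by (simp_all add: is_lam_def)
  show "lam C S \<in> Arr C" "Dom C (lam C S) = Dom C (sq_top S)" "Cod C (lam C S) = Dom C (l_right C S)"
    "Cod C (lam C S) = Dom C (l_bot C S)"
    "l_right C S \<cdot> lam C S = bar C (sq_right S) \<cdot> coim C (sq_right S) \<cdot> sq_top S"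
    "l_bot C S \<cdot> lam C S = bar C (sq_bot S) \<cdot> coim C (sq_bot S) \<cdot> sq_left S"
    using is_liftD [OF l(1)] is_liftD [OF l(2)] commutative_squareD [OF assms] by simp_all
qed

lemma is_lam_opp:
  assumes "commutative_square C S"
  shows "is_lam (opp C) (sq_opp S) w = is_rho C S w"
  using commutative_squareD [OF assms] by (simp add: is_lam_def is_rho_def bar_opp)

lemma lam_opp: "commutative_square C S \<Longrightarrow> lam (opp C) (sq_opp S) = rho C S"
  by (simp add: lam_def rho_def is_lam_opp)

lemma rho_opp:
  assumes "commutative_square C S" shows "rho (opp C) (sq_opp S) = lam C S"
proof -
  have "is_rho (opp C) (sq_opp S) w = is_lam C S w" for w
    using commutative_squareD [OF assms] by (simp add: is_lam_def is_rho_def bar_opp)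
  then show ?thesis by (simp add: lam_def rho_def)
qed

lemma square_pushout:
  "commutative_square C S \<Longrightarrow> is_pushout C (coim C (sq_left S)) (coim C (sq_top S)) (r_left C S) (r_top C S)"
  using homological_category_with_choices.square_pullback [OF homological_opp, of "sq_opp S"] by simp

lemma r_left_cokernel:
  "commutative_square C S \<Longrightarrow> is_cokernel C (r_left C S) (coim C (sq_left S) \<cdot> ker (sq_top S))"
  using homological_category_with_choices.l_right_kernel [OF homological_opp, of "sq_opp S"] by simp

lemma r_top_cokernel:
  "commutative_square C S \<Longrightarrow> is_cokernel C (r_top C S) (coim C (sq_top S) \<cdot> ker (sq_left S))"
  using homological_category_with_choices.l_bot_kernel [OF homological_opp, of "sq_opp S"] by simp

lemma rho_typing:
  assumes "commutative_square C S"
  shows "rho C S \<in> Arr C" "Cod C (rho C S) = Cod C (sq_bot S)" "Dom C (rho C S) = Cod C (r_left C S)"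
    "Dom C (rho C S) = Cod C (r_top C S)"
    "rho C S \<cdot> r_left C S = sq_bot S \<cdot> im C (sq_left S) \<cdot> bar C (sq_left S)"
    "rho C S \<cdot> r_top C S = sq_right S \<cdot> im C (sq_top S) \<cdot> bar C (sq_top S)"
  using homological_category_with_choices.lam_typing [OF homological_opp, of "sq_opp S"] assms
    commutative_squareD [OF assms] by (simp_all add: lam_opp bar_opp)

lemma Lambek_invariants:
  assumes "commutative_square C S" shows "Lambek_invariants_well_defined C S"
proof -
  have "\<exists>!w. is_rho C S w"
    using homological_category_with_choices.lam_ex1 [OF homological_opp, of "sq_opp S"] assms
    by (simp add: is_lam_opp)
  then show ?thesis
    using assms commutative_squareD [OF assms] im_coim_has_middle
    by (auto simp: Lambek_invariants_well_defined_def square_pullback square_pushout lam_ex1)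
qed

text \<open>Covers both directions: \<open>b\<close> is the shared side, vertical or horizontal.
  Nullity of the rows gives the morphism. The two implications are exactness at the middle, written
  as tests: \<open>coker f'\<close> annihilates whatever \<open>g'\<close> does, and what
  annihilates \<open>f\<close> also annihilates \<open>ker g\<close>. The isomorphism
  \<open>bar b\<close> brings \<open>l\<close>, a subobject of Im b, and \<open>r\<close>, a
  quotient of Coim b, onto one object E.\<close>

lemma Lambek_core:
  assumes b: "exact_arrow C b"
    and F: "f \<in> Arr C" "g \<in> Arr C" "f' \<in> Arr C" "g' \<in> Arr C" "Cod C f = Dom C b" "Dom C g = Dom C b"
      "Cod C f' = Cod C b" "Dom C g' = Cod C b" "g \<cdot> f \<in> Null C" "g' \<cdot> f' \<in> Null C"
    and l: "is_kernel C l (coker f' \<cdot> im C b)" and r: "is_cokernel C r (coim C b \<cdot> ker g)"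
    and lm: "lm \<in> Arr C" "Cod C lm = Dom C l" "l \<cdot> lm = bar C b \<cdot> coim C b \<cdot> f"
    and rh: "rh \<in> Arr C" "Dom C rh = Cod C r" "rh \<cdot> r = g' \<cdot> im C b \<cdot> bar C b"
  shows "has_middle C (ker rh) (coker lm) (r \<cdot> inv_arr C (bar C b) \<cdot> l)"
    and "(\<And>x. x \<in> Arr C \<Longrightarrow> Cod C x = Cod C b \<Longrightarrow> g' \<cdot> x \<in> Null C \<Longrightarrow> coker f' \<cdot> x \<in> Null C) \<Longrightarrow>
      (\<And>x. x \<in> Arr C \<Longrightarrow> Dom C x = Dom C b \<Longrightarrow> x \<cdot> f \<in> Null C \<Longrightarrow> x \<cdot> ker g \<in> Null C) \<Longrightarrow>
      is_iso C (middle C (ker rh) (coker lm) (r \<cdot> inv_arr C (bar C b) \<cdot> l))"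
proof -
  have B: "b \<in> Arr C" and i: "is_iso C (bar C b)" using b by (auto simp: exact_arrow_iff)
  let ?t = "inv_arr C (bar C b)"
  note L = is_kernelD [OF l] and R = is_cokernelD [OF r]
  note S = F(1-8) B L(2,3) R(2,3) iso_inv_typing [OF i] iso_cancel [OF i] lm rh
  have rl: "rh \<cdot> r \<cdot> ?t \<cdot> x = g' \<cdot> im C b \<cdot> x" if "x \<in> Arr C" "Cod C x = Dom C (im C b)" for x
    using reassoc [OF rh(3), of "?t \<cdot> x"] S that by simp
  have lr: "?t \<cdot> l \<cdot> lm = coim C b \<cdot> f"
    using S by simp
  have x1: "coker f' \<cdot> im C b \<cdot> x \<in> Null C \<Longrightarrow> g' \<cdot> im C b \<cdot> x \<in> Null C"
    if "x \<in> Arr C" "Cod C x = Dom C (im C b)" for x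
    using null_of_coker [of f' g' "im C b \<cdot> x"] S F(10) that by simp
  have x2: "x \<cdot> coim C b \<cdot> ker g \<in> Null C \<Longrightarrow> x \<cdot> coim C b \<cdot> f \<in> Null C"
    if "x \<in> Arr C" "Dom C x = Cod C (coim C b)" for x
    using null_of_ker [of f g "x \<cdot> coim C b"] S F(9) that by simp
  show "has_middle C (ker rh) (coker lm) (r \<cdot> ?t \<cdot> l)"
  proof (rule middle_exists [OF ker_choice coker_choice])
    have "coker f' \<cdot> im C b \<cdot> l \<in> Null C" using L(4) S by simp
    then show "rh \<cdot> r \<cdot> ?t \<cdot> l \<in> Null C" using x1 [of l] rl [of l] S by simp
    have "r \<cdot> coim C b \<cdot> ker g \<in> Null C" using R(4) S by simp
    then show "(r \<cdot> ?t \<cdot> l) \<cdot> lm \<in> Null C" using x2 [of r] lr S by simp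
  qed (use S in simp_all)
  assume bot: "\<And>x. x \<in> Arr C \<Longrightarrow> Cod C x = Cod C b \<Longrightarrow> g' \<cdot> x \<in> Null C \<Longrightarrow> coker f' \<cdot> x \<in> Null C"
    and top: "\<And>x. x \<in> Arr C \<Longrightarrow> Dom C x = Dom C b \<Longrightarrow> x \<cdot> f \<in> Null C \<Longrightarrow> x \<cdot> ker g \<in> Null C"
  \<comment> \<open>By exactness, \<open>g'\<close> and \<open>coker f'\<close> annihilate the same
    morphisms, and \<open>rh \<cdot> r \<cdot> ?t\<close> acts as \<open>g' \<cdot> im b\<close>. So
    \<open>l\<close>, which was built from \<open>coker f'\<close>, is also the kernel that
    \<open>homology_core\<close> asks for.\<close>
  have l': "is_kernel C l (rh \<cdot> r \<cdot> ?t)"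
  proof (rule is_kernel_cong [OF l])
    show "rh \<cdot> r \<cdot> ?t \<in> Arr C" "Dom C (rh \<cdot> r \<cdot> ?t) = Dom C (coker f' \<cdot> im C b)" using S by simp_all
    fix x assume x: "x \<in> Arr C" "Cod C x = Dom C (coker f' \<cdot> im C b)"
    then show "(rh \<cdot> r \<cdot> ?t) \<cdot> x \<in> Null C \<longleftrightarrow> (coker f' \<cdot> im C b) \<cdot> x \<in> Null C"
      using x1 [of x] bot [of "im C b \<cdot> x"] rl [of x] S by auto
  qed
  \<comment> \<open>Dually, \<open>f\<close> takes the place of \<open>ker g\<close> in the
    description of \<open>r\<close>; the shift along \<open>bar b\<close> then yields a cokernel of
    \<open>l \<cdot> lm\<close>.\<close>
  have r0: "is_cokernel C r (coim C b \<cdot> f)"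
  proof (rule is_cokernel_cong [OF r])
    show "coim C b \<cdot> f \<in> Arr C" "Cod C (coim C b \<cdot> f) = Cod C (coim C b \<cdot> ker g)" using S by simp_all
    fix x assume x: "x \<in> Arr C" "Dom C x = Cod C (coim C b \<cdot> ker g)"
    then show "x \<cdot> coim C b \<cdot> f \<in> Null C \<longleftrightarrow> x \<cdot> coim C b \<cdot> ker g \<in> Null C"
      using x2 [of x] top [of "x \<cdot> coim C b"] S by auto
  qed
  have r': "is_cokernel C (r \<cdot> ?t) (l \<cdot> lm)"
    unfolding lm(3) by (rule cokernel_shift [OF r0 i]) (use S in simp)
  have "is_iso C (middle C (ker rh) (coker lm) ((r \<cdot> ?t) \<cdot> l))"
    by (rule homology_core [OF l' r' _ _ _ _ _ coker_choice ker_choice]) (use S in simp_all)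
  then show "is_iso C (middle C (ker rh) (coker lm) (r \<cdot> ?t \<cdot> l))" using S by simp
qed

lemma Lambek_h:
  assumes S: "commutative_square C S" and T: "commutative_square C T" and ST: "sq_right S = sq_left T"
    and ex: "exact_arrow C (sq_right S)"
    and n: "sq_top T \<cdot> sq_top S \<in> Null C" "sq_bot T \<cdot> sq_bot S \<in> Null C"
  shows "Lambek_h_well_defined C S T"
    and "(\<And>x. x \<in> Arr C \<Longrightarrow> Cod C x = Dom C (sq_bot T) \<Longrightarrow> sq_bot T \<cdot> x \<in> Null C \<Longrightarrow> coker (sq_bot S) \<cdot> x \<in> Null C) \<Longrightarrow>
      (\<And>x. x \<in> Arr C \<Longrightarrow> Dom C x = Cod C (sq_top S) \<Longrightarrow> x \<cdot> sq_top S \<in> Null C \<Longrightarrow> x \<cdot> ker (sq_top T) \<in> Null C) \<Longrightarrow>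
      is_iso C (Lambek_h C S T)"
proof -
  note F = commutative_squareD [OF S] commutative_squareD [OF T] lam_typing [OF S] rho_typing [OF T] ST n
  have A: "sq_top T \<in> Arr C" "sq_bot T \<in> Arr C" "Cod C (sq_top S) = Dom C (sq_right S)"
    "Dom C (sq_top T) = Dom C (sq_right S)" "Cod C (sq_bot S) = Cod C (sq_right S)" "Dom C (sq_bot T) = Cod C (sq_right S)"
    using F by simp_all
  have r: "is_cokernel C (r_left C T) (coim C (sq_right S) \<cdot> ker (sq_top T))"
    using r_left_cokernel [OF T] ST by simp
  have rh: "rho C T \<cdot> r_left C T = sq_bot T \<cdot> im C (sq_right S) \<cdot> bar C (sq_right S)" using F by simp
  note core = Lambek_core [OF ex F(1) A(1) F(4) A(2-6) n l_right_kernel [OF S] r lam_typing(1,3,5) [OF S] rho_typing(1,3) [OF T] rh]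
  show "Lambek_h_well_defined C S T"
    using core(1) ST ex by (simp add: Lambek_h_well_defined_def Lambek_h_target_def)
  assume bot: "\<And>x. x \<in> Arr C \<Longrightarrow> Cod C x = Dom C (sq_bot T) \<Longrightarrow> sq_bot T \<cdot> x \<in> Null C \<Longrightarrow> coker (sq_bot S) \<cdot> x \<in> Null C"
    and top: "\<And>x. x \<in> Arr C \<Longrightarrow> Dom C x = Cod C (sq_top S) \<Longrightarrow> x \<cdot> sq_top S \<in> Null C \<Longrightarrow> x \<cdot> ker (sq_top T) \<in> Null C"
  show "is_iso C (Lambek_h C S T)"
    unfolding Lambek_h_def Lambek_h_target_def
    by (rule core(2)) (use bot top A in simp_all)
qed

lemma Lambek_v:
  assumes S: "commutative_square C S" and T: "commutative_square C T" and ST: "sq_bot S = sq_top T"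
    and ex: "exact_arrow C (sq_bot S)"
    and n: "sq_left T \<cdot> sq_left S \<in> Null C" "sq_right T \<cdot> sq_right S \<in> Null C"
  shows "Lambek_v_well_defined C S T"
    and "(\<And>x. x \<in> Arr C \<Longrightarrow> Cod C x = Dom C (sq_right T) \<Longrightarrow> sq_right T \<cdot> x \<in> Null C \<Longrightarrow> coker (sq_right S) \<cdot> x \<in> Null C) \<Longrightarrow>
      (\<And>x. x \<in> Arr C \<Longrightarrow> Dom C x = Cod C (sq_left S) \<Longrightarrow> x \<cdot> sq_left S \<in> Null C \<Longrightarrow> x \<cdot> ker (sq_left T) \<in> Null C) \<Longrightarrow>
      is_iso C (Lambek_v C S T)"
proof -
  note F = commutative_squareD [OF S] commutative_squareD [OF T] lam_typing [OF S] rho_typing [OF T] ST n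
  have A: "sq_left T \<in> Arr C" "sq_right T \<in> Arr C" "Cod C (sq_left S) = Dom C (sq_bot S)"
    "Dom C (sq_left T) = Dom C (sq_bot S)" "Cod C (sq_right S) = Cod C (sq_bot S)" "Dom C (sq_right T) = Cod C (sq_bot S)"
    using F by simp_all
  have r: "is_cokernel C (r_top C T) (coim C (sq_bot S) \<cdot> ker (sq_left T))"
    using r_top_cokernel [OF T] ST by simp
  have rh: "rho C T \<cdot> r_top C T = sq_right T \<cdot> im C (sq_bot S) \<cdot> bar C (sq_bot S)" using F by simp
  note core = Lambek_core [OF ex F(2) A(1) F(3) A(2-6) n l_bot_kernel [OF S] r lam_typing(1,4,6) [OF S] rho_typing(1,4) [OF T] rh]
  show "Lambek_v_well_defined C S T"
    using core(1) ST ex by (simp add: Lambek_v_well_defined_def Lambek_v_target_def)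
  assume bot: "\<And>x. x \<in> Arr C \<Longrightarrow> Cod C x = Dom C (sq_right T) \<Longrightarrow> sq_right T \<cdot> x \<in> Null C \<Longrightarrow> coker (sq_right S) \<cdot> x \<in> Null C"
    and top: "\<And>x. x \<in> Arr C \<Longrightarrow> Dom C x = Cod C (sq_left S) \<Longrightarrow> x \<cdot> sq_left S \<in> Null C \<Longrightarrow> x \<cdot> ker (sq_left T) \<in> Null C"
  show "is_iso C (Lambek_v C S T)"
    unfolding Lambek_v_def Lambek_v_target_def
    by (rule core(2)) (use bot top A in simp_all)
qed

lemma Lambek_h_typing:
  assumes "Lambek_h_well_defined C S T"
  shows "Lambek_h C S T \<in> Arr C" "Dom C (Lambek_h C S T) = Cod C (coker (lam C S))"
    "Cod C (Lambek_h C S T) = Dom C (ker (rho C T))"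
    "ker (rho C T) \<cdot> Lambek_h C S T \<cdot> coker (lam C S) = r_left C T \<cdot> inv_arr C (bar C (sq_right S)) \<cdot> l_right C S"
proof -
  have "has_middle C (ker (rho C T)) (coker (lam C S)) (Lambek_h_target C S T)"
    using assms by (simp add: Lambek_h_well_defined_def)
  note m = is_middleD [OF has_middleD [OF this], folded Lambek_h_def, unfolded Lambek_h_target_def]
  show "Lambek_h C S T \<in> Arr C" "Dom C (Lambek_h C S T) = Cod C (coker (lam C S))"
    "Cod C (Lambek_h C S T) = Dom C (ker (rho C T))" by (rule m)+
  show "ker (rho C T) \<cdot> Lambek_h C S T \<cdot> coker (lam C S) = r_left C T \<cdot> inv_arr C (bar C (sq_right S)) \<cdot> l_right C S"
    by (rule m)
qed

lemma Lambek_v_typing: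
  assumes "Lambek_v_well_defined C S T"
  shows "Lambek_v C S T \<in> Arr C" "Dom C (Lambek_v C S T) = Cod C (coker (lam C S))"
    "Cod C (Lambek_v C S T) = Dom C (ker (rho C T))"
    "ker (rho C T) \<cdot> Lambek_v C S T \<cdot> coker (lam C S) = r_top C T \<cdot> inv_arr C (bar C (sq_bot S)) \<cdot> l_bot C S"
proof -
  have "has_middle C (ker (rho C T)) (coker (lam C S)) (Lambek_v_target C S T)"
    using assms by (simp add: Lambek_v_well_defined_def)
  note m = is_middleD [OF has_middleD [OF this], folded Lambek_v_def, unfolded Lambek_v_target_def]
  show "Lambek_v C S T \<in> Arr C" "Dom C (Lambek_v C S T) = Cod C (coker (lam C S))"
    "Cod C (Lambek_v C S T) = Dom C (ker (rho C T))" by (rule m)+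
  show "ker (rho C T) \<cdot> Lambek_v C S T \<cdot> coker (lam C S) = r_top C T \<cdot> inv_arr C (bar C (sq_bot S)) \<cdot> l_bot C S"
    by (rule m)
qed

end

context homological_category_with_choices
begin

section \<open>Induced morphisms, homology and dual Lambek morphisms\<close>

lemma on_ker_null:
  assumes "x \<in> Arr C" "y \<in> Arr C" "u \<in> Arr C" "Dom C u = Dom C x" "Cod C u = Dom C y" "y \<cdot> u \<cdot> ker x \<in> Null C"
  shows "induces_on_ker C x y u" "on_ker C x y u \<in> Arr C" "Dom C (on_ker C x y u) = Dom C (ker x)"
    "Cod C (on_ker C x y u) = Dom C (ker y)" "ker y \<cdot> on_ker C x y u = u \<cdot> ker x"
  using ker_lift [of y "u \<cdot> ker x"] assms by (simp_all add: induces_on_ker_def on_ker_def)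

lemma on_coker_null:
  assumes "x \<in> Arr C" "y \<in> Arr C" "u \<in> Arr C" "Dom C u = Cod C x" "Cod C u = Cod C y" "coker y \<cdot> u \<cdot> x \<in> Null C"
  shows "induces_on_coker C x y u" "on_coker C x y u \<in> Arr C" "Dom C (on_coker C x y u) = Cod C (coker x)"
    "Cod C (on_coker C x y u) = Cod C (coker y)" "on_coker C x y u \<cdot> coker x = coker y \<cdot> u"
  using coker_colift [of x "coker y \<cdot> u"] assms by (simp_all add: induces_on_coker_def on_coker_def)

lemma on_ker_square:
  assumes "x \<in> Arr C" "y \<in> Arr C" "u \<in> Arr C" "w \<in> Arr C" "Dom C u = Dom C x" "Cod C u = Dom C y"
    "Dom C w = Cod C x" "y \<cdot> u = w \<cdot> x"
  shows "induces_on_ker C x y u" "on_ker C x y u \<in> Arr C" "Dom C (on_ker C x y u) = Dom C (ker x)"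
    "Cod C (on_ker C x y u) = Dom C (ker y)" "ker y \<cdot> on_ker C x y u = u \<cdot> ker x"
proof -
  have "w \<cdot> x \<cdot> ker x \<in> Null C" by (rule null_left) (use assms in simp_all)
  then have n: "y \<cdot> u \<cdot> ker x \<in> Null C" using reassoc [OF assms(8), of "ker x"] assms by simp
  show "induces_on_ker C x y u" "on_ker C x y u \<in> Arr C" "Dom C (on_ker C x y u) = Dom C (ker x)"
    "Cod C (on_ker C x y u) = Dom C (ker y)" "ker y \<cdot> on_ker C x y u = u \<cdot> ker x"
    using on_ker_null [OF assms(1-3,5,6) n] by simp_all
qed

lemma on_coker_square:
  assumes "x \<in> Arr C" "y \<in> Arr C" "u \<in> Arr C" "w \<in> Arr C" "Dom C u = Cod C x" "Cod C u = Cod C y"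
    "Cod C w = Dom C y" "u \<cdot> x = y \<cdot> w"
  shows "induces_on_coker C x y u" "on_coker C x y u \<in> Arr C" "Dom C (on_coker C x y u) = Cod C (coker x)"
    "Cod C (on_coker C x y u) = Cod C (coker y)" "on_coker C x y u \<cdot> coker x = coker y \<cdot> u"
  using homological_category_with_choices.on_ker_square [OF homological_opp, of y x u w] assms by simp_all

lemma sharp_typing:
  assumes "f \<in> Arr C" "g \<in> Arr C" "Cod C f = Dom C g" "g \<cdot> f \<in> Null C"
  shows "lifts C (ker g) f" "sharp C f g \<in> Arr C" "Dom C (sharp C f g) = Dom C f"
    "Cod C (sharp C f g) = Dom C (ker g)" "ker g \<cdot> sharp C f g = f"
  using ker_lift [of g f] assms by (simp_all add: sharp_def)

lemma flat_typing:
  assumes "f \<in> Arr C" "g \<in> Arr C" "Cod C f = Dom C g" "g \<cdot> f \<in> Null C"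
  shows "colifts C (coker f) g" "flat C f g \<in> Arr C" "Dom C (flat C f g) = Cod C (coker f)"
    "Cod C (flat C f g) = Cod C g" "flat C f g \<cdot> coker f = g"
  using coker_colift [of f g] assms by (simp_all add: flat_def)

text \<open>The instance of \<open>homology_core\<close> with \<open>l = ker g\<close> and
  \<open>r = coker f\<close>; its outer morphisms are \<open>sharp f g\<close> and
  \<open>flat f g\<close>, because \<open>ker g \<cdot> sharp f g = f\<close> and
  \<open>flat f g \<cdot> coker f = g\<close>.\<close>

lemma homology_iso:
  assumes A: "f \<in> Arr C" "g \<in> Arr C" "Cod C f = Dom C g" "g \<cdot> f \<in> Null C"
  shows "homology_well_defined C f g" "is_iso C (homology_iso C f g)"
    "homology_iso C f g \<in> Arr C" "Dom C (homology_iso C f g) = Cod C (coker (sharp C f g))"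
    "Cod C (homology_iso C f g) = Dom C (ker (flat C f g))"
    "ker (flat C f g) \<cdot> homology_iso C f g \<cdot> coker (sharp C f g) = coker f \<cdot> ker g"
proof -
  note S = A(1-3) sharp_typing [OF A] flat_typing [OF A]
  have l: "is_kernel C (ker g) (flat C f g \<cdot> coker f)" using S ker_choice by simp
  have r: "is_cokernel C (coker f) (ker g \<cdot> sharp C f g)" using S coker_choice by simp
  have h: "has_middle C (ker (flat C f g)) (coker (sharp C f g)) (coker f \<cdot> ker g)"
    "is_iso C (homology_iso C f g)"
    unfolding homology_iso_def
    by (rule homology_core [OF l r _ _ _ _ _ coker_choice ker_choice]; use S in simp)+
  show "homology_well_defined C f g" using h S by (simp add: homology_well_defined_def)
  show "is_iso C (homology_iso C f g)" by (rule h)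
  note m = is_middleD [OF has_middleD [OF h(1)], folded homology_iso_def]
  show "homology_iso C f g \<in> Arr C" "Dom C (homology_iso C f g) = Cod C (coker (sharp C f g))"
    "Cod C (homology_iso C f g) = Dom C (ker (flat C f g))"
    "ker (flat C f g) \<cdot> homology_iso C f g \<cdot> coker (sharp C f g) = coker f \<cdot> ker g" by (rule m)+
qed

lemma inv_inv [simp]: "is_iso C f \<Longrightarrow> inv_arr C (inv_arr C f) = f"
  using inv_arr_eq is_inverse_sym iso_inverse by blast

lemma on_coker_iso:
  assumes i: "is_iso C \<phi>" and x: "x \<in> Arr C" "Cod C x = Dom C \<phi>" "\<phi> \<cdot> x = y"
  shows "induces_on_coker C x y \<phi>" "is_iso C (on_coker C x y \<phi>)" "on_coker C x y \<phi> \<in> Arr C"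
    "Dom C (on_coker C x y \<phi>) = Cod C (coker x)" "Cod C (on_coker C x y \<phi>) = Cod C (coker y)"
    "on_coker C x y \<phi> \<cdot> coker x = coker y \<cdot> \<phi>"
proof -
  note S = iso_Arr [OF i] iso_inv_typing [OF i] x(1,2) x(3) [symmetric] iso_cancel [OF i]
  have "is_cokernel C (coker y \<cdot> \<phi>) x"
    using cokernel_shift [OF coker_choice iso_inv [OF i], of y] S i by simp
  note u = cokernel_unique [OF coker_choice [OF x(1)] this]
  show "induces_on_coker C x y \<phi>" "is_iso C (on_coker C x y \<phi>)"
    using u by (simp_all add: induces_on_coker_def on_coker_def)
  note m = is_coliftD [OF coliftsD [OF u(1)], folded on_coker_def]
  show "on_coker C x y \<phi> \<in> Arr C"
    "Dom C (on_coker C x y \<phi>) = Cod C (coker x)" "on_coker C x y \<phi> \<cdot> coker x = coker y \<cdot> \<phi>" by (rule m)+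
  show "Cod C (on_coker C x y \<phi>) = Cod C (coker y)" using m S by simp
qed

text \<open>A kernel taken inside a kernel is cut out by two annihilation conditions on the ambient
  object, the assumption moving the second one there from \<open>Dom k\<close>. The order of the
  conditions is lost, which is what makes \<open>Ker h\<close> and \<open>Ker eta\<close>
  comparable.\<close>

lemma factors_kernel_comp:
  assumes k: "is_kernel C k d" and l: "is_kernel C l e" and A: "Cod C l = Dom C k"
    and eq: "\<And>y. y \<in> Arr C \<Longrightarrow> Cod C y = Dom C k \<Longrightarrow> e \<cdot> y \<in> Null C \<longleftrightarrow> e' \<cdot> k \<cdot> y \<in> Null C"
    and x: "x \<in> Arr C" "Cod C x = Dom C d"
  shows "factors C (k \<cdot> l) x \<longleftrightarrow> d \<cdot> x \<in> Null C \<and> e' \<cdot> x \<in> Null C"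
proof (cases "d \<cdot> x \<in> Null C")
  case True
  note K = is_kernelD [OF k] is_kernelD [OF l]
  obtain y where y: "y \<in> Arr C" "Dom C y = Dom C x" "Cod C y = Dom C k" "k \<cdot> y = x"
    using kernel_factor [OF k x True] by metis
  have "factors C (k \<cdot> l) (k \<cdot> y) \<longleftrightarrow> factors C l y"
    by (rule factors_comp) (use is_kernel_mono [OF k] K A y in simp_all)
  also have "\<dots> \<longleftrightarrow> e \<cdot> y \<in> Null C"
    by (rule factors_kernel [OF l]) (use K A y in simp_all)
  finally show ?thesis using y eq [of y] True by simp
next
  case False
  have "\<not> factors C k x" using False factors_kernel [OF k x] by simp
  then show ?thesis using False factors_comp_left [of k l x] is_kernelD [OF k] is_kernelD [OF l] A by auto
qed

text \<open>The squares change order and \<open>bar\<close> of the shared side is self-dual.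
  Exactness of that side makes the inverse of \<open>bar\<close> a genuine arrow, so that the
  threefold composite \<open>Lambek_h_target\<close> can be rebracketed.\<close>

lemma Lambek_h_opp:
  assumes "commutative_square C S" "commutative_square C T" "sq_right S = sq_left T" "exact_arrow C (sq_right S)"
  shows "Lambek_h (opp C) (sq_opp T) (sq_opp S) = Lambek_h C S T"
    "Lambek_h_well_defined (opp C) (sq_opp T) (sq_opp S) = Lambek_h_well_defined C S T"
proof -
  have i: "is_iso C (bar C (sq_left T))" using assms by (simp add: exact_arrow_iff)
  note F = assms(1,2) assms(3) [symmetric] commutative_squareD [OF assms(1)] commutative_squareD [OF assms(2)] lam_typing [OF assms(1)]
    rho_typing [OF assms(2)] is_kernelD [OF l_right_kernel [OF assms(1)]] is_cokernelD [OF r_left_cokernel [OF assms(2)]]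
  have t: "Lambek_h_target (opp C) (sq_opp T) (sq_opp S) = Lambek_h_target C S T"
    using F i by (simp add: Lambek_h_target_def bar_opp)
  show "Lambek_h (opp C) (sq_opp T) (sq_opp S) = Lambek_h C S T"
    unfolding Lambek_h_def t using F by (simp add: lam_opp rho_opp middle_opp)
  show "Lambek_h_well_defined (opp C) (sq_opp T) (sq_opp S) = Lambek_h_well_defined C S T"
    unfolding Lambek_h_well_defined_def t using F by (auto simp: lam_opp rho_opp has_middle_opp exact_arrow_opp)
qed

lemma Lambek_v_opp:
  assumes "commutative_square C S" "commutative_square C T" "sq_bot S = sq_top T" "exact_arrow C (sq_bot S)"
  shows "Lambek_v (opp C) (sq_opp T) (sq_opp S) = Lambek_v C S T"
    "Lambek_v_well_defined (opp C) (sq_opp T) (sq_opp S) = Lambek_v_well_defined C S T"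
proof -
  have i: "is_iso C (bar C (sq_top T))" using assms by (simp add: exact_arrow_iff)
  note F = assms(1,2) assms(3) [symmetric] commutative_squareD [OF assms(1)] commutative_squareD [OF assms(2)] lam_typing [OF assms(1)]
    rho_typing [OF assms(2)] is_kernelD [OF l_bot_kernel [OF assms(1)]] is_cokernelD [OF r_top_cokernel [OF assms(2)]]
  have t: "Lambek_v_target (opp C) (sq_opp T) (sq_opp S) = Lambek_v_target C S T"
    using F i by (simp add: Lambek_v_target_def bar_opp)
  show "Lambek_v (opp C) (sq_opp T) (sq_opp S) = Lambek_v C S T"
    unfolding Lambek_v_def t using F by (simp add: lam_opp rho_opp middle_opp)
  show "Lambek_v_well_defined (opp C) (sq_opp T) (sq_opp S) = Lambek_v_well_defined C S T"
    unfolding Lambek_v_well_defined_def t using F by (auto simp: lam_opp rho_opp has_middle_opp exact_arrow_opp)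
qed

end

section \<open>The diagram\<close>

text \<open>A half turn: reversing the columns puts the primed row on top, and reversing the rows
  exchanges left with right. The middle column stays, so exactness of \<open>b\<close> is self-dual
  and S and T trade places.\<close>

definition opd :: "'m diagram \<Rightarrow> 'm diagram" where
  "opd D = \<lparr>row_f = row_gp D, row_g = row_fp D, row_fp = row_g D, row_gp = row_f D,
     col_a = col_c D, col_b = col_b D, col_c = col_a D\<rparr>"

lemma opd_simps [simp]:
  "row_f (opd D) = row_gp D" "row_g (opd D) = row_fp D" "row_fp (opd D) = row_g D" "row_gp (opd D) = row_f D"
  "col_a (opd D) = col_c D" "col_b (opd D) = col_b D" "col_c (opd D) = col_a D"
  by (simp_all add: opd_def)

lemma diagram_arrows_opp [simp]:
  "b_hat (opp C) (opd D) = b_check C D" "b_check (opp C) (opd D) = b_hat C D"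
  "f_hat (opp C) (opd D) = gp_check C D" "g_hat (opp C) (opd D) = fp_check C D"
  "fp_check (opp C) (opd D) = g_hat C D" "gp_check (opp C) (opd D) = f_hat C D"
  by (simp_all add: b_hat_def b_check_def f_hat_def g_hat_def fp_check_def gp_check_def)

lemma xi_eta_opp [simp]:
  "xi (opp C) (opd D) = xip C D" "xip (opp C) (opd D) = xi C D"
  "eta (opp C) (opd D) = etap C D" "etap (opp C) (opd D) = eta C D"
  by (simp_all add: xi_def xip_def eta_def etap_def)

lemma lambda_mu_opp [simp]:
  "lambda (opp C) (opd D) = lambdap C D" "mu (opp C) (opd D) = mup C D" "v_arr (opp C) (opd D) = u_arr C D"
  "lambdap (opp C) (opd D) = lambda C D" "mup (opp C) (opd D) = mu C D" "u_arr (opp C) (opd D) = v_arr C D"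
  by (simp_all add: lambda_def mu_def v_arr_def lambdap_def mup_def u_arr_def)

lemma p_kappa_opp [simp]:
  "p_pre (opp C) (opd D) = pp_pre C D" "kappa_pre (opp C) (opd D) = kappap_pre C D"
  by (simp_all add: p_pre_def kappa_pre_def pp_pre_def kappap_pre_def)

lemma squares_opp [simp]:
  "sq_S (opd D) = sq_opp (sq_T D)" "sq_T (opd D) = sq_opp (sq_S D)"
  "sq_S0 (opp C) (opd D) = sq_opp (sq_T0 C D)" "sq_T0 (opp C) (opd D) = sq_opp (sq_S0 C D)"
  "sq_S1 (opp C) (opd D) = sq_opp (sq_T1 C D)" "sq_T1 (opp C) (opd D) = sq_opp (sq_S1 C D)"
  "sq_S2 (opp C) (opd D) = sq_opp (sq_T2 C D)" "sq_T2 (opp C) (opd D) = sq_opp (sq_S2 C D)"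
  by (simp_all add: sq_S_def sq_T_def sq_S0_def sq_T0_def sq_S1_def sq_T1_def sq_S2_def sq_T2_def sq_opp_def)

lemma pb_po_opp [simp]:
  "pb_S0_iso (opp C) (opd D) = po_T0_iso C D" "pb_S2_iso (opp C) (opd D) = po_T2_iso C D"
  by (simp_all add: pb_S0_iso_def pb_S2_iso_def po_T0_iso_def po_T2_iso_def)

locale lambek_diagram = homological_category_with_choices C
  for C :: "('o, 'm, 'x) chosen_category_scheme" (structure) +
  fixes D :: "'m diagram"
  assumes null_rows: "null_row_diagram C D"
    and b_exact: "exact_arrow C (col_b D)"
begin

text \<open>Every fact about the diagram can be applied to this dual diagram; the exchange rules
  above then read it back as the dual fact about the original one.\<close>

lemma opp_diagram: "lambek_diagram (opp C) (opd D)"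
proof -
  have "null_row_diagram (opp C) (opd D)"
    using null_rows by (auto simp: null_row_diagram_def)
  moreover have "exact_arrow (opp C) (col_b (opd D))" using b_exact by (simp add: exact_arrow_opp)
  ultimately show ?thesis using homological_opp by (simp add: lambek_diagram_def lambek_diagram_axioms_def)
qed

abbreviation (input) "f \<equiv> row_f D"
abbreviation (input) "g \<equiv> row_g D"
abbreviation (input) "f' \<equiv> row_fp D"
abbreviation (input) "g' \<equiv> row_gp D"
abbreviation (input) "a \<equiv> col_a D"
abbreviation (input) "b \<equiv> col_b D"
abbreviation (input) "c \<equiv> col_c D"

section \<open>The morphisms induced by the diagram\<close>

lemma diagram_typing [simp]:
  "f \<in> Arr C" "g \<in> Arr C" "f' \<in> Arr C" "g' \<in> Arr C" "a \<in> Arr C" "b \<in> Arr C" "c \<in> Arr C"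
  "Dom C a = Dom C f" "Cod C a = Dom C f'" "Cod C f = Dom C g" "Dom C b = Dom C g"
  "Cod C b = Dom C g'" "Cod C f' = Dom C g'" "Dom C c = Cod C g" "Cod C c = Cod C g'"
  "g \<cdot> f \<in> Null C" "g' \<cdot> f' \<in> Null C"
  using null_rows by (simp_all add: null_row_diagram_def)

lemma diagram_squares: "b \<cdot> f = f' \<cdot> a" "c \<cdot> g = g' \<cdot> b"
  using null_rows by (simp_all add: null_row_diagram_def)

lemmas [simp] = sharp_typing [OF diagram_typing(1,2,10,16)] sharp_typing [OF diagram_typing(3,4,13,17)]
  flat_typing [OF diagram_typing(1,2,10,16)] flat_typing [OF diagram_typing(3,4,13,17)]

lemma row_homology [simp]:
  "homology_well_defined C f g" "homology_well_defined C f' g'"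
  "is_iso C (homology_iso C f g)" "is_iso C (homology_iso C f' g')"
  "homology_iso C f g \<in> Arr C" "homology_iso C f' g' \<in> Arr C"
  "Dom C (homology_iso C f g) = Cod C (coker (sharp C f g))"
  "Cod C (homology_iso C f g) = Dom C (ker (flat C f g))"
  "Dom C (homology_iso C f' g') = Cod C (coker (sharp C f' g'))"
  "Cod C (homology_iso C f' g') = Dom C (ker (flat C f' g'))"
  by (rule homology_iso; simp)+

lemma b_hat_typing [simp]: "induces_on_ker C g g' b" "b_hat C D \<in> Arr C" "Dom C (b_hat C D) = Dom C (ker g)"
    "Cod C (b_hat C D) = Dom C (ker g')"
  and b_hat_eq: "ker g' \<cdot> b_hat C D = b \<cdot> ker g"
  using on_ker_square [of g g' b c] diagram_squares by (simp_all add: b_hat_def)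

lemma b_check_typing [simp]: "induces_on_coker C f f' b" "b_check C D \<in> Arr C"
    "Dom C (b_check C D) = Cod C (coker f)" "Cod C (b_check C D) = Cod C (coker f')"
  and b_check_eq: "b_check C D \<cdot> coker f = coker f' \<cdot> b"
  using on_coker_square [of f f' b a] diagram_squares by (simp_all add: b_check_def)

lemma f_hat_typing [simp]: "induces_on_ker C a b f" "f_hat C D \<in> Arr C" "Dom C (f_hat C D) = Dom C (ker a)"
    "Cod C (f_hat C D) = Dom C (ker b)"
  and f_hat_eq: "ker b \<cdot> f_hat C D = f \<cdot> ker a"
  using on_ker_square [of a b f f'] diagram_squares by (simp_all add: f_hat_def)

lemma g_hat_typing [simp]: "induces_on_ker C b c g" "g_hat C D \<in> Arr C" "Dom C (g_hat C D) = Dom C (ker b)"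
    "Cod C (g_hat C D) = Dom C (ker c)"
  and g_hat_eq: "ker c \<cdot> g_hat C D = g \<cdot> ker b"
  using on_ker_square [of b c g g'] diagram_squares by (simp_all add: g_hat_def)

lemma fp_check_typing [simp]: "induces_on_coker C a b f'" "fp_check C D \<in> Arr C"
    "Dom C (fp_check C D) = Cod C (coker a)" "Cod C (fp_check C D) = Cod C (coker b)"
  using on_coker_square [of a b f' f] diagram_squares by (simp_all add: fp_check_def)

lemma gp_check_typing [simp]: "induces_on_coker C b c g'" "gp_check C D \<in> Arr C"
    "Dom C (gp_check C D) = Cod C (coker b)" "Cod C (gp_check C D) = Cod C (coker c)"
  and gp_check_eq: "gp_check C D \<cdot> coker b = coker c \<cdot> g'"
  using on_coker_square [of b c g' g] diagram_squares by (simp_all add: gp_check_def)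

lemma sharp_square: "b_hat C D \<cdot> sharp C f g = sharp C f' g' \<cdot> a"
proof (rule mono_arr_cancel [of C "ker g'"])
  show "ker g' \<cdot> b_hat C D \<cdot> sharp C f g = ker g' \<cdot> sharp C f' g' \<cdot> a"
    using reassoc [OF b_hat_eq, of "sharp C f g"] reassoc [OF sharp_typing(5) [OF diagram_typing(3,4,13,17)], of a] diagram_squares
    by simp
qed simp_all

lemma flat_square: "flat C f' g' \<cdot> b_check C D = c \<cdot> flat C f g"
  using lambek_diagram.sharp_square [OF opp_diagram] by simp

lemma h_arr_typing [simp]: "induces_on_coker C (sharp C f g) (sharp C f' g') (b_hat C D)" "h_arr C D \<in> Arr C"
    "Dom C (h_arr C D) = Cod C (coker (sharp C f g))" "Cod C (h_arr C D) = Cod C (coker (sharp C f' g'))"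
  and h_arr_eq: "h_arr C D \<cdot> coker (sharp C f g) = coker (sharp C f' g') \<cdot> b_hat C D"
  using on_coker_square [of "sharp C f g" "sharp C f' g'" "b_hat C D" a] sharp_square by (simp_all add: h_arr_def)

text \<open>The morphism induced by \<open>b_check\<close> on the right homologies \<open>Ker (Coker f \<rightarrow> C)\<close>.\<close>

definition h_right :: 'm where "h_right = on_ker C (flat C f g) (flat C f' g') (b_check C D)"

lemma h_right_typing [simp]: "induces_on_ker C (flat C f g) (flat C f' g') (b_check C D)" "h_right \<in> Arr C"
    "Dom C h_right = Dom C (ker (flat C f g))" "Cod C h_right = Dom C (ker (flat C f' g'))"
  and h_right_eq: "ker (flat C f' g') \<cdot> h_right = b_check C D \<cdot> ker (flat C f g)"
  using on_ker_square [of "flat C f g" "flat C f' g'" "b_check C D" c] flat_square by (simp_all add: h_right_def)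

text \<open>Between the epimorphism \<open>coker (sharp f g)\<close> and the monomorphism
  \<open>ker (flat f' g')\<close>, both sides become
  \<open>coker f' \<cdot> b \<cdot> ker g\<close>.\<close>

lemma homology_iso_natural: "homology_iso C f' g' \<cdot> h_arr C D = h_right \<cdot> homology_iso C f g"
proof (rule epi_arr_cancel [of C "coker (sharp C f g)"], simp_all)
  note m = homology_iso(6) [OF diagram_typing(1,2,10,16)] homology_iso(6) [OF diagram_typing(3,4,13,17)]
  have m2: "ker (flat C f' g') \<cdot> homology_iso C f' g' \<cdot> coker (sharp C f' g') \<cdot> b_hat C D
      = coker f' \<cdot> ker g' \<cdot> b_hat C D"
    using reassoc [OF m(2), of "b_hat C D"] by simp
  show "homology_iso C f' g' \<cdot> h_arr C D \<cdot> coker (sharp C f g) = h_right \<cdot> homology_iso C f g \<cdot> coker (sharp C f g)"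
    by (rule mono_arr_cancel [of C "ker (flat C f' g')"])
      (simp_all add: h_arr_eq m m2 h_right_eq reassoc [OF h_right_eq] b_hat_eq reassoc [OF b_check_eq])
qed

lemma xi_typing [simp]: "induces_on_ker C b (b_check C D) (coker f)" "xi C D \<in> Arr C" "Dom C (xi C D) = Dom C (ker b)"
    "Cod C (xi C D) = Dom C (ker (b_check C D))"
  and xi_eq: "ker (b_check C D) \<cdot> xi C D = coker f \<cdot> ker b"
  using on_ker_square [of b "b_check C D" "coker f" "coker f'"] b_check_eq by (simp_all add: xi_def)

lemma eta_typing [simp]: "induces_on_ker C (b_check C D) c (flat C f g)" "eta C D \<in> Arr C"
    "Dom C (eta C D) = Dom C (ker (b_check C D))" "Cod C (eta C D) = Dom C (ker c)"
  and eta_eq: "ker c \<cdot> eta C D = flat C f g \<cdot> ker (b_check C D)"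
  using on_ker_square [of "b_check C D" c "flat C f g" "flat C f' g'"] flat_square by (simp_all add: eta_def)

lemma eta_xi: "eta C D \<cdot> xi C D = g_hat C D"
  by (rule mono_arr_cancel [of C "ker c"])
    (simp_all add: g_hat_eq reassoc [OF eta_eq] xi_eq reassoc [OF flat_typing(5)])

lemma etap_typing [simp]: "induces_on_coker C a (b_hat C D) (sharp C f' g')" "etap C D \<in> Arr C"
    "Dom C (etap C D) = Cod C (coker a)" "Cod C (etap C D) = Cod C (coker (b_hat C D))"
  and etap_eq: "etap C D \<cdot> coker a = coker (b_hat C D) \<cdot> sharp C f' g'"
  using lambek_diagram.eta_typing [OF opp_diagram] lambek_diagram.eta_eq [OF opp_diagram] by simp_all

lemma xip_typing [simp]: "induces_on_coker C (b_hat C D) b (ker g')" "xip C D \<in> Arr C"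
    "Dom C (xip C D) = Cod C (coker (b_hat C D))" "Cod C (xip C D) = Cod C (coker b)"
  and xip_eq: "xip C D \<cdot> coker (b_hat C D) = coker b \<cdot> ker g'"
  using lambek_diagram.xi_typing [OF opp_diagram] lambek_diagram.xi_eq [OF opp_diagram] by simp_all

lemma xip_etap: "xip C D \<cdot> etap C D = fp_check C D"
  using lambek_diagram.eta_xi [OF opp_diagram] by simp

lemma xi_f_hat_null: "xi C D \<cdot> f_hat C D \<in> Null C"
proof (rule ker_reflects_null [of "b_check C D"])
  have "(coker f \<cdot> f) \<cdot> ker a \<in> Null C" by (rule null_right) simp_all
  then show "ker (b_check C D) \<cdot> xi C D \<cdot> f_hat C D \<in> Null C"
    by (simp add: reassoc [OF xi_eq] f_hat_eq)
qed simp_all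

lemma hat_null [simp]: "g_hat C D \<cdot> f_hat C D \<in> Null C"
  unfolding eta_xi [symmetric] using null_left [OF xi_f_hat_null, of "eta C D"] by simp

lemma check_null [simp]: "gp_check C D \<cdot> fp_check C D \<in> Null C"
  using lambek_diagram.hat_null [OF opp_diagram] by simp

lemma induced_arrows: "induced_arrows_well_defined C D"
  unfolding induced_arrows_well_defined_def
  using homology_iso_natural [unfolded h_right_def] eta_xi xip_etap by (simp add: homology_iso(1))

section \<open>The outer arrows p and \<kappa>\<close>

lemma lambda_typing [simp]: "lifts C (ker (xi C D)) (f_hat C D)" "lambda C D \<in> Arr C"
    "Dom C (lambda C D) = Dom C (ker a)" "Cod C (lambda C D) = Dom C (ker (xi C D))"
  and lambda_eq: "ker (xi C D) \<cdot> lambda C D = f_hat C D"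
  using ker_lift [of "xi C D" "f_hat C D"] xi_f_hat_null by (simp_all add: lambda_def)

lemma mu_typing [simp]: "lifts C (ker (eta C D \<cdot> xi C D)) (ker (xi C D))" "mu C D \<in> Arr C"
    "Dom C (mu C D) = Dom C (ker (xi C D))" "Cod C (mu C D) = Dom C (ker (eta C D \<cdot> xi C D))"
  and mu_eq: "ker (eta C D \<cdot> xi C D) \<cdot> mu C D = ker (xi C D)"
proof -
  have "eta C D \<cdot> xi C D \<cdot> ker (xi C D) \<in> Null C" by (rule null_left) simp_all
  note l = ker_lift [of "eta C D \<cdot> xi C D" "ker (xi C D)", folded mu_def]
  show "lifts C (ker (eta C D \<cdot> xi C D)) (ker (xi C D))" "mu C D \<in> Arr C"
    "Dom C (mu C D) = Dom C (ker (xi C D))" "Cod C (mu C D) = Dom C (ker (eta C D \<cdot> xi C D))"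
    "ker (eta C D \<cdot> xi C D) \<cdot> mu C D = ker (xi C D)"
    using l \<open>_ \<in> Null C\<close> by simp_all
qed

text \<open>Through this equation \<open>Coker (mu \<cdot> lambda)\<close> is the object
  \<open>homology f_hat g_hat\<close> itself, so \<open>p_pre\<close> and \<open>kappa_pre\<close>
  meet there without an identification.\<close>

lemma mu_lambda: "mu C D \<cdot> lambda C D = sharp C (f_hat C D) (g_hat C D)"
proof -
  have "is_lift C (ker (g_hat C D)) (f_hat C D) (mu C D \<cdot> lambda C D)"
    using lambda_eq reassoc [OF mu_eq, of "lambda C D"] by (simp add: is_lift_def hom_def eta_xi)
  then show ?thesis unfolding sharp_def by (rule mono_lift(2) [OF ker_typing(4) [OF g_hat_typing(2)], symmetric])
qed

lemma v_arr_typing [simp]: "induces_on_ker C (eta C D \<cdot> xi C D) (eta C D) (xi C D)" "v_arr C D \<in> Arr C"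
    "Dom C (v_arr C D) = Dom C (ker (eta C D \<cdot> xi C D))" "Cod C (v_arr C D) = Dom C (ker (eta C D))"
  and v_arr_eq: "ker (eta C D) \<cdot> v_arr C D = xi C D \<cdot> ker (eta C D \<cdot> xi C D)"
  using on_ker_null [of "eta C D \<cdot> xi C D" "eta C D" "xi C D"] ker_typing(3) [of "eta C D \<cdot> xi C D"]
  by (simp_all add: v_arr_def del: ker_typing(3))

lemma p_pre_typing [simp]: "induces_on_coker C (lambda C D) (mu C D \<cdot> lambda C D) (mu C D)" "p_pre C D \<in> Arr C"
    "Dom C (p_pre C D) = Cod C (coker (lambda C D))" "Cod C (p_pre C D) = Cod C (coker (mu C D \<cdot> lambda C D))"
  and p_pre_eq: "p_pre C D \<cdot> coker (lambda C D) = coker (mu C D \<cdot> lambda C D) \<cdot> mu C D"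
  using on_coker_null [of "lambda C D" "mu C D \<cdot> lambda C D" "mu C D"] by (simp_all add: p_pre_def)

lemma v_mu_null: "v_arr C D \<cdot> mu C D \<in> Null C"
  by (rule ker_reflects_null [of "eta C D"]) (simp_all add: reassoc [OF v_arr_eq] mu_eq)

lemma kappa_pre_typing [simp]: "colifts C (coker (mu C D \<cdot> lambda C D)) (v_arr C D)" "kappa_pre C D \<in> Arr C"
    "Dom C (kappa_pre C D) = Cod C (coker (mu C D \<cdot> lambda C D))" "Cod C (kappa_pre C D) = Dom C (ker (eta C D))"
  and kappa_pre_eq: "kappa_pre C D \<cdot> coker (mu C D \<cdot> lambda C D) = v_arr C D"
proof -
  have "(v_arr C D \<cdot> mu C D) \<cdot> lambda C D \<in> Null C" by (rule null_right [OF v_mu_null]) simp_all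
  then show "colifts C (coker (mu C D \<cdot> lambda C D)) (v_arr C D)" "kappa_pre C D \<in> Arr C"
    "Dom C (kappa_pre C D) = Cod C (coker (mu C D \<cdot> lambda C D))" "Cod C (kappa_pre C D) = Dom C (ker (eta C D))"
    "kappa_pre C D \<cdot> coker (mu C D \<cdot> lambda C D) = v_arr C D"
    using coker_colift [of "mu C D \<cdot> lambda C D" "v_arr C D"] by (simp_all add: kappa_pre_def)
qed

lemma kappa_p_null: "kappa_pre C D \<cdot> p_pre C D \<in> Null C"
  by (rule coker_reflects_null [of "lambda C D"])
    (simp_all add: p_pre_eq reassoc [OF kappa_pre_eq] v_mu_null)

text \<open>Precomposed with its cokernel, \<open>kappa_pre\<close> becomes \<open>v_arr\<close>,
  and \<open>ker eta \<cdot> v_arr = xi \<cdot> ker (eta \<cdot> xi)\<close> is annihilated by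
  \<open>coker xi\<close>. Nullness is thus reached before the Lambek isomorphisms in \<beta> are
  applied.\<close>

lemma beta_kappa_null: "coker (xi C D) \<cdot> ker (eta C D) \<cdot> kappa_pre C D \<in> Null C"
proof (rule coker_reflects_null [of "mu C D \<cdot> lambda C D"])
  have "(coker (xi C D) \<cdot> xi C D) \<cdot> ker (eta C D \<cdot> xi C D) \<in> Null C" by (rule null_right) simp_all
  then show "(coker (xi C D) \<cdot> ker (eta C D) \<cdot> kappa_pre C D) \<cdot> coker (mu C D \<cdot> lambda C D) \<in> Null C"
    by (simp add: kappa_pre_eq v_arr_eq)
qed simp_all

section \<open>The eight squares and their Lambek morphisms\<close>

lemma square_sides [simp]:
  "sq_top (sq_S D) = f" "sq_left (sq_S D) = a" "sq_right (sq_S D) = b" "sq_bot (sq_S D) = f'"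
  "sq_top (sq_T D) = g" "sq_left (sq_T D) = b" "sq_right (sq_T D) = c" "sq_bot (sq_T D) = g'"
  "sq_top (sq_S0 C D) = f_hat C D" "sq_left (sq_S0 C D) = ker a" "sq_right (sq_S0 C D) = ker b" "sq_bot (sq_S0 C D) = f"
  "sq_top (sq_T0 C D) = g'" "sq_left (sq_T0 C D) = coker b" "sq_right (sq_T0 C D) = coker c" "sq_bot (sq_T0 C D) = gp_check C D"
  "sq_top (sq_S1 C D) = coker f" "sq_left (sq_S1 C D) = b" "sq_right (sq_S1 C D) = b_check C D" "sq_bot (sq_S1 C D) = coker f'"
  "sq_top (sq_S2 C D) = xi C D" "sq_left (sq_S2 C D) = ker b" "sq_right (sq_S2 C D) = ker (b_check C D)" "sq_bot (sq_S2 C D) = coker f"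
  "sq_top (sq_T1 C D) = ker g" "sq_left (sq_T1 C D) = b_hat C D" "sq_right (sq_T1 C D) = b" "sq_bot (sq_T1 C D) = ker g'"
  "sq_top (sq_T2 C D) = ker g'" "sq_left (sq_T2 C D) = coker (b_hat C D)" "sq_right (sq_T2 C D) = coker b" "sq_bot (sq_T2 C D) = xip C D"
  by (simp_all add: sq_S_def sq_T_def sq_S0_def sq_T0_def sq_S1_def sq_T1_def sq_S2_def sq_T2_def)

lemma squares_commute [simp]:
  "commutative_square C (sq_S D)" "commutative_square C (sq_T D)"
  "commutative_square C (sq_S0 C D)" "commutative_square C (sq_T0 C D)"
  "commutative_square C (sq_S1 C D)" "commutative_square C (sq_T1 C D)"
  "commutative_square C (sq_S2 C D)" "commutative_square C (sq_T2 C D)"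
  using diagram_squares f_hat_eq gp_check_eq b_hat_eq b_check_eq xi_eq xip_eq
  by (simp_all add: commutative_square_def)

lemma b_iso [simp]: "is_iso C (bar C b)"
  using b_exact by (simp add: exact_arrow_iff)

lemma coker_f_iso [simp]: "is_iso C (bar C (coker f))"
  using exact_coker [of f] by (simp add: exact_arrow_iff)

lemma Lambek_S_T: "Lambek_h_well_defined C (sq_S D) (sq_T D)"
  by (rule Lambek_h(1)) (simp_all add: b_exact)

text \<open>The rows \<open>f\<close>, \<open>coker f\<close> and \<open>f'\<close>,
  \<open>coker f'\<close> are exact at the middle by construction: one test is immediate, and the
  other says that \<open>f\<close> and \<open>im f = ker (coker f)\<close> are annihilated by the
  same morphisms.\<close>

lemma Lambek_S_S1: "Lambek_h_well_defined C (sq_S D) (sq_S1 C D)"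
    and Lambek_S_S1_iso [simp]: "is_iso C (Lambek_h C (sq_S D) (sq_S1 C D))"
  by (rule Lambek_h; use b_exact null_im_iff [of f] in \<open>simp add: im_def\<close>)+

lemma Lambek_S2_S1: "Lambek_v_well_defined C (sq_S2 C D) (sq_S1 C D)"
    and Lambek_S2_S1_iso [simp]: "is_iso C (Lambek_v C (sq_S2 C D) (sq_S1 C D))"
  by (rule Lambek_v; use exact_coker [of f] null_coim_iff [of "b_check C D"] in \<open>simp add: coim_def\<close>)+

text \<open>\<open>sq_S0\<close> sits on \<open>sq_S\<close> along \<open>f\<close>, so exactness of
  \<open>f\<close> is exactness of the shared side; the columns, each a kernel followed by its
  arrow, are exact at the middle.\<close>

lemma Lambek_S0_S:
  assumes "exact_arrow C f"
  shows "Lambek_v_well_defined C (sq_S0 C D) (sq_S D)" "is_iso C (Lambek_v C (sq_S0 C D) (sq_S D))"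
  by (rule Lambek_v; use assms null_coim_iff [of b] in \<open>simp add: coim_def\<close>)+

lemma Lambek_T1_T: "Lambek_h_well_defined C (sq_T1 C D) (sq_T D)"
    and Lambek_T1_T_iso [simp]: "is_iso C (Lambek_h C (sq_T1 C D) (sq_T D))"
  using lambek_diagram.Lambek_S_S1 [OF opp_diagram] lambek_diagram.Lambek_S_S1_iso [OF opp_diagram]
    b_exact by (simp_all add: Lambek_h_opp)

lemma Lambek_T1_T2: "Lambek_v_well_defined C (sq_T1 C D) (sq_T2 C D)"
    and Lambek_T1_T2_iso [simp]: "is_iso C (Lambek_v C (sq_T1 C D) (sq_T2 C D))"
  using lambek_diagram.Lambek_S2_S1 [OF opp_diagram] lambek_diagram.Lambek_S2_S1_iso [OF opp_diagram]
    exact_ker [of g'] by (simp_all add: Lambek_v_opp)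

lemma Lambek_T_T0:
  assumes "exact_arrow C g'"
  shows "Lambek_v_well_defined C (sq_T D) (sq_T0 C D)" "is_iso C (Lambek_v C (sq_T D) (sq_T0 C D))"
  using lambek_diagram.Lambek_S0_S [OF opp_diagram] assms by (simp_all add: Lambek_v_opp exact_arrow_opp)

lemmas [simp] = Lambek_h_typing(1-3) [OF Lambek_S_T] Lambek_h_typing(1-3) [OF Lambek_S_S1]
  Lambek_v_typing(1-3) [OF Lambek_S2_S1] Lambek_h_typing(1-3) [OF Lambek_T1_T] Lambek_v_typing(1-3) [OF Lambek_T1_T2]

lemmas [simp] = squares_commute [THEN lam_typing(1)] squares_commute [THEN lam_typing(2)]
  squares_commute [THEN rho_typing(1)] squares_commute [THEN rho_typing(2)]

section \<open>Identifications\<close>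

text \<open>The pullback of two images is their intersection, carried into \<open>Dom d\<close>. The
  condition for \<open>im (ker d)\<close> can be stated with \<open>d\<close>, because
  \<open>coim d = coker (ker d)\<close> annihilates the same morphisms as \<open>d\<close>.\<close>

lemma image_pullback_factors:
  assumes S: "commutative_square C S" and r: "sq_right S = ker d" and d: "d \<in> Arr C"
  shows "mono_arr C (im C (ker d) \<cdot> l_right C S)" "Cod C (im C (ker d) \<cdot> l_right C S) = Dom C d"
    and "\<And>x. x \<in> Arr C \<Longrightarrow> Cod C x = Dom C d \<Longrightarrow>
      factors C (im C (ker d) \<cdot> l_right C S) x \<longleftrightarrow> d \<cdot> x \<in> Null C \<and> coker (sq_bot S) \<cdot> x \<in> Null C"
proof -
  note F = commutative_squareD [OF S] is_kernelD [OF l_right_kernel [OF S]] r d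
  show "mono_arr C (im C (ker d) \<cdot> l_right C S)"
    by (rule mono_comp) (use F is_kernel_mono [OF l_right_kernel [OF S]] in simp_all)
  show "Cod C (im C (ker d) \<cdot> l_right C S) = Dom C d" using F by simp
  fix x assume x: "x \<in> Arr C" "Cod C x = Dom C d"
  have "factors C (im C (ker d) \<cdot> l_right C S) x \<longleftrightarrow> coker (ker d) \<cdot> x \<in> Null C \<and> coker (sq_bot S) \<cdot> x \<in> Null C"
    by (rule factors_kernel_comp [OF im_kernel l_right_kernel [OF S]]) (use F x in simp_all)
  then show "factors C (im C (ker d) \<cdot> l_right C S) x \<longleftrightarrow> d \<cdot> x \<in> Null C \<and> coker (sq_bot S) \<cdot> x \<in> Null C"
    using null_coim_iff [OF d x] by (simp add: coim_def)
qed

text \<open>Both subobjects of B consist of the \<open>x\<close> annihilated by \<open>b\<close> and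
  by \<open>coker f\<close>. For \<open>ker b \<cdot> ker xi\<close> this uses
  \<open>ker b_check \<cdot> xi = coker f \<cdot> ker b\<close>, where \<open>ker b_check\<close>
  reflects null morphisms.\<close>

lemma pb_S0_iso:
    "lifts C (ker b \<cdot> ker (xi C D)) (im C (ker b) \<cdot> l_right C (sq_S0 C D))" "is_iso C (pb_S0_iso C D)"
proof -
  note P = image_pullback_factors [OF squares_commute(3), of b]
  have k: "mono_arr C (ker b \<cdot> ker (xi C D))" by (rule mono_comp) simp_all
  have l: "mono_arr C (im C (ker b) \<cdot> l_right C (sq_S0 C D))" using P by simp
  have "factors C (ker b \<cdot> ker (xi C D)) x \<longleftrightarrow> b \<cdot> x \<in> Null C \<and> coker f \<cdot> x \<in> Null C"
    if "x \<in> Arr C" "Cod C x = Dom C g" for x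
  proof (rule factors_kernel_comp [OF ker_choice ker_choice])
    fix y assume y: "y \<in> Arr C" "Cod C y = Dom C (ker b)"
    show "xi C D \<cdot> y \<in> Null C \<longleftrightarrow> coker f \<cdot> ker b \<cdot> y \<in> Null C"
      using ker_reflects_null [of "b_check C D" "xi C D \<cdot> y"] null_left [of "xi C D \<cdot> y" "ker (b_check C D)"] y
        reassoc [OF xi_eq, of y] by auto
  qed (use that in simp_all)
  then have "factors C (ker b \<cdot> ker (xi C D)) x \<longleftrightarrow> factors C (im C (ker b) \<cdot> l_right C (sq_S0 C D)) x"
    if "x \<in> Arr C" "Cod C x = Dom C g" for x
    using P(3) [of x] that by simp
  then show "lifts C (ker b \<cdot> ker (xi C D)) (im C (ker b) \<cdot> l_right C (sq_S0 C D))" "is_iso C (pb_S0_iso C D)"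
    unfolding pb_S0_iso_def using factors_iso [OF k l] P(2) by simp_all
qed

text \<open>The bottom side of \<open>sq_S2\<close> is \<open>coker f\<close>, whose own cokernel is
  null, so intersecting with its image leaves the whole of \<open>Ker b_check\<close>.\<close>

lemma pb_S2_iso:
    "lifts C (ker (b_check C D)) (im C (ker (b_check C D)) \<cdot> l_right C (sq_S2 C D))" "is_iso C (pb_S2_iso C D)"
proof -
  note P = image_pullback_factors [OF squares_commute(7), of "b_check C D"]
  have k: "mono_arr C (ker (b_check C D))" by simp
  have l: "mono_arr C (im C (ker (b_check C D)) \<cdot> l_right C (sq_S2 C D))" using P by simp
  have n: "coker (coker f) \<in> Null C"
    by (rule coker_reflects_null [of f]) simp_all
  have "factors C (ker (b_check C D)) x \<longleftrightarrow> factors C (im C (ker (b_check C D)) \<cdot> l_right C (sq_S2 C D)) x"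
    if "x \<in> Arr C" "Cod C x = Cod C (coker f)" for x
    using P(3) [of x] factors_kernel [OF ker_choice, of "b_check C D" x] null_right [OF n, of x] that by simp
  then show "lifts C (ker (b_check C D)) (im C (ker (b_check C D)) \<cdot> l_right C (sq_S2 C D))" "is_iso C (pb_S2_iso C D)"
    unfolding pb_S2_iso_def using factors_iso [OF k l] P(2) by simp_all
qed

lemma pb_S0_typing [simp]: "pb_S0_iso C D \<in> Arr C" "Dom C (pb_S0_iso C D) = Dom C (l_right C (sq_S0 C D))"
    "Cod C (pb_S0_iso C D) = Dom C (ker (xi C D))"
  and pb_S0_eq: "ker b \<cdot> ker (xi C D) \<cdot> pb_S0_iso C D = im C (ker b) \<cdot> l_right C (sq_S0 C D)"
  using is_liftD [OF liftsD [OF pb_S0_iso(1)], folded pb_S0_iso_def]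
    is_kernelD [OF l_right_kernel [OF squares_commute(3)]] by simp_all

lemma pb_S2_typing [simp]: "pb_S2_iso C D \<in> Arr C" "Dom C (pb_S2_iso C D) = Dom C (l_right C (sq_S2 C D))"
    "Cod C (pb_S2_iso C D) = Dom C (ker (b_check C D))"
  and pb_S2_eq: "ker (b_check C D) \<cdot> pb_S2_iso C D = im C (ker (b_check C D)) \<cdot> l_right C (sq_S2 C D)"
  using is_liftD [OF liftsD [OF pb_S2_iso(1)], folded pb_S2_iso_def]
    is_kernelD [OF l_right_kernel [OF squares_commute(7)]] by simp_all

lemma pb_S0_lam: "pb_S0_iso C D \<cdot> lam C (sq_S0 C D) = lambda C D"
proof (rule mono_arr_cancel [of C "ker b \<cdot> ker (xi C D)"])
  show "mono_arr C (ker b \<cdot> ker (xi C D))" by (rule mono_comp) simp_all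
  note L = lam_typing [OF squares_commute(3)] is_kernelD [OF l_right_kernel [OF squares_commute(3)]]
  have "(ker b \<cdot> ker (xi C D) \<cdot> pb_S0_iso C D) \<cdot> lam C (sq_S0 C D) = ker b \<cdot> f_hat C D"
    unfolding pb_S0_eq using L by simp
  then show "(ker b \<cdot> ker (xi C D)) \<cdot> pb_S0_iso C D \<cdot> lam C (sq_S0 C D) = (ker b \<cdot> ker (xi C D)) \<cdot> lambda C D"
    using L by (simp add: lambda_eq)
qed (use lam_typing [OF squares_commute(3)] in simp_all)

lemma pb_S2_lam: "pb_S2_iso C D \<cdot> lam C (sq_S2 C D) = xi C D"
proof (rule mono_arr_cancel [of C "ker (b_check C D)"])
  note L = lam_typing [OF squares_commute(7)] is_kernelD [OF l_right_kernel [OF squares_commute(7)]]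
  have "(ker (b_check C D) \<cdot> pb_S2_iso C D) \<cdot> lam C (sq_S2 C D) = ker (b_check C D) \<cdot> xi C D"
    unfolding pb_S2_eq using L by simp
  then show "ker (b_check C D) \<cdot> pb_S2_iso C D \<cdot> lam C (sq_S2 C D) = ker (b_check C D) \<cdot> xi C D"
    using L by simp
qed (use lam_typing [OF squares_commute(7)] in simp_all)

lemma Im_S0_iso [simp]: "induces_on_coker C (lam C (sq_S0 C D)) (lambda C D) (pb_S0_iso C D)"
    "is_iso C (Im_S0_iso C D)" "Im_S0_iso C D \<in> Arr C"
    "Dom C (Im_S0_iso C D) = Cod C (coker (lam C (sq_S0 C D)))"
    "Cod C (Im_S0_iso C D) = Cod C (coker (lambda C D))"
  unfolding Im_S0_iso_def
  by (rule on_coker_iso [OF pb_S0_iso(2)]; use lam_typing [OF squares_commute(3)] pb_S0_lam in simp)+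

lemma Im_S2_iso [simp]: "induces_on_coker C (lam C (sq_S2 C D)) (xi C D) (pb_S2_iso C D)"
    "is_iso C (Im_S2_iso C D)" "Im_S2_iso C D \<in> Arr C"
    "Dom C (Im_S2_iso C D) = Cod C (coker (lam C (sq_S2 C D)))"
    "Cod C (Im_S2_iso C D) = Cod C (coker (xi C D))"
  and Im_S2_eq: "Im_S2_iso C D \<cdot> coker (lam C (sq_S2 C D)) = coker (xi C D) \<cdot> pb_S2_iso C D"
  unfolding Im_S2_iso_def
  by (rule on_coker_iso [OF pb_S2_iso(2)]; use lam_typing [OF squares_commute(7)] pb_S2_lam in simp)+

lemma po_T_iso:
  "colifts C (coker (xip C D) \<cdot> coker b) (r_left C (sq_T0 C D) \<cdot> coim C (coker b))" "is_iso C (po_T0_iso C D)"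
  "colifts C (coker (b_hat C D)) (r_left C (sq_T2 C D) \<cdot> coim C (coker (b_hat C D)))" "is_iso C (po_T2_iso C D)"
  using lambek_diagram.pb_S0_iso [OF opp_diagram] lambek_diagram.pb_S2_iso [OF opp_diagram] by simp_all

lemma Im_iso_opp: "Im_S0_iso (opp C) (opd D) = Ker_T0_iso C D" "Im_S2_iso (opp C) (opd D) = Ker_T2_iso C D"
  by (simp_all add: Im_S0_iso_def Im_S2_iso_def Ker_T0_iso_def Ker_T2_iso_def lam_opp)

lemma Ker_T0_iso [simp]: "induces_on_ker C (lambdap C D) (rho C (sq_T0 C D)) (po_T0_iso C D)"
    "is_iso C (Ker_T0_iso C D)" "Ker_T0_iso C D \<in> Arr C"
    "Cod C (Ker_T0_iso C D) = Dom C (ker (rho C (sq_T0 C D)))"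
    "Dom C (Ker_T0_iso C D) = Dom C (ker (lambdap C D))"
  using lambek_diagram.Im_S0_iso [OF opp_diagram] by (simp_all add: Im_iso_opp lam_opp)

lemma Ker_T2_iso [simp]: "induces_on_ker C (xip C D) (rho C (sq_T2 C D)) (po_T2_iso C D)"
    "is_iso C (Ker_T2_iso C D)" "Ker_T2_iso C D \<in> Arr C"
    "Cod C (Ker_T2_iso C D) = Dom C (ker (rho C (sq_T2 C D)))"
    "Dom C (Ker_T2_iso C D) = Dom C (ker (xip C D))"
  using lambek_diagram.Im_S2_iso [OF opp_diagram] by (simp_all add: Im_iso_opp lam_opp)

text \<open>Both subobjects of Coker f are cut out by nullness of \<open>flat f g \<cdot> x\<close>
  and of \<open>b_check \<cdot> x\<close>, imposed in opposite orders: \<open>Ker eta\<close> starts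
  from \<open>b_check\<close>, while \<open>Ker h\<close> starts from the homology, seen as
  \<open>Ker (flat f g)\<close>.\<close>

lemma ker_h_iso:
    "lifts C (ker (b_check C D) \<cdot> ker (eta C D)) (ker (flat C f g) \<cdot> homology_iso C f g \<cdot> ker (h_arr C D))"
    "is_iso C (ker_h_iso C D)"
proof -
  let ?m = "homology_iso C f g" and ?m' = "homology_iso C f' g'"
  have k: "mono_arr C (ker (b_check C D) \<cdot> ker (eta C D))" by (rule mono_comp) simp_all
  \<comment> \<open>\<open>h\<close> lives on the cokernel form of the homology;
    \<open>homology_iso\<close> moves its kernel to the kernel form, which is a subobject of Coker
    f.\<close>
  have mh: "is_kernel C (?m \<cdot> ker (h_arr C D)) (h_arr C D \<cdot> inv_arr C ?m)"
    using kernel_shift [OF ker_choice iso_inv [OF row_homology(3)], of "h_arr C D"] by simp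
  have l: "mono_arr C (ker (flat C f g) \<cdot> ?m \<cdot> ker (h_arr C D))"
    by (rule mono_comp) (simp_all add: is_kernel_mono [OF mh])
  have 1: "factors C (ker (b_check C D) \<cdot> ker (eta C D)) x \<longleftrightarrow> b_check C D \<cdot> x \<in> Null C \<and> flat C f g \<cdot> x \<in> Null C"
    if "x \<in> Arr C" "Cod C x = Cod C (coker f)" for x
  proof (rule factors_kernel_comp [OF ker_choice ker_choice])
    fix y assume y: "y \<in> Arr C" "Cod C y = Dom C (ker (b_check C D))"
    show "eta C D \<cdot> y \<in> Null C \<longleftrightarrow> flat C f g \<cdot> ker (b_check C D) \<cdot> y \<in> Null C"
      using ker_reflects_null [of c "eta C D \<cdot> y"] null_left [of "eta C D \<cdot> y" "ker c"] y
        reassoc [OF eta_eq, of y] by auto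
  qed (use that in simp_all)
  have 2: "factors C (ker (flat C f g) \<cdot> ?m \<cdot> ker (h_arr C D)) x \<longleftrightarrow> flat C f g \<cdot> x \<in> Null C \<and> b_check C D \<cdot> x \<in> Null C"
    if "x \<in> Arr C" "Cod C x = Cod C (coker f)" for x
  proof (rule factors_kernel_comp [OF ker_choice mh])
    fix y assume y: "y \<in> Arr C" "Cod C y = Dom C (ker (flat C f g))"
    let ?hy = "h_arr C D \<cdot> inv_arr C ?m \<cdot> y"
    \<comment> \<open>Naturality trades \<open>h\<close> for \<open>h_right\<close>, whose nullness
      is then tested through the kernel \<open>ker (flat f' g')\<close>, where it becomes a
      condition on \<open>b_check\<close>.\<close>
    have e1: "?m' \<cdot> ?hy = h_right \<cdot> y"
      using reassoc [OF homology_iso_natural, of "inv_arr C ?m \<cdot> y"] iso_cancel(4) [OF row_homology(3) y(1)] y by simp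
    have "?hy \<in> Null C \<longleftrightarrow> ?m' \<cdot> ?hy \<in> Null C"
      using iso_reflects_null [OF row_homology(4), of ?hy] null_left [of ?hy ?m'] y by auto
    also have "\<dots> \<longleftrightarrow> ker (flat C f' g') \<cdot> h_right \<cdot> y \<in> Null C"
      unfolding e1
      using ker_reflects_null [of "flat C f' g'" "h_right \<cdot> y"] null_left [of "h_right \<cdot> y" "ker (flat C f' g')"] y by auto
    also have "ker (flat C f' g') \<cdot> h_right \<cdot> y = b_check C D \<cdot> ker (flat C f g) \<cdot> y"
      using reassoc [OF h_right_eq, of y] y by simp
    finally show "(h_arr C D \<cdot> inv_arr C ?m) \<cdot> y \<in> Null C \<longleftrightarrow> b_check C D \<cdot> ker (flat C f g) \<cdot> y \<in> Null C"
      using y by simp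
  qed (use that in simp_all)
  show "lifts C (ker (b_check C D) \<cdot> ker (eta C D)) (ker (flat C f g) \<cdot> ?m \<cdot> ker (h_arr C D))"
    "is_iso C (ker_h_iso C D)"
    unfolding ker_h_iso_def using 1 2 by (intro factors_iso [OF k l]; auto)+
qed

text \<open>Not the dual of \<open>ker_h_iso\<close>, because duality would turn \<open>h\<close>
  into the morphism of the kernel forms. The cokernel form of the homology is already a quotient of
  \<open>Ker g'\<close>, so \<open>Coker h\<close> is reached without \<open>homology_iso\<close>.
  The comparison takes place in the opposite category; the two conditions are that \<open>x\<close>
  annihilates \<open>b_hat\<close> and \<open>sharp f' g'\<close>.\<close>

lemma coker_h_iso:
    "colifts C (coker (etap C D) \<cdot> coker (b_hat C D)) (coker (h_arr C D) \<cdot> coker (sharp C f' g'))"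
    "is_iso C (coker_h_iso C D)"
proof -
  note op = homological_opp
  have k: "mono_arr (opp C) (coker (etap C D) \<cdot> coker (b_hat C D))"
    using homological_category_with_choices.mono_comp [OF op, of "coker (b_hat C D)" "coker (etap C D)"] by simp
  have l: "mono_arr (opp C) (coker (h_arr C D) \<cdot> coker (sharp C f' g'))"
    using homological_category_with_choices.mono_comp [OF op, of "coker (sharp C f' g')" "coker (h_arr C D)"] by simp
  have 1: "factors (opp C) (coker (etap C D) \<cdot> coker (b_hat C D)) x \<longleftrightarrow> x \<cdot> b_hat C D \<in> Null C \<and> x \<cdot> sharp C f' g' \<in> Null C"
    if x: "x \<in> Arr C" "Dom C x = Dom C (ker g')" for x
  proof -
    have "y \<cdot> etap C D \<in> Null C \<longleftrightarrow> y \<cdot> coker (b_hat C D) \<cdot> sharp C f' g' \<in> Null C"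
      if y: "y \<in> Arr C" "Dom C y = Cod C (coker (b_hat C D))" for y
      unfolding etap_eq [symmetric]
      using coker_reflects_null [of a "y \<cdot> etap C D"] null_right [of "y \<cdot> etap C D" "coker a"] y by auto
    then show ?thesis
      using homological_category_with_choices.factors_kernel_comp [OF op, of "coker (b_hat C D)" "b_hat C D" "coker (etap C D)" "etap C D" "sharp C f' g'" x] x
      by (simp add: coker_choice)
  qed
  have 2: "factors (opp C) (coker (h_arr C D) \<cdot> coker (sharp C f' g')) x \<longleftrightarrow> x \<cdot> sharp C f' g' \<in> Null C \<and> x \<cdot> b_hat C D \<in> Null C"
    if x: "x \<in> Arr C" "Dom C x = Dom C (ker g')" for x
  proof -
    have "y \<cdot> h_arr C D \<in> Null C \<longleftrightarrow> y \<cdot> coker (sharp C f' g') \<cdot> b_hat C D \<in> Null C"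
      if y: "y \<in> Arr C" "Dom C y = Cod C (coker (sharp C f' g'))" for y
      unfolding h_arr_eq [symmetric]
      using coker_reflects_null [of "sharp C f g" "y \<cdot> h_arr C D"] null_right [of "y \<cdot> h_arr C D" "coker (sharp C f g)"] y by auto
    then show ?thesis
      using homological_category_with_choices.factors_kernel_comp [OF op, of "coker (sharp C f' g')" "sharp C f' g'" "coker (h_arr C D)" "h_arr C D" "b_hat C D" x] x
      by (simp add: coker_choice)
  qed
  have "lifts (opp C) (coker (etap C D) \<cdot> coker (b_hat C D)) (coker (h_arr C D) \<cdot> coker (sharp C f' g'))"
    "is_iso (opp C) (lift (opp C) (coker (etap C D) \<cdot> coker (b_hat C D)) (coker (h_arr C D) \<cdot> coker (sharp C f' g')))"
    using 1 2 by (intro homological_category_with_choices.factors_iso [OF op k l]; auto)+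
  then show "colifts C (coker (etap C D) \<cdot> coker (b_hat C D)) (coker (h_arr C D) \<cdot> coker (sharp C f' g'))"
    "is_iso C (coker_h_iso C D)" by (simp_all add: coker_h_iso_def)
qed

lemma ker_h_iso_typing [simp]: "ker_h_iso C D \<in> Arr C" "Dom C (ker_h_iso C D) = Dom C (ker (h_arr C D))"
    "Cod C (ker_h_iso C D) = Dom C (ker (eta C D))"
  using is_liftD [OF liftsD [OF ker_h_iso(1)], folded ker_h_iso_def] by simp_all

lemma coker_h_iso_typing [simp]: "coker_h_iso C D \<in> Arr C" "Cod C (coker_h_iso C D) = Cod C (coker (h_arr C D))"
    "Dom C (coker_h_iso C D) = Cod C (coker (etap C D))"
  using is_coliftD [OF coliftsD [OF coker_h_iso(1)], folded coker_h_iso_def] by simp_all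

lemma identifications: "identifications_well_defined C D"
  unfolding identifications_well_defined_def
  by (simp add: ker_h_iso coker_h_iso pb_S0_iso pb_S2_iso po_T_iso)

lemma lambdap_typing [simp]: "colifts C (coker (xip C D)) (gp_check C D)" "lambdap C D \<in> Arr C"
    "Cod C (lambdap C D) = Cod C (coker c)" "Dom C (lambdap C D) = Cod C (coker (xip C D))"
  and mup_typing [simp]: "colifts C (coker (xip C D \<cdot> etap C D)) (coker (xip C D))" "mup C D \<in> Arr C"
    "Cod C (mup C D) = Cod C (coker (xip C D))" "Dom C (mup C D) = Cod C (coker (xip C D \<cdot> etap C D))"
  and u_arr_typing [simp]: "induces_on_coker C (etap C D) (xip C D \<cdot> etap C D) (xip C D)" "u_arr C D \<in> Arr C"
    "Cod C (u_arr C D) = Cod C (coker (xip C D \<cdot> etap C D))" "Dom C (u_arr C D) = Cod C (coker (etap C D))"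
  and pp_pre_typing [simp]: "induces_on_ker C (lambdap C D \<cdot> mup C D) (lambdap C D) (mup C D)" "pp_pre C D \<in> Arr C"
    "Cod C (pp_pre C D) = Dom C (ker (lambdap C D))" "Dom C (pp_pre C D) = Dom C (ker (lambdap C D \<cdot> mup C D))"
  and kappap_pre_typing [simp]: "lifts C (ker (lambdap C D \<cdot> mup C D)) (u_arr C D)" "kappap_pre C D \<in> Arr C"
    "Cod C (kappap_pre C D) = Dom C (ker (lambdap C D \<cdot> mup C D))" "Dom C (kappap_pre C D) = Cod C (coker (etap C D))"
  using lambek_diagram.lambda_typing [OF opp_diagram] lambek_diagram.mu_typing [OF opp_diagram]
    lambek_diagram.v_arr_typing [OF opp_diagram] lambek_diagram.p_pre_typing [OF opp_diagram]
    lambek_diagram.kappa_pre_typing [OF opp_diagram] by simp_all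

text \<open>On this side \<open>Ker (lambdap \<cdot> mup)\<close> is the kernel form of the
  homology, whence the factor \<open>homology_iso fp_check gp_check\<close> or its inverse in
  \<open>pp_arr\<close> and \<open>kappap\<close>.\<close>

lemma mup_lambdap: "lambdap C D \<cdot> mup C D = flat C (fp_check C D) (gp_check C D)"
  using lambek_diagram.mu_lambda [OF opp_diagram] by simp

lemma sequence_arrows: "sequence_arrows_well_defined C D"
  unfolding sequence_arrows_well_defined_def
  by (simp add: Lambek_S_T Lambek_S_S1 Lambek_S2_S1 Lambek_T1_T Lambek_T1_T2)

lemma kappap_pp_null: "pp_pre C D \<cdot> kappap_pre C D \<in> Null C"
  using lambek_diagram.kappa_p_null [OF opp_diagram] by simp

lemma kappap_betap_null: "kappap_pre C D \<cdot> coker (etap C D) \<cdot> ker (xip C D) \<in> Null C"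
  using lambek_diagram.beta_kappa_null [OF opp_diagram] by simp

section \<open>The connecting morphisms\<close>

text \<open>\<beta> before the identification of \<open>Ker h\<close>. This part has
  \<open>betap_pre\<close> as its exact dual, whereas \<open>ker_h_iso\<close> and
  \<open>coker_h_iso\<close> are not dual to each other.\<close>

definition beta_pre :: 'm where
  "beta_pre = inv_arr C (Lambek_h C (sq_S D) (sq_S1 C D)) \<cdot> Lambek_v C (sq_S2 C D) (sq_S1 C D) \<cdot>
     inv_arr C (Im_S2_iso C D) \<cdot> coker (xi C D) \<cdot> ker (eta C D)"

definition betap_pre :: 'm where
  "betap_pre = coker (etap C D) \<cdot> ker (xip C D) \<cdot> inv_arr C (Ker_T2_iso C D) \<cdot>
     Lambek_v C (sq_T1 C D) (sq_T2 C D) \<cdot> inv_arr C (Lambek_h C (sq_T1 C D) (sq_T D))"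

lemma beta_pre_typing [simp]: "beta_pre \<in> Arr C" "Dom C beta_pre = Dom C (ker (eta C D))"
    "Cod C beta_pre = Cod C (coker (lam C (sq_S D)))"
  by (simp_all add: beta_pre_def)

lemma betap_pre_typing [simp]: "betap_pre \<in> Arr C" "Cod C betap_pre = Cod C (coker (etap C D))"
    "Dom C betap_pre = Dom C (ker (rho C (sq_T D)))"
  by (simp_all add: betap_pre_def)

text \<open>\<open>flat f g\<close> is \<open>im g \<cdot> bar g \<cdot> t\<close>. Since
  \<open>g\<close> is not assumed exact, \<open>bar g\<close> cannot be inverted, and both outer
  factors are removed by reflection of null morphisms.\<close>

lemma flat_null_coim:
  assumes "y \<in> Arr C" "Cod C y = Cod C (coker f)" "flat C f g \<cdot> y \<in> Null C"
    and t: "is_colift C (coker f) (coim C g) t"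
  shows "t \<cdot> y \<in> Null C"
proof -
  note T = is_coliftD [OF t]
  have e: "im C g \<cdot> bar C g \<cdot> t = flat C f g"
    by (rule epi_arr_cancel [of C "coker f"]) (use T in simp_all)
  have "im C g \<cdot> bar C g \<cdot> t \<cdot> y \<in> Null C"
    using assms(3) unfolding e [symmetric] using T assms(1,2) by simp
  then have "bar C g \<cdot> t \<cdot> y \<in> Null C"
    by (rule im_reflects_null [rotated 3]) (use T assms(1,2) in simp_all)
  then show ?thesis by (rule bar_reflects_null [rotated 3]) (use T assms(1,2) in simp_all)
qed

text \<open>\<open>n\<close> below is the quotient \<open>N\<^bsub>S\<^sub>1\<^esub> \<rightarrow> N\<^sub>T\<close> induced by \<open>t : Coker f \<rightarrow> Coim g\<close>.\<close>

lemma Lambda_beta_null: "Lambda C D \<cdot> beta_pre \<in> Null C"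
proof -
  let ?S = "sq_S D" and ?T = "sq_T D" and ?S1 = "sq_S1 C D" and ?S2 = "sq_S2 C D"
  let ?L1 = "Lambek_h C ?S ?S1" and ?L2 = "Lambek_v C ?S2 ?S1" and ?q = "coker f"
  let ?i = "inv_arr C (bar C b)" and ?i' = "inv_arr C (bar C ?q)" and ?I = "inv_arr C (Im_S2_iso C D)"
  let ?P = "inv_arr C (pb_S2_iso C D)" and ?ke = "ker (eta C D)"
  note LS = is_kernelD [OF l_right_kernel [OF squares_commute(1)]]
  note LS2 = is_kernelD [OF l_right_kernel [OF squares_commute(7)]] is_kernelD [OF l_bot_kernel [OF squares_commute(7)]]
    is_pullbackD [OF square_pullback [OF squares_commute(7)]]
  note RS1 = is_pullbackD [OF square_pushout [OF squares_commute(5), folded is_pullback_opp]]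
  note RT = is_pullbackD [OF square_pushout [OF squares_commute(2), folded is_pullback_opp]]
  note R1 = rho_typing [OF squares_commute(5)] and R2 = rho_typing [OF squares_commute(2)]
  note pbi = pb_S2_iso(2)
  have "coim C g \<cdot> f \<in> Null C" using null_coim_iff [of g f] by simp
  then obtain t where t: "is_colift C ?q (coim C g) t"
    using coliftsD [OF coker_colift(1), of f "coim C g"] by auto
  note T = is_coliftD [OF t]
  \<comment> \<open>\<open>?j \<cdot> coim ?q = ?q\<close>, so \<open>?v \<cdot> coim ?q\<close> is
    \<open>r_top ?T \<cdot> coim g\<close>, which equals \<open>r_left ?T \<cdot> coim b\<close> by
    the pushout of \<open>sq_T\<close>. This is the compatibility that produces
    \<open>n\<close>.\<close>
  let ?j = "im C ?q \<cdot> bar C ?q"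
  let ?v = "r_top C ?T \<cdot> t \<cdot> ?j"
  have "r_left C ?T \<cdot> coim C b = ?v \<cdot> coim C ?q"
    using RT T by simp
  then have "\<exists>n. is_colift C (r_left C ?S1) (r_left C ?T) n \<and> is_colift C (r_top C ?S1) ?v n"
    using is_pullback_ex1 [OF square_pushout [OF squares_commute(5), folded is_pullback_opp], of "r_left C ?T" ?v] RT T
    by auto
  then obtain n where n: "is_colift C (r_left C ?S1) (r_left C ?T) n" "is_colift C (r_top C ?S1) ?v n" by blast
  note N = is_coliftD [OF n(1)] is_coliftD [OF n(2)]
  \<comment> \<open>Precomposed with \<open>coker (lam ?S)\<close> and followed by the kernels of
    \<open>rho\<close>, both Lambek morphisms become \<open>?i \<cdot> l_right ?S\<close> followed
    by a coprojection, and \<open>n\<close> carries \<open>r_left ?S1\<close> to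
    \<open>r_left ?T\<close>.\<close>
  have step1: "ker (rho C ?T) \<cdot> Lambda C D = n \<cdot> ker (rho C ?S1) \<cdot> ?L1"
  proof (rule epi_arr_cancel [of C "coker (lam C ?S)"])
    have "n \<cdot> r_left C ?S1 \<cdot> ?i \<cdot> l_right C ?S = r_left C ?T \<cdot> ?i \<cdot> l_right C ?S"
      using reassoc [OF N(4), of "?i \<cdot> l_right C ?S"] N RS1 LS by simp
    then show "(ker (rho C ?T) \<cdot> Lambda C D) \<cdot> coker (lam C ?S) = (n \<cdot> ker (rho C ?S1) \<cdot> ?L1) \<cdot> coker (lam C ?S)"
      using Lambek_h_typing(4) [OF Lambek_S_T] Lambek_h_typing(4) [OF Lambek_S_S1] N R1 by (simp add: Lambda_def)
  qed (use N R1 R2 in \<open>simp_all add: Lambda_def\<close>)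
  \<comment> \<open>Trades \<open>coker xi\<close> for \<open>coker (lam ?S2)\<close>, after which
    the defining equation of \<open>Lambek_v\<close> applies.\<close>
  have Icx: "?I \<cdot> coker (xi C D) = coker (lam C ?S2) \<cdot> ?P"
  proof (rule epi_arr_cancel [of C "pb_S2_iso C D"])
    show "epi_arr C (pb_S2_iso C D)" by (rule iso_epi [OF pbi])
    show "(?I \<cdot> coker (xi C D)) \<cdot> pb_S2_iso C D = (coker (lam C ?S2) \<cdot> ?P) \<cdot> pb_S2_iso C D"
      using Im_S2_eq [symmetric] iso_cancel [OF Im_S2_iso(2)] iso_cancel [OF pbi] pbi LS2 lam_typing [OF squares_commute(7)] by simp
  qed (use pbi LS2 lam_typing [OF squares_commute(7)] in simp_all)
  \<comment> \<open>\<open>?j \<cdot> ?i'\<close> is \<open>im ?q\<close>, and the pullback square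
    of \<open>sq_S2\<close> exchanges \<open>im ?q \<cdot> l_bot ?S2\<close> for
    \<open>im (ker b_check) \<cdot> l_right ?S2\<close>, which is
    \<open>ker b_check \<cdot> pb_S2_iso\<close>.\<close>
  have z: "?j \<cdot> ?i' \<cdot> l_bot C ?S2 \<cdot> ?P = ker (b_check C D)"
  proof -
    have "?j \<cdot> ?i' \<cdot> l_bot C ?S2 \<cdot> ?P = (im C ?q \<cdot> l_bot C ?S2) \<cdot> ?P"
      using iso_cancel [OF coker_f_iso] pbi LS2 by simp
    also have "\<dots> = (ker (b_check C D) \<cdot> pb_S2_iso C D) \<cdot> ?P"
      unfolding pb_S2_eq using LS2 by simp
    also have "\<dots> = ker (b_check C D)" using iso_cancel [OF pbi] pbi by simp
    finally show ?thesis .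
  qed
  have "ker (rho C ?T) \<cdot> Lambda C D \<cdot> beta_pre = n \<cdot> ker (rho C ?S1) \<cdot> ?L1 \<cdot> beta_pre"
    using reassoc [OF step1, of beta_pre] N R1 R2 by (simp add: Lambda_def)
  also have "?L1 \<cdot> beta_pre = ?L2 \<cdot> (?I \<cdot> coker (xi C D)) \<cdot> ?ke"
    unfolding beta_pre_def using iso_cancel [OF Lambek_S_S1_iso] by simp
  also have "n \<cdot> ker (rho C ?S1) \<cdot> ?L2 \<cdot> (?I \<cdot> coker (xi C D)) \<cdot> ?ke
      = n \<cdot> (ker (rho C ?S1) \<cdot> ?L2 \<cdot> coker (lam C ?S2)) \<cdot> ?P \<cdot> ?ke"
    unfolding Icx using N R1 pbi LS2 lam_typing [OF squares_commute(7)] by simp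
  also have "\<dots> = (n \<cdot> r_top C ?S1) \<cdot> ?i' \<cdot> l_bot C ?S2 \<cdot> ?P \<cdot> ?ke"
    unfolding Lambek_v_typing(4) [OF Lambek_S2_S1] using N(1-3,5-7) R1 pbi LS2 RS1 by simp
  also have "\<dots> = r_top C ?T \<cdot> t \<cdot> (?j \<cdot> ?i' \<cdot> l_bot C ?S2 \<cdot> ?P) \<cdot> ?ke"
    unfolding N(8) using RT T pbi LS2 by simp
  also have "\<dots> = r_top C ?T \<cdot> t \<cdot> ker (b_check C D) \<cdot> ?ke"
    unfolding z ..
  finally have e: "ker (rho C ?T) \<cdot> Lambda C D \<cdot> beta_pre = r_top C ?T \<cdot> t \<cdot> ker (b_check C D) \<cdot> ?ke" .
  have "ker c \<cdot> eta C D \<cdot> ?ke \<in> Null C" by (rule null_left) simp_all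
  then have "flat C f g \<cdot> ker (b_check C D) \<cdot> ?ke \<in> Null C" using reassoc [OF eta_eq, of ?ke] by simp
  then have "t \<cdot> ker (b_check C D) \<cdot> ?ke \<in> Null C"
    by (intro flat_null_coim [OF _ _ _ t]) simp_all
  then have "r_top C ?T \<cdot> t \<cdot> ker (b_check C D) \<cdot> ?ke \<in> Null C"
    by (rule null_left) (use RT T in simp_all)
  then show ?thesis unfolding e [symmetric]
    by (rule ker_reflects_null [rotated 3]) (simp_all add: Lambda_def)
qed

lemma beta_pre_opp: "lambek_diagram.beta_pre (opp C) (opd D) = betap_pre"
  unfolding lambek_diagram.beta_pre_def [OF opp_diagram] betap_pre_def
  by (simp add: Im_iso_opp Lambek_h_opp Lambek_v_opp b_exact exact_ker)

lemma Lambda_opp: "Lambda (opp C) (opd D) = Lambda C D"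
  by (simp add: Lambda_def Lambek_h_opp b_exact)

lemma betap_Lambda_null: "betap_pre \<cdot> Lambda C D \<in> Null C"
  using lambek_diagram.Lambda_beta_null [OF opp_diagram] by (simp add: beta_pre_opp Lambda_opp)

lemma Lambda_typing [simp]: "Lambda C D \<in> Arr C" "Dom C (Lambda C D) = Cod C (coker (lam C (sq_S D)))"
    "Cod C (Lambda C D) = Dom C (ker (rho C (sq_T D)))"
  by (simp_all add: Lambda_def)

section \<open>Assembling the null sequence\<close>

lemma check_homology [simp]:
  "is_iso C (homology_iso C (fp_check C D) (gp_check C D))"
  "homology_iso C (fp_check C D) (gp_check C D) \<in> Arr C"
  "Dom C (homology_iso C (fp_check C D) (gp_check C D)) = Cod C (coker (sharp C (fp_check C D) (gp_check C D)))"
  "Cod C (homology_iso C (fp_check C D) (gp_check C D)) = Dom C (ker (flat C (fp_check C D) (gp_check C D)))"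
  by (rule homology_iso; simp)+

lemma arrow_typing:
  "p_arr C D \<in> hom C (Im_sq C (sq_S0 C D)) (homology C (f_hat C D) (g_hat C D))"
  "kappa C D \<in> hom C (homology C (f_hat C D) (g_hat C D)) (Ker C (h_arr C D))"
  "beta C D \<in> hom C (Ker C (h_arr C D)) (Im_sq C (sq_S D))"
  "Lambda C D \<in> hom C (Im_sq C (sq_S D)) (Ker_sq C (sq_T D))"
  "betap C D \<in> hom C (Ker_sq C (sq_T D)) (Coker C (h_arr C D))"
  "kappap C D \<in> hom C (Coker C (h_arr C D)) (homology C (fp_check C D) (gp_check C D))"
  "pp_arr C D \<in> hom C (homology C (fp_check C D) (gp_check C D)) (Ker_sq C (sq_T0 C D))"
  by (simp_all add: hom_def p_arr_def kappa_def beta_def betap_def kappap_def pp_arr_def Im_sq_def Ker_sq_def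
      homology_def Ker_def Coker_def mu_lambda mup_lambdap ker_h_iso(2) coker_h_iso(2))

lemma beta_eq: "beta C D = beta_pre \<cdot> ker_h_iso C D"
  by (simp add: beta_def beta_pre_def)

lemma betap_eq: "betap C D = coker_h_iso C D \<cdot> betap_pre"
  by (simp add: betap_def betap_pre_def)

text \<open>Where consecutive arrows meet at a transported object, one carries an identification and
  the other its inverse, and the two cancel; what remains is an earlier null composite framed by
  further arrows.\<close>

lemma null_composites:
  "kappa C D \<cdot> p_arr C D \<in> Null C" "beta C D \<cdot> kappa C D \<in> Null C" "Lambda C D \<cdot> beta C D \<in> Null C"
  "betap C D \<cdot> Lambda C D \<in> Null C" "kappap C D \<cdot> betap C D \<in> Null C" "pp_arr C D \<cdot> kappap C D \<in> Null C"
proof -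
  note ci = ker_h_iso(2) iso_cancel [OF ker_h_iso(2)] coker_h_iso(2) iso_cancel [OF coker_h_iso(2)]
    iso_cancel [OF check_homology(1)] mu_lambda
  have n: "x \<in> Null C \<Longrightarrow> h \<in> Arr C \<Longrightarrow> k \<in> Arr C \<Longrightarrow> Cod C x = Dom C h \<Longrightarrow> Cod C k = Dom C x \<Longrightarrow> h \<cdot> x \<cdot> k \<in> Null C"
    for x h k using null_left [OF null_right, of x k h] Null_in_Arr by simp
  have "inv_arr C (ker_h_iso C D) \<cdot> (kappa_pre C D \<cdot> p_pre C D) \<cdot> Im_S0_iso C D \<in> Null C"
    by (rule n [OF kappa_p_null]) (use ci in simp_all)
  then show "kappa C D \<cdot> p_arr C D \<in> Null C" by (simp add: kappa_def p_arr_def ci)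
  have "inv_arr C (Lambek_h C (sq_S D) (sq_S1 C D)) \<cdot> Lambek_v C (sq_S2 C D) (sq_S1 C D) \<cdot>
     inv_arr C (Im_S2_iso C D) \<cdot> coker (xi C D) \<cdot> ker (eta C D) \<cdot> kappa_pre C D \<in> Null C"
    by (rule null_left [OF null_left [OF null_left [OF beta_kappa_null]]]) simp_all
  then show "beta C D \<cdot> kappa C D \<in> Null C" by (simp add: kappa_def beta_def ci)
  show "Lambda C D \<cdot> beta C D \<in> Null C"
    using null_right [OF Lambda_beta_null, of "ker_h_iso C D"] by (simp add: beta_eq)
  show "betap C D \<cdot> Lambda C D \<in> Null C"
    using null_left [OF betap_Lambda_null, of "coker_h_iso C D"] by (simp add: betap_eq)
  have "inv_arr C (homology_iso C (fp_check C D) (gp_check C D)) \<cdot> (kappap_pre C D \<cdot> coker (etap C D) \<cdot> ker (xip C D)) \<cdot>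
     inv_arr C (Ker_T2_iso C D) \<cdot> Lambek_v C (sq_T1 C D) (sq_T2 C D) \<cdot> inv_arr C (Lambek_h C (sq_T1 C D) (sq_T D)) \<in> Null C"
    by (rule n [OF kappap_betap_null]) (simp_all add: mup_lambdap)
  then show "kappap C D \<cdot> betap C D \<in> Null C" by (simp add: kappap_def betap_def ci mup_lambdap)
  have "Ker_T0_iso C D \<cdot> (pp_pre C D \<cdot> kappap_pre C D) \<cdot> inv_arr C (coker_h_iso C D) \<in> Null C"
    by (rule n [OF kappap_pp_null]) (use ci in simp_all)
  then show "pp_arr C D \<cdot> kappap C D \<in> Null C"
    by (simp add: kappap_def pp_arr_def ci mup_lambdap)
qed

lemma null_sequence_main:
  "null_sequence C
    [Im_sq C (sq_S0 C D), homology C (f_hat C D) (g_hat C D), Ker C (h_arr C D),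
     Im_sq C (sq_S D), Ker_sq C (sq_T D),
     Coker C (h_arr C D), homology C (fp_check C D) (gp_check C D), Ker_sq C (sq_T0 C D)]
    [p_arr C D, kappa C D, beta C D, Lambda C D, betap C D, kappap C D, pp_arr C D]"
  unfolding null_sequence_def
  using arrow_typing null_composites by (simp add: less_Suc_eq all_conj_distrib numeral_eq_Suc)

text \<open>Only the two ends differ from the general sequence. Composing there with inverse Lambek
  isomorphisms keeps the outermost composites null by the ideal law.\<close>

lemma null_sequence_exact:
  assumes ex: "exact_arrow C f" "exact_arrow C g'"
  shows "null_sequence C
    [Ker_sq C (sq_S D), homology C (f_hat C D) (g_hat C D), Ker C (h_arr C D),
     Im_sq C (sq_S D), Ker_sq C (sq_T D),
     Coker C (h_arr C D), homology C (fp_check C D) (gp_check C D), Im_sq C (sq_T D)]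
    [p1_arr C D, kappa C D, beta C D, Lambda C D, betap C D, kappap C D, pp1_arr C D]"
proof -
  note L = Lambek_S0_S [OF ex(1)] Lambek_T_T0 [OF ex(2)]
    Lambek_v_typing [OF Lambek_S0_S(1) [OF ex(1)]] Lambek_v_typing [OF Lambek_T_T0(1) [OF ex(2)]]
  have t: "p1_arr C D \<in> hom C (Ker_sq C (sq_S D)) (homology C (f_hat C D) (g_hat C D))"
    "pp1_arr C D \<in> hom C (homology C (fp_check C D) (gp_check C D)) (Im_sq C (sq_T D))"
    using L arrow_typing(1,7) by (simp_all add: hom_def p1_arr_def pp1_arr_def Im_sq_def Ker_sq_def Ker_def Coker_def)
  have "kappa C D \<cdot> p1_arr C D \<in> Null C"
    using null_right [OF null_composites(1), of "inv_arr C (Lambek_v C (sq_S0 C D) (sq_S D))"] L arrow_typing(1,2)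
    by (simp add: p1_arr_def hom_def Im_sq_def Coker_def)
  moreover have "pp1_arr C D \<cdot> kappap C D \<in> Null C"
    using null_left [OF null_composites(6), of "inv_arr C (Lambek_v C (sq_T D) (sq_T0 C D))"] L arrow_typing(6,7)
    by (simp add: pp1_arr_def hom_def Ker_sq_def Ker_def)
  ultimately show ?thesis
    unfolding null_sequence_def
    using arrow_typing t null_composites by (simp add: less_Suc_eq all_conj_distrib numeral_eq_Suc)
qed

end

theorem mainTheorem4:
  fixes C :: "('o, 'm, 'x) chosen_category_scheme" and D :: "'m diagram"
  assumes "homological_category_with_choices C"
    and "null_row_diagram C D"
    and "exact_arrow C (col_b D)"
  shows
    "(induced_arrows_well_defined C D \<and>
      (\<forall>Q \<in> {sq_S D, sq_T D, sq_S0 C D, sq_T0 C D, sq_S1 C D, sq_S2 C D, sq_T1 C D, sq_T2 C D}.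
         Lambek_invariants_well_defined C Q) \<and>
      identifications_well_defined C D \<and>
      sequence_arrows_well_defined C D \<and>
      null_sequence C
        [Im_sq C (sq_S0 C D), homology C (f_hat C D) (g_hat C D), Ker C (h_arr C D),
         Im_sq C (sq_S D), Ker_sq C (sq_T D),
         Coker C (h_arr C D), homology C (fp_check C D) (gp_check C D), Ker_sq C (sq_T0 C D)]
        [p_arr C D, kappa C D, beta C D, Lambda C D, betap C D, kappap C D, pp_arr C D]) \<and>
     (exact_arrow C (row_f D) \<and> exact_arrow C (row_gp D) \<longrightarrow>
      Lambek_v_well_defined C (sq_S0 C D) (sq_S D) \<and>
      is_iso C (Lambek_v C (sq_S0 C D) (sq_S D)) \<and>
      Lambek_v_well_defined C (sq_T D) (sq_T0 C D) \<and>
      is_iso C (Lambek_v C (sq_T D) (sq_T0 C D)) \<and>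
      null_sequence C
        [Ker_sq C (sq_S D), homology C (f_hat C D) (g_hat C D), Ker C (h_arr C D),
         Im_sq C (sq_S D), Ker_sq C (sq_T D),
         Coker C (h_arr C D), homology C (fp_check C D) (gp_check C D), Im_sq C (sq_T D)]
        [p1_arr C D, kappa C D, beta C D, Lambda C D, betap C D, kappap C D, pp1_arr C D])"
proof -
  interpret lambek_diagram C D
    using assms by (simp add: lambek_diagram_def lambek_diagram_axioms_def)
  show ?thesis
    using induced_arrows Lambek_invariants squares_commute identifications sequence_arrows null_sequence_main
      Lambek_S0_S Lambek_T_T0 null_sequence_exact by simp
qed

end
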